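(* Let $G$ and $G'$ be framed $4$-graphs, each with exactly two unicursal components, which are related by a finite sequence of first, second and third Reidemeister moves (i.e. they represent the same two-component free link). Then $\{G\}=\{G'\}$ in $\widetilde{\mathbb{Z}_2\mathfrak{G}}$.
   Context: A $4$-graph is a topological space with finitely many components, each either a circle or a finite graph (loops and multiple edges allowed) all of whose vertices have valency four; it is framed if at each vertex the four half-edges are split into two pairs of opposite half-edges. Circle components are called free loops. A unicursal component is a circle component or an equivalence class of edges under the relation generated by: $a\sim b$ if $a,b$ are opposite at some vertex. Smoothing at a vertex $v$ with half-edges $a,b,c,d$, where $a$ is opposite $c$ and $b$ opposite $d$: remove $v$ and reconnect the half-edges either as $(a,b),(c,d)$ or as $(a,d),(b,c)$; the rest of the graph and framing is unchanged. One may smooth at several vertices. Reidemeister moves on framed $4$-graphs: (1) removal/addition of a vertex $v$ with a loop edge whose two ends at $v$ are not opposite; removal deletes $v$ and the loop and joins the two remaining (mutually opposite) half-edges. (2) For vertices $u\ne v$ joined by edges $e_1,e_2$ which are non-opposite at $u$ and non-opposite at $v$: delete $u,v,e_1,e_2$ and join the half-edge opposite $e_1$ at $u$ to the half-edge opposite $e_1$ at $v$, and likewise for $e_2$; or the inverse (which may be applied to any two edges). (3) If three vertices $A,B,C$ and three strands $s_1,s_2,s_3$ (a strand passing straight through a vertex along opposite half-edges) are arranged so that $s_1$ runs $p_1\!-\!A\!-\!B\!-\!q_1$, $s_2$ runs $p_2\!-\!A\!-\!C\!-\!q_2$, $s_3$ runs $p_3\!-\!B\!-\!C\!-\!q_3$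 (with edges $AB,AC,BC$), replace this fragment by one with vertices $A',B',C'$ where $s_1$ runs $p_1\!-\!B'\!-\!A'\!-\!q_1$, $s_2$ runs $p_2\!-\!C'\!-\!A'\!-\!q_2$, $s_3$ runs $p_3\!-\!C'\!-\!B'\!-\!q_3$. These moves preserve the number of unicursal components; a two-component free link is an equivalence class of framed $4$-graphs with two unicursal components modulo these moves. $\widetilde{\mathbb{Z}_2\mathfrak{G}}$ is the $\mathbb{Z}_2$-vector space spanned by equivalence classes of framed $4$-graphs (any number of components) modulo second Reidemeister moves, in which every graph having a circle component is set equal to $0$. For a framed $4$-graph $G$ with two unicursal components, a vertex is called odd if the two strands passing through it belong to different unicursal components, and even otherwise. Define $\{G\}=\sum_s G_s\in\widetilde{\mathbb{Z}_2\mathfrak{G}}$, where the sum is over all states $s$, a state being a choice of one of the two smoothings at every even vertex, and $G_s$ is the framed graph obtained by performing these smoothings (odd vertices are left unchanged). *)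

theory Defs
  imports Main
begin

text \<open>A framed 4-graph is encoded by a finite set of darts (half-edges, labelled by
naturals), a fixed-point-free involution edg pairing the two ends of each edge,
a fixed-point-free involution opp pairing opposite half-edges at a vertex, a
vertex labelling vx (each vertex has exactly four darts, closed under opp), and
the number nloops of free loops (circle components).\<close>

record fgraph =
  darts :: "nat set"
  edg :: "nat \<Rightarrow> nat"
  opp :: "nat \<Rightarrow> nat"
  vx :: "nat \<Rightarrow> nat"
  nloops :: nat

definition wf :: "fgraph \<Rightarrow> bool" where
  "wf G \<longleftrightarrow> finite (darts G) \<and>
     (\<forall>h\<in>darts G. edg G h \<in> darts G \<and> edg G h \<noteq> h \<and> edg G (edg G h) = h) \<and>
     (\<forall>h\<in>darts G. opp G h \<in> darts G \<and> opp G h \<noteq> h \<and> opp G (opp G h) = h) \<and>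
     (\<forall>h\<in>darts G. vx G (opp G h) = vx G h \<and> card {k\<in>darts G. vx G k = vx G h} = 4)"

definition fg_iso :: "fgraph \<Rightarrow> fgraph \<Rightarrow> bool" where
  "fg_iso G H \<longleftrightarrow> nloops G = nloops H \<and>
     (\<exists>f. bij_betw f (darts G) (darts H) \<and>
       (\<forall>h\<in>darts G. f (edg G h) = edg H (f h) \<and> f (opp G h) = opp H (f h) \<and>
          (\<forall>k\<in>darts G. vx G h = vx G k \<longleftrightarrow> vx H (f h) = vx H (f k))))"

text \<open>Reconnection: delete the darts in X (all darts of some vertices) and
re-pair them by the involution s on X; the remaining darts are joined along the
resulting paths, and closed cycles lying entirely in X become new free loops.\<close>
definition conn_rel :: "fgraph \<Rightarrow> nat set \<Rightarrow> (nat \<Rightarrow> nat) \<Rightarrow> (nat \<times> nat) set" where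
  "conn_rel G X s = ({(h, edg G h) | h. h \<in> darts G} \<union> {(h, s h) | h. h \<in> X})\<^sup>*"

definition reconnect :: "fgraph \<Rightarrow> nat set \<Rightarrow> (nat \<Rightarrow> nat) \<Rightarrow> fgraph" where
  "reconnect G X s =
    \<lparr> darts = darts G - X,
      edg = (\<lambda>h. THE k. k \<in> darts G - X \<and> k \<noteq> h \<and> (h, k) \<in> conn_rel G X s),
      opp = opp G,
      vx = vx G,
      nloops = nloops G + card {Q \<in> darts G // conn_rel G X s. Q \<subseteq> X} \<rparr>"

definition r1_remove :: "fgraph \<Rightarrow> fgraph \<Rightarrow> bool" where
  "r1_remove G G' \<longleftrightarrow> wf G \<and> wf G' \<and>
    (\<exists>a b. a \<in> darts G \<and> edg G a = b \<and> vx G b = vx G a \<and> b \<noteq> opp G a \<and>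
       (let X = {a, b, opp G a, opp G b};
            s = (\<lambda>h. if h = a then b else if h = b then a
                      else if h = opp G a then opp G b else if h = opp G b then opp G a else h);
            H = reconnect G X s
        in G' = H\<lparr>nloops := nloops H - 1\<rparr>))"

text \<open>Second move (removal): vertices u = vx x1 and v = vx y1 distinct, joined by
edges e1 = x1--y1 and e2 = x2--y2, non-opposite at u and at v.  The two vertices
and edges are deleted and the strands are joined straight through.\<close>
definition r2_remove :: "fgraph \<Rightarrow> fgraph \<Rightarrow> bool" where
  "r2_remove G G' \<longleftrightarrow> wf G \<and> wf G' \<and>
    (\<exists>x1 x2 y1 y2. x1 \<in> darts G \<and> x2 \<in> darts G \<and>
       edg G x1 = y1 \<and> edg G x2 = y2 \<and>
       vx G x2 = vx G x1 \<and> vx G y2 = vx G y1 \<and> vx G x1 \<noteq> vx G y1 \<and>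
       x2 \<noteq> x1 \<and> x2 \<noteq> opp G x1 \<and> y2 \<noteq> opp G y1 \<and>
       G' = reconnect G {k \<in> darts G. vx G k = vx G x1 \<or> vx G k = vx G y1} (opp G))"

text \<open>Third move.  Strand s1: (opp a1) A a1 -- b1 B (opp b1);
strand s2: (opp a2) A a2 -- c2 C (opp c2); strand s3: (opp b3) B b3 -- c3 C (opp c3).
After the move: s1 passes B' then A', s2 passes C' then A', s3 passes C' then B'.\<close>
definition r3_move :: "fgraph \<Rightarrow> fgraph \<Rightarrow> bool" where
  "r3_move G G' \<longleftrightarrow> wf G \<and> wf G' \<and>
    (\<exists>a1 b1 a2 c2 b3 c3.
       {a1, b1, a2, c2, b3, c3} \<subseteq> darts G \<and>
       edg G a1 = b1 \<and> edg G a2 = c2 \<and> edg G b3 = c3 \<and>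
       vx G a2 = vx G a1 \<and> a2 \<noteq> a1 \<and> a2 \<noteq> opp G a1 \<and>
       vx G b3 = vx G b1 \<and> b3 \<noteq> b1 \<and> b3 \<noteq> opp G b1 \<and>
       vx G c3 = vx G c2 \<and> c3 \<noteq> c2 \<and> c3 \<noteq> opp G c2 \<and>
       vx G a1 \<noteq> vx G b1 \<and> vx G a1 \<noteq> vx G c2 \<and> vx G b1 \<noteq> vx G c2 \<and>
       G' = G\<lparr>vx := (\<lambda>h.
              if h \<in> {b1, opp G b1, c2, opp G c2} then vx G a1
              else if h \<in> {a1, opp G a1, c3, opp G c3} then vx G b1
              else if h \<in> {a2, opp G a2, b3, opp G b3} then vx G c2
              else vx G h)\<rparr>)"

definition link_step :: "fgraph \<Rightarrow> fgraph \<Rightarrow> bool" where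
  "link_step G H \<longleftrightarrow> wf G \<and> wf H \<and>
     (fg_iso G H \<or> r1_remove G H \<or> r1_remove H G \<or> r2_remove G H \<or> r2_remove H G \<or>
      r3_move G H \<or> r3_move H G)"

definition link_equiv :: "fgraph \<Rightarrow> fgraph \<Rightarrow> bool" where
  "link_equiv G H \<longleftrightarrow> wf G \<and> wf H \<and> link_step\<^sup>*\<^sup>* G H"

definition r2_step :: "fgraph \<Rightarrow> fgraph \<Rightarrow> bool" where
  "r2_step G H \<longleftrightarrow> wf G \<and> wf H \<and> (fg_iso G H \<or> r2_remove G H \<or> r2_remove H G)"

definition r2_equiv :: "fgraph \<Rightarrow> fgraph \<Rightarrow> bool" where
  "r2_equiv G H \<longleftrightarrow> wf G \<and> wf H \<and> r2_step\<^sup>*\<^sup>* G H"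

definition uni_rel :: "fgraph \<Rightarrow> (nat \<times> nat) set" where
  "uni_rel G = ({(h, edg G h) | h. h \<in> darts G} \<union> {(h, opp G h) | h. h \<in> darts G})\<^sup>*"

definition num_unicursal :: "fgraph \<Rightarrow> nat" where
  "num_unicursal G = card (darts G // uni_rel G) + nloops G"

definition even_vertex :: "fgraph \<Rightarrow> nat \<Rightarrow> bool" where
  "even_vertex G v \<longleftrightarrow> (\<forall>h\<in>darts G. \<forall>k\<in>darts G. vx G h = v \<longrightarrow> vx G k = v \<longrightarrow> (h, k) \<in> uni_rel G)"

definition even_darts :: "fgraph \<Rightarrow> nat set" where
  "even_darts G = {h \<in> darts G. even_vertex G (vx G h)}"

text \<open>A state: at each even vertex, one of the two smoothings, i.e. an involution
pairing each dart with a non-opposite dart of the same vertex (identity elsewhere).\<close>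
definition states :: "fgraph \<Rightarrow> (nat \<Rightarrow> nat) set" where
  "states G = {s. (\<forall>h\<in>even_darts G. s h \<in> even_darts G \<and> s (s h) = h \<and> s h \<noteq> h \<and>
                    s h \<noteq> opp G h \<and> vx G (s h) = vx G h) \<and>
                  (\<forall>h. h \<notin> even_darts G \<longrightarrow> s h = h)}"

text \<open>An element of the space is determined by its Z2 coefficient on each basis
class (R2-class of framed 4-graphs); classes containing a graph with a circle
component are zero.  bracket G K is the coefficient of the class of K in {G}.\<close>
definition killed :: "fgraph \<Rightarrow> bool" where
  "killed K \<longleftrightarrow> (\<exists>K'. r2_equiv K K' \<and> nloops K' > 0)"

definition bracket :: "fgraph \<Rightarrow> fgraph \<Rightarrow> bool" where
  "bracket G K \<longleftrightarrow> \<not> killed K \<and>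
     odd (card {s \<in> states G. r2_equiv (reconnect G (even_darts G) s) K})"

end

theory Submission
  imports Defs
begin

text \<open>Every link step preserves the number of unicursal components and the bracket.
A reconnection can be carried out one pair of half-edges at a time, so reconnections at disjoint
sets of vertices commute and every comparison is local. At a curl, one smoothing creates a free
loop and the other one removes the curl. At a bigon both vertices have the same parity: if they
are odd, the smoothed graphs differ by a second move; if they are even, one of the four smoothings
creates a free loop, two coincide and cancel modulo 2, and the fourth removes the bigon. At a
triangle either all vertices are even or exactly one is, because the three strands lie in at most
two unicursal components. With one even vertex, one smoothing makes both sides equal up to second
moves and the other makes them isomorphic. With three even vertices the eight smoothings give a
free loop and pairings of the six outer ends; three of these pairings coincide, and modulo 2 both
sides of the move yield the same five pairings.\<close>

text \<open>The obstacle is the definition of \<open>reconnect\<close>: edges are chosen by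
  \<open>THE\<close> over a reachability relation and free loops are counted as equivalence classes,
  which is unmanageable for explicit smoothings. This relation is analysed in depth once, to justify
  eliminating a single pair; afterwards edges are contracted symbolically and smoothings are
  compared by evaluating the reconnecting maps pointwise. The removal moves are also written as
  reconnections, along \<open>opp\<close>, so that a move and a smoothing are the same kind of
  operation on disjoint sets of vertices. Coefficients are compared for one basis class
  \<open>K\<close> at a time. If \<open>K\<close> is killed, both sides vanish; otherwise no graph
  with a free loop lies in the class of \<open>K\<close>, so every term that creates a loop drops
  out. Only the third move calls on the number of unicursal components, to exclude a triangle with
  three odd vertices. The induction along a sequence of moves therefore carries this number together
  with the bracket.\<close>

definition matching :: "'a set \<Rightarrow> ('a \<Rightarrow> 'a) \<Rightarrow> bool" where
  "matching D e \<longleftrightarrow> (\<forall>h\<in>D. e h \<in> D \<and> e h \<noteq> h \<and> e (e h) = h)"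

text \<open>Weaker than \<open>wf\<close>: eliminating a single pair of darts destroys the valency
  of a vertex, but the edge pairing survives. The inductions over pairs run over such
  graphs.\<close>

definition edge_matched :: "fgraph \<Rightarrow> bool" where
  "edge_matched G \<longleftrightarrow> finite (darts G) \<and> matching (darts G) (edg G)"

text \<open>Record equality would be too strong: \<open>edg\<close>, \<open>opp\<close> and
  \<open>vx\<close> are total functions, and the constructions below leave different values off the
  darts.\<close>

definition same_graph :: "fgraph \<Rightarrow> fgraph \<Rightarrow> bool" where
  "same_graph G H \<longleftrightarrow> darts G = darts H \<and> nloops G = nloops H \<and>
     (\<forall>h\<in>darts G. edg G h = edg H h \<and> opp G h = opp H h \<and> vx G h = vx H h)"

text \<open>The effect of reconnecting along the single pair \<open>a \<leftrightarrow> b\<close>.\<close>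

definition join :: "nat \<Rightarrow> nat \<Rightarrow> fgraph \<Rightarrow> fgraph" where
  "join a b G = G\<lparr>darts := darts G - {a, b},
     edg := (if edg G a = b then edg G else (edg G)(edg G a := edg G b, edg G b := edg G a)),
     nloops := nloops G + (if edg G a = b then 1 else 0)\<rparr>"

text \<open>Applied to sets made of whole edges, so that the unchanged \<open>edg\<close> still
  pairs the remaining darts.\<close>

definition del_darts :: "nat set \<Rightarrow> fgraph \<Rightarrow> fgraph" where
  "del_darts A G = G\<lparr>darts := darts G - A\<rparr>"

lemma matchingD:
  assumes "matching D e" "h \<in> D"
  shows "e h \<in> D" "e h \<noteq> h" "e (e h) = h"
  using assms by (auto simp: matching_def)

lemma matching_eq_iff: "matching D e \<Longrightarrow> h \<in> D \<Longrightarrow> k \<in> D \<Longrightarrow> e h = e k \<longleftrightarrow> h = k"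
  by (metis matchingD(3))

lemma edge_matchedD:
  assumes "edge_matched G" "h \<in> darts G"
  shows "edg G h \<in> darts G" "edg G h \<noteq> h" "edg G (edg G h) = h"
  using assms by (auto simp: edge_matched_def matching_def)

lemma same_graph_refl [simp]: "same_graph G G"
  by (simp add: same_graph_def)

lemma same_graph_sym: "same_graph G H \<Longrightarrow> same_graph H G"
  by (auto simp: same_graph_def)

lemma same_graph_trans [trans]: "same_graph G H \<Longrightarrow> same_graph H K \<Longrightarrow> same_graph G K"
  by (auto simp: same_graph_def)

lemma edge_matched_cong: "same_graph G H \<Longrightarrow> edge_matched G \<Longrightarrow> edge_matched H"
  by (auto simp: same_graph_def edge_matched_def matching_def)

lemma join_simps [simp]:
  "darts (join a b G) = darts G - {a, b}" "opp (join a b G) = opp G" "vx (join a b G) = vx G"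
  by (simp_all add: join_def)

lemma del_darts_simps [simp]:
  "darts (del_darts A G) = darts G - A" "edg (del_darts A G) = edg G"
  "opp (del_darts A G) = opp G" "vx (del_darts A G) = vx G" "nloops (del_darts A G) = nloops G"
  by (simp_all add: del_darts_def)

lemma reconnect_simps [simp]:
  "darts (reconnect G X s) = darts G - X" "opp (reconnect G X s) = opp G" "vx (reconnect G X s) = vx G"
  by (simp_all add: reconnect_def)

lemma nloops_reconnect_ge: "nloops G \<le> nloops (reconnect G X s)"
  by (simp add: reconnect_def)

lemma edge_matched_join:
  assumes "edge_matched G" "a \<in> darts G" "b \<in> darts G" "a \<noteq> b"
  shows "edge_matched (join a b G)"
proof -
  note e = edge_matchedD[OF assms(1)]
  have "matching (darts (join a b G)) (edg (join a b G))"
    unfolding matching_def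
  proof
    fix h assume "h \<in> darts (join a b G)"
    then have h: "h \<in> darts G" "h \<noteq> a" "h \<noteq> b" by auto
    have inj: "edg G x = edg G y \<longleftrightarrow> x = y" if "x \<in> darts G" "y \<in> darts G" for x y
      using e that by metis
    have sw: "edg G x \<noteq> y" if "x \<in> darts G" "y \<in> darts G" "edg G y \<noteq> x" for x y
      using e(3) that by metis
    show "edg (join a b G) h \<in> darts (join a b G) \<and> edg (join a b G) h \<noteq> h \<and>
        edg (join a b G) (edg (join a b G) h) = h"
      using h assms(2-4) sw[of a h] sw[of b h] sw[of a b] sw[of b a] sw[of h a] sw[of h b]
      by (simp add: join_def e inj)
  qed
  then show ?thesis using assms(1) by (simp add: edge_matched_def)
qed

lemma edge_matched_del: 
  assumes "edge_matched G" "x \<in> darts G" "edg G x = y"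
  shows "edge_matched (del_darts {x, y} G)"
proof -
  note e = edge_matchedD[OF assms(1)]
  have "edg G h \<noteq> x" "edg G h \<noteq> y" if "h \<in> darts G" "h \<noteq> x" "h \<noteq> y" for h
    using e that assms(2,3) by metis+
  then show ?thesis using assms(1) e by (auto simp: edge_matched_def matching_def)
qed

lemma conn_rel_cong:
  assumes "darts G = darts H" "\<And>h. h \<in> darts G \<Longrightarrow> edg G h = edg H h" "\<And>h. h \<in> X \<Longrightarrow> s h = t h"
  shows "conn_rel G X s = conn_rel H X t"
proof -
  have "{(h, edg G h) | h. h \<in> darts G} = {(h, edg H h) | h. h \<in> darts H}"
       "{(h, s h) | h. h \<in> X} = {(h, t h) | h. h \<in> X}" using assms by auto
  then show ?thesis by (simp add: conn_rel_def)
qed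

lemma reconnect_cong_fun: "(\<And>h. h \<in> X \<Longrightarrow> s h = t h) \<Longrightarrow> reconnect G X s = reconnect G X t"
  using conn_rel_cong[of G G X s t] by (simp add: reconnect_def)

lemma reconnect_cong:
  assumes "same_graph G H" "\<And>h. h \<in> X \<Longrightarrow> s h = t h"
  shows "same_graph (reconnect G X s) (reconnect H X t)"
proof -
  have "conn_rel G X s = conn_rel H X t"
    using assms by (intro conn_rel_cong) (auto simp: same_graph_def)
  then show ?thesis using assms by (auto simp: same_graph_def reconnect_def)
qed

lemma conn_rel_edg: "h \<in> darts G \<Longrightarrow> (h, edg G h) \<in> conn_rel G X s"
  unfolding conn_rel_def by blast

lemma conn_rel_fun: "h \<in> X \<Longrightarrow> (h, s h) \<in> conn_rel G X s"
  unfolding conn_rel_def by blast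

lemma conn_rel_trans: "(x, y) \<in> conn_rel G X s \<Longrightarrow> (y, z) \<in> conn_rel G X s \<Longrightarrow> (x, z) \<in> conn_rel G X s"
  unfolding conn_rel_def by (rule rtrancl_trans)

lemma conn_rel_refl [simp]: "(x, x) \<in> conn_rel G X s"
  unfolding conn_rel_def by simp

text \<open>One induction along paths serves two purposes: with \<open>f = id\<close> it propagates
  an invariant \<open>P\<close>, and with a general \<open>f\<close> it carries the paths of one
  graph to paths of another.\<close>

lemma conn_rel_map:
  assumes "(x, y) \<in> conn_rel G X s" "P x"
    and "\<And>h. h \<in> darts G \<Longrightarrow> P h \<Longrightarrow> P (edg G h) \<and> (f h, f (edg G h)) \<in> conn_rel H Y t"
    and "\<And>h. h \<in> X \<Longrightarrow> P h \<Longrightarrow> P (s h) \<and> (f h, f (s h)) \<in> conn_rel H Y t"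
  shows "P y \<and> (f x, f y) \<in> conn_rel H Y t"
  using assms(1,2) unfolding conn_rel_def[of G]
proof (induction rule: rtrancl_induct)
  case base
  then show ?case by simp
next
  case (step y z)
  then show ?case using assms(3,4) by (auto intro: conn_rel_trans)
qed

lemma conn_rel_sym:
  assumes "edge_matched G" "matching X s"
  shows "(x, y) \<in> conn_rel G X s \<Longrightarrow> (y, x) \<in> conn_rel G X s"
proof -
  have "sym ({(h, edg G h) | h. h \<in> darts G} \<union> {(h, s h) | h. h \<in> X})"
    using edge_matchedD[OF assms(1)] matchingD[OF assms(2)] unfolding sym_def by fastforce
  then have "sym (conn_rel G X s)" unfolding conn_rel_def by (rule sym_rtrancl)
  then show "(x, y) \<in> conn_rel G X s \<Longrightarrow> (y, x) \<in> conn_rel G X s" by (simp add: sym_def)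
qed

lemma conn_rel_equiv: "edge_matched G \<Longrightarrow> matching X s \<Longrightarrow> equiv UNIV (conn_rel G X s)"
  by (rule equivI) (auto simp: refl_on_def sym_def trans_def intro: conn_rel_sym conn_rel_trans)

lemma conn_rel_closed:
  assumes "edge_matched G" "matching X s" "X \<subseteq> darts G" "h \<in> darts G" "(h, k) \<in> conn_rel G X s"
  shows "k \<in> darts G"
  using conn_rel_map[OF assms(5), of "\<lambda>h. h \<in> darts G" id G X s] assms
  by (auto simp: edge_matched_def matching_def conn_rel_edg conn_rel_fun)

subsection \<open>Eliminating one pair of the reconnecting involution\<close>

text \<open>\<open>X\<close> is what remains to be reconnected once the pair \<open>a\<close>,
  \<open>b\<close> has been dealt with; the full set is \<open>X'\<close> below.\<close>

locale pair_elim =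
  fixes G X s a b
  assumes em: "edge_matched G" and m: "matching X s" and X: "X \<subseteq> darts G"
    and ab: "a \<in> darts G" "b \<in> darts G" "a \<noteq> b" "a \<notin> X" "b \<notin> X" "s a = b" "s b = a"
begin

text \<open>Sends \<open>a\<close> and \<open>b\<close> to representatives of their classes that survive the
elimination, unless \<open>{a, b}\<close> is itself a closed cycle, which is collapsed to \<open>a\<close>.\<close>

definition retract :: "nat \<Rightarrow> nat" where
  "retract h = (if edg G a = b then (if h = b then a else h)
     else if h = a then edg G a else if h = b then edg G b else h)"

abbreviation "X' \<equiv> insert a (insert b X)"
abbreviation "R \<equiv> conn_rel G X' s"
abbreviation "R' \<equiv> conn_rel (join a b G) X s"

lemma m': "matching X' s"
  using m ab by (auto simp: matching_def)

lemma em': "edge_matched (join a b G)"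
  using em ab edge_matched_join by blast

lemma X_sub: "X \<subseteq> darts (join a b G)"
  using X ab by auto

lemma equivR: "equiv UNIV R" and equivR': "equiv UNIV R'"
  using conn_rel_equiv em em' m m' by blast+

lemma retract_step_edg:
  assumes "h \<in> darts G" shows "(retract h, retract (edg G h)) \<in> R'"
proof -
  note e = edge_matchedD[OF em]
  have aa: "edg G (edg G a) = a" "edg G (edg G b) = b" "edg G a \<noteq> a" "edg G b \<noteq> b"
    using e(2,3)[OF ab(1)] e(2,3)[OF ab(2)] by simp_all
  have ne: "edg G h \<noteq> a" if "h \<noteq> edg G a" using that e(3)[OF assms] by metis
  have ne': "edg G h \<noteq> b" if "h \<noteq> edg G b" using that e(3)[OF assms] by metis
  show ?thesis
  proof (cases "edg G a = b")
    case True
    then have ba: "edg G b = a" using aa by simp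
    show ?thesis
    proof (cases "h \<in> {a, b}")
      case False
      then have "edg G h \<noteq> a" "edg G h \<noteq> b" using ne ne' True ba by auto
      then show ?thesis
        using True False assms conn_rel_edg[of h "join a b G" X s] by (simp add: retract_def join_def)
    next
      case True
      then have "retract h = a" "retract (edg G h) = a" using \<open>edg G a = b\<close> ba by (auto simp: retract_def)
      then show ?thesis by simp
    qed
  next
    case False
    then have ba: "edg G b \<noteq> a" using aa by metis
    consider "h = a" | "h = b" | "h = edg G a" | "h = edg G b" | "h \<notin> {a, b, edg G a, edg G b}" by blast
    then show ?thesis
    proof cases
      case 5
      then have "edg G h \<notin> {a, b}" using ne ne' by auto
      then show ?thesis
        using False 5 assms conn_rel_edg[of h "join a b G" X s] by (simp add: retract_def join_def)
    qed (use aa ab False ba in \<open>simp_all add: retract_def\<close>)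
  qed
qed

text \<open>The pairing step between \<open>a\<close> and \<open>b\<close> becomes the new edge of
  \<open>join a b G\<close> between \<open>edg G a\<close> and \<open>edg G b\<close>, or a trivial
  step if \<open>a\<close> and \<open>b\<close> already form an edge.\<close>

lemma retract_step_fun:
  assumes "h \<in> X'" shows "(retract h, retract (s h)) \<in> R'"
proof -
  note e = edge_matchedD[OF em]
  have *: "(edg G a, edg G b) \<in> R'" if "edg G a \<noteq> b"
  proof -
    have "edg G a \<in> darts (join a b G)" using that e(1,2)[OF ab(1)] by simp
    moreover have "edg (join a b G) (edg G a) = edg G b"
      using that e(3)[OF ab(1)] e(3)[OF ab(2)] ab(3) by (auto simp: join_def)
    ultimately show ?thesis by (metis conn_rel_edg)
  qed
  have *: "edg G a \<noteq> b \<Longrightarrow> (edg G b, edg G a) \<in> R'" "edg G a \<noteq> b \<Longrightarrow> (edg G a, edg G b) \<in> R'"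
    using * conn_rel_sym[OF em' m] by blast+
  consider "h = a" | "h = b" | "h \<in> X" using assms by blast
  then show ?thesis
  proof cases
    case 3
    then have "h \<notin> {a, b}" "s h \<in> X" using ab matchingD(1)[OF m] by auto
    then have "h \<notin> {a, b}" "s h \<notin> {a, b}" using ab(4,5) by blast+
    then show ?thesis using 3 conn_rel_fun[of h X s] by (simp add: retract_def)
  qed (use * ab in \<open>auto simp: retract_def\<close>)
qed

lemma retract_rel: "(h, k) \<in> R \<Longrightarrow> (retract h, retract k) \<in> R'"
  using conn_rel_map[of h k G X' s "\<lambda>_. True" retract "join a b G" X s]
    retract_step_edg retract_step_fun by blast

text \<open>The only edge of \<open>join a b G\<close> that is new joins \<open>edg G a\<close> to
  \<open>edg G b\<close>, and these are linked in \<open>R\<close> through \<open>a\<close> and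
  \<open>b\<close>.\<close>

lemma R'_sub_R: assumes "(h, k) \<in> R'" shows "(h, k) \<in> R"
proof -
  note e = edge_matchedD[OF em]
  have 1: "(edg G a, edg G b) \<in> R" if "edg G a \<noteq> b"
  proof -
    have "(a, edg G a) \<in> R" "(a, b) \<in> R" "(b, edg G b) \<in> R"
      using conn_rel_edg ab conn_rel_fun[of a X' s] by auto
    then show ?thesis by (meson conn_rel_sym[OF em m'] conn_rel_trans)
  qed
  then have 2: "(edg G b, edg G a) \<in> R" if "edg G a \<noteq> b" using that conn_rel_sym[OF em m'] by blast
  have "(h', edg (join a b G) h') \<in> R" if "h' \<in> darts (join a b G)" for h'
    using that 1 2 conn_rel_edg[of h' G] by (auto simp: join_def)
  then show ?thesis
    using conn_rel_map[OF assms, of "\<lambda>_. True" id G X' s] conn_rel_fun[of _ X' s] by auto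
qed

lemma retract_id: "h \<notin> {a, b} \<Longrightarrow> retract h = h"
  by (auto simp: retract_def)

lemma R_iff: "h \<notin> {a, b} \<Longrightarrow> k \<notin> {a, b} \<Longrightarrow> (h, k) \<in> R \<longleftrightarrow> (h, k) \<in> R'"
  using retract_rel[of h k] retract_id R'_sub_R by auto

lemma R'_avoids:
  assumes "(h, k) \<in> R'" "h \<notin> {a, b}" shows "k \<notin> {a, b}"
proof -
  note e = edge_matchedD[OF em']
  have "h' \<in> darts (join a b G) \<Longrightarrow> edg (join a b G) h' \<notin> {a, b}" for h' using e by fastforce
  moreover have "h' \<in> X \<Longrightarrow> s h' \<notin> {a, b}" for h' using X_sub matchingD(1)[OF m] by auto
  ultimately show ?thesis
    using conn_rel_map[OF assms(1), of "\<lambda>h. h \<notin> {a, b}" id "join a b G" X s] assms(2)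
      conn_rel_edg conn_rel_fun by auto
qed

text \<open>If \<open>a\<close> and \<open>b\<close> form an edge, the class \<open>{a, b}\<close>
  is the one cycle lost, and \<open>join\<close> counts it as a loop. Otherwise deleting
  \<open>a\<close> and \<open>b\<close> from each class is a bijection between the classes inside
  \<open>X'\<close> and those inside \<open>X\<close>; no class is emptied or merged, because it
  keeps the image of its elements under \<open>retract\<close>.\<close>

lemma nloops_elim:
  "nloops (reconnect G X' s) = nloops (reconnect (join a b G) X s)"
proof (cases "edg G a = b")
  case True
  note e = edge_matchedD[OF em]
  have eb: "edg G b = a" using True e ab by auto
  have sep: "(h, k) \<notin> R" if "h \<notin> {a, b}" "k \<in> {a, b}" for h k
  proof
    assume "(h, k) \<in> R"
    then have "(h, a) \<in> R'" using retract_rel[of h k] retract_id[of h] that True by (auto simp: retract_def)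
    then show False using R'_avoids that by blast
  qed
  have cls: "R `` {h} = R' `` {h}" if "h \<notin> {a, b}" for h
  proof (rule set_eqI)
    fix k show "k \<in> R `` {h} \<longleftrightarrow> k \<in> R' `` {h}"
      using that sep[OF that] R'_avoids[OF _ that] R_iff[OF that] by blast
  qed
  have Ra: "R `` {a} = {a, b}" "R `` {b} = {a, b}"
  proof -
    have "(a, b) \<in> R" "(b, a) \<in> R" using conn_rel_fun[of a X' s] conn_rel_fun[of b X' s] ab by auto
    moreover have "(a, k) \<notin> R" "(b, k) \<notin> R" if "k \<notin> {a, b}" for k
      using sep[OF that] conn_rel_sym[OF em m'] by blast+
    ultimately show "R `` {a} = {a, b}" "R `` {b} = {a, b}" by auto
  qed
  let ?A = "{Q \<in> darts G // R. Q \<subseteq> X'}" and ?B = "{Q \<in> darts (join a b G) // R'. Q \<subseteq> X}"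
  have D: "darts G // R = insert {a, b} (darts (join a b G) // R')"
  proof -
    have "darts G // R = {R `` {a}, R `` {b}} \<union> {R `` {h} | h. h \<in> darts G - {a, b}}"
      using ab by (auto simp: quotient_def)
    also have "{R `` {h} | h. h \<in> darts G - {a, b}} = darts (join a b G) // R'"
      using cls by (auto simp: quotient_def)
    finally show ?thesis using Ra by auto
  qed
  have nab: "a \<notin> Q \<and> b \<notin> Q" if "Q \<in> darts (join a b G) // R'" for Q
    using that R'_avoids by (auto simp: quotient_def)
  have "?A = insert {a, b} ?B" unfolding D using nab by blast
  moreover have "{a, b} \<notin> ?B" using nab by blast
  moreover have "finite ?B"
    using em' by (simp add: quotient_def edge_matched_def)
  ultimately have "card ?A = Suc (card ?B)" by simp
  then show ?thesis using True by (simp add: reconnect_def join_def)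
next
  case False
  note e = edge_matchedD[OF em]
  have rd: "retract h \<in> darts (join a b G)" if "h \<in> darts G" for h
    using that e ab False by (auto simp: retract_def) (metis e(3))
  have hr: "(h, retract h) \<in> R" if "h \<in> darts G" for h
    using that False ab conn_rel_edg[of h G] by (auto simp: retract_def)
  have cls: "R `` {h} - {a, b} = R' `` {retract h}" if h: "h \<in> darts G" for h
  proof (rule set_eqI)
    fix k
    have *: "retract h \<notin> {a, b}" using rd[OF h] by auto
    have "(h, k) \<in> R \<longleftrightarrow> (retract h, k) \<in> R"
      using hr[OF h] by (meson conn_rel_sym[OF em m'] conn_rel_trans)
    then show "k \<in> R `` {h} - {a, b} \<longleftrightarrow> k \<in> R' `` {retract h}"
      using R_iff[OF *] R'_avoids[OF _ *] by blast
  qed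
  let ?A = "{Q \<in> darts G // R. Q \<subseteq> X'}" and ?B = "{Q \<in> darts (join a b G) // R'. Q \<subseteq> X}"
  have "bij_betw (\<lambda>Q. Q - {a, b}) ?A ?B"
  proof (rule bij_betwI')
    fix Q1 Q2 assume Q: "Q1 \<in> ?A" "Q2 \<in> ?A"
    show "(Q1 - {a, b} = Q2 - {a, b}) = (Q1 = Q2)"
    proof
      assume eq: "Q1 - {a, b} = Q2 - {a, b}"
      obtain h1 h2 where h: "h1 \<in> darts G" "h2 \<in> darts G" "Q1 = R `` {h1}" "Q2 = R `` {h2}"
        using Q by (auto simp: quotient_def)
      have "retract h1 \<in> Q1 - {a, b}" using cls h by auto
      then have "(h1, retract h1) \<in> R" "(h2, retract h1) \<in> R" using eq h by auto
      then have "(h1, h2) \<in> R" by (meson conn_rel_sym[OF em m'] conn_rel_trans)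
      then show "Q1 = Q2" using h equiv_class_eq[OF equivR] by blast
    qed simp
  next
    fix Q assume "Q \<in> ?A"
    then show "Q - {a, b} \<in> ?B" using cls rd by (auto simp: quotient_def)
  next
    fix Q assume "Q \<in> ?B"
    then obtain h where h: "h \<in> darts (join a b G)" "Q = R' `` {h}" "Q \<subseteq> X" by (auto simp: quotient_def)
    then have "R `` {h} - {a, b} = Q" using cls[of h] retract_id[of h] by auto
    moreover have "R `` {h} \<in> ?A" using h calculation by (auto simp: quotient_def)
    ultimately show "\<exists>x\<in>?A. Q = x - {a, b}" by blast
  qed
  then have "card ?A = card ?B" by (rule bij_betw_same_card)
  then show ?thesis using False by (simp add: reconnect_def join_def)
qed

lemma reconnect_elim: "same_graph (reconnect G X' s) (reconnect (join a b G) X s)"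
proof -
  have "edg (reconnect G X' s) h = edg (reconnect (join a b G) X s) h" if "h \<in> darts G - X'" for h
  proof -
    have "(k \<in> darts G - X' \<and> k \<noteq> h \<and> (h, k) \<in> R) = (k \<in> darts (join a b G) - X \<and> k \<noteq> h \<and> (h, k) \<in> R')" for k
      using that R_iff[of h k] by auto
    then show ?thesis by (simp add: reconnect_def)
  qed
  moreover have "darts G - X' = darts G - {a, b} - X" by auto
  ultimately show ?thesis using nloops_elim by (auto simp: same_graph_def)
qed

end

subsection \<open>Iterated reconnection and contraction of edges\<close>

lemma matching_remove_pair:
  assumes "matching X s" "a \<in> X"
  shows "matching (X - {a, s a}) s"
  unfolding matching_def
proof
  fix h assume h: "h \<in> X - {a, s a}"
  have "s h \<noteq> a" "s h \<noteq> s a"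
    using h assms matching_eq_iff[OF assms(1)] matchingD(3)[OF assms(1), of h] by auto
  then show "s h \<in> X - {a, s a} \<and> s h \<noteq> h \<and> s (s h) = h"
    using h matchingD[OF assms(1), of h] by auto
qed

text \<open>The step adds a whole orbit of \<open>s\<close>, since a single dart would break the
  matching.\<close>

lemma matching_induct [consumes 2, case_names empty pair]:
  assumes "finite X" "matching X s" and "P {}"
    and step: "\<And>a X. finite X \<Longrightarrow> matching X s \<Longrightarrow> a \<notin> X \<Longrightarrow> s a \<notin> X \<Longrightarrow> s a \<noteq> a \<Longrightarrow> s (s a) = a \<Longrightarrow>
       P X \<Longrightarrow> P (insert a (insert (s a) X))"
  shows "P X"
  using assms(1,2)
proof (induction rule: finite_psubset_induct)
  case (psubset X)
  show ?case
  proof (cases "X = {}")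
    case False
    then obtain a where a: "a \<in> X" by blast
    let ?Y = "X - {a, s a}"
    have m: "matching ?Y s" by (rule matching_remove_pair[OF psubset.prems a])
    moreover have "?Y \<subset> X" using a by blast
    ultimately have "P ?Y" using psubset.IH by blast
    moreover have "s a \<in> X" "s a \<noteq> a" "s (s a) = a" using matchingD[OF psubset.prems a] by auto
    ultimately have "P (insert a (insert (s a) ?Y))"
      using psubset.hyps m by (intro step) auto
    moreover have "insert a (insert (s a) ?Y) = X" using a \<open>s a \<in> X\<close> by blast
    ultimately show ?thesis by simp
  qed (use \<open>P {}\<close> in simp)
qed

lemma reconnect_insert_pair:
  assumes "edge_matched G" "matching X s" "insert a (insert (s a) X) \<subseteq> darts G"
    "a \<notin> X" "s a \<notin> X" "s a \<noteq> a" "s (s a) = a"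
  shows "same_graph (reconnect G (insert a (insert (s a) X)) s) (reconnect (join a (s a) G) X s)"
proof -
  interpret pair_elim G X s a "s a" using assms by unfold_locales auto
  show ?thesis by (rule reconnect_elim)
qed

lemma conn_rel_insert_pair:
  assumes "edge_matched G" "matching X s" "insert a (insert (s a) X) \<subseteq> darts G"
    "a \<notin> X" "s a \<notin> X" "s a \<noteq> a" "s (s a) = a" and "h \<notin> {a, s a}" "k \<notin> {a, s a}"
  shows "(h, k) \<in> conn_rel G (insert a (insert (s a) X)) s \<longleftrightarrow> (h, k) \<in> conn_rel (join a (s a) G) X s"
proof -
  interpret pair_elim G X s a "s a" using assms by unfold_locales auto
  show ?thesis using R_iff assms by blast
qed

lemma conn_rel_empty:
  assumes "edge_matched G" "h \<in> darts G"
  shows "(h, k) \<in> conn_rel G {} s \<longleftrightarrow> k = h \<or> k = edg G h"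
proof
  assume "(h, k) \<in> conn_rel G {} s"
  then show "k = h \<or> k = edg G h"
    using conn_rel_map[of h k G "{}" s "\<lambda>k. k = h \<or> k = edg G h" id G "{}" s]
      edge_matchedD[OF assms] conn_rel_edg by force
qed (use assms conn_rel_edg in auto)

text \<open>With nothing to reconnect, the classes of darts are the edges, so \<open>THE\<close>
  returns the other end; a class is never empty, hence no loop is counted.\<close>

lemma reconnect_empty:
  assumes "edge_matched G" shows "same_graph (reconnect G {} s) G"
proof -
  have "edg (reconnect G {} s) h = edg G h" if "h \<in> darts G" for h
    using that edge_matchedD[OF assms that]
    by (auto simp: reconnect_def conn_rel_empty[OF assms] intro!: the_equality)
  moreover have "{Q \<in> darts G // conn_rel G {} s. Q \<subseteq> {}} = {}"
  proof -
    have "x \<in> conn_rel G {} s `` {x}" for x by simp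
    then show ?thesis unfolding quotient_def by blast
  qed
  ultimately show ?thesis by (auto simp: same_graph_def) (auto simp: reconnect_def)
qed

lemma edge_matched_reconnect:
  assumes "edge_matched G" "X \<subseteq> darts G" "matching X s"
  shows "edge_matched (reconnect G X s)"
proof -
  have "finite X" using assms finite_subset unfolding edge_matched_def by blast
  then show ?thesis using assms(3,1,2)
  proof (induction X arbitrary: G rule: matching_induct)
    case empty
    then show ?case using reconnect_empty edge_matched_cong same_graph_sym by blast
  next
    case (pair a X)
    have "edge_matched (join a (s a) G)" using pair by (intro edge_matched_join) auto
    moreover have "X \<subseteq> darts (join a (s a) G)" using pair by auto
    ultimately have "edge_matched (reconnect (join a (s a) G) X s)" using pair.IH by blast
    then show ?case
      using reconnect_insert_pair[of G X s a] pair edge_matched_cong same_graph_sym by blast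
  qed
qed

text \<open>Both claims follow by eliminating the pairs of \<open>X\<close> one by one, with
  \<open>G\<close> varying. The claim on \<open>conn_rel\<close> is what later compares unicursal
  components. Using one \<open>s\<close> for both regions loses nothing: they are disjoint, so two
  maps can be merged by cases.\<close>

lemma reconnect_reconnect_aux:
  assumes "edge_matched G" "X \<union> Y \<subseteq> darts G" "X \<inter> Y = {}" "matching X s" "matching Y s"
  shows "same_graph (reconnect (reconnect G X s) Y s) (reconnect G (X \<union> Y) s) \<and>
    (\<forall>h\<in>darts G - X. \<forall>k\<in>darts G - X.
       (h, k) \<in> conn_rel (reconnect G X s) Y s \<longleftrightarrow> (h, k) \<in> conn_rel G (X \<union> Y) s)"
proof -
  have "finite X" using assms finite_subset unfolding edge_matched_def by blast
  then show ?thesis using assms(4,1-3)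
  proof (induction X arbitrary: G rule: matching_induct)
    case empty
    have s: "same_graph (reconnect G {} s) G" using reconnect_empty empty by blast
    then have "conn_rel (reconnect G {} s) Y s = conn_rel G Y s"
      by (intro conn_rel_cong) (auto simp: same_graph_def)
    then show ?case using reconnect_cong[OF s] by simp
  next
    case (pair a X)
    let ?J = "join a (s a) G" and ?X = "insert a (insert (s a) X)"
    have J: "edge_matched ?J" using pair by (intro edge_matched_join) auto
    have *: "X \<union> Y \<subseteq> darts ?J" "X \<inter> Y = {}" using pair by auto
    have IH: "same_graph (reconnect (reconnect ?J X s) Y s) (reconnect ?J (X \<union> Y) s)"
      "\<And>h k. h \<in> darts ?J - X \<Longrightarrow> k \<in> darts ?J - X \<Longrightarrow>
       (h, k) \<in> conn_rel (reconnect ?J X s) Y s \<longleftrightarrow> (h, k) \<in> conn_rel ?J (X \<union> Y) s"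
      using pair.IH[OF J *] by blast+
    have s: "same_graph (reconnect G ?X s) (reconnect ?J X s)"
      by (rule reconnect_insert_pair) (use pair in auto)
    then have c: "conn_rel (reconnect G ?X s) Y s = conn_rel (reconnect ?J X s) Y s"
      by (intro conn_rel_cong) (auto simp: same_graph_def)
    have m: "matching (X \<union> Y) s" using pair(2) assms(5) by (auto simp: matching_def)
    have sub: "insert a (insert (s a) (X \<union> Y)) \<subseteq> darts G" "a \<notin> X \<union> Y" "s a \<notin> X \<union> Y"
      using pair by auto
    have eq: "?X \<union> Y = insert a (insert (s a) (X \<union> Y))" by blast
    have "same_graph (reconnect (reconnect G ?X s) Y s) (reconnect (reconnect ?J X s) Y s)"
      by (rule reconnect_cong[OF s]) simp
    also note IH(1)
    also have "same_graph (reconnect ?J (X \<union> Y) s) (reconnect G (?X \<union> Y) s)"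
      unfolding eq using reconnect_insert_pair[OF pair.prems(1) m sub] pair(5,6) same_graph_sym by blast
    finally have 1: "same_graph (reconnect (reconnect G ?X s) Y s) (reconnect G (?X \<union> Y) s)" .
    have "(h, k) \<in> conn_rel (reconnect G ?X s) Y s \<longleftrightarrow> (h, k) \<in> conn_rel G (?X \<union> Y) s"
      if "h \<in> darts G - ?X" "k \<in> darts G - ?X" for h k
      unfolding c eq using IH(2)[of h k] conn_rel_insert_pair[OF pair.prems(1) m sub] pair(5,6) that by auto
    then show ?case using 1 by blast
  qed
qed

lemma reconnect_reconnect:
  assumes "edge_matched G" "X \<union> Y \<subseteq> darts G" "X \<inter> Y = {}" "matching X s" "matching Y s"
  shows "same_graph (reconnect (reconnect G X s) Y s) (reconnect G (X \<union> Y) s)"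
  using reconnect_reconnect_aux[OF assms] by blast

lemma conn_rel_reconnect:
  assumes "edge_matched G" "X \<union> Y \<subseteq> darts G" "X \<inter> Y = {}" "matching X s" "matching Y s"
    and "h \<in> darts G - X" "k \<in> darts G - X"
  shows "(h, k) \<in> conn_rel (reconnect G X s) Y s \<longleftrightarrow> (h, k) \<in> conn_rel G (X \<union> Y) s"
  using reconnect_reconnect_aux[OF assms(1-5)] assms(6,7) by blast

text \<open>Eliminating the pairs of \<open>x\<close> and of \<open>y\<close> one after the other
  concatenates the edges at \<open>s x\<close> and \<open>s y\<close>. Deleting the edge between
  \<open>x\<close> and \<open>y\<close> and eliminating the pair formed by \<open>s x\<close> and
  \<open>s y\<close> does the same.\<close>

lemma reconnect_contract:
  assumes em: "edge_matched G" and m: "matching X s" and X: "X \<subseteq> darts G"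
    and x: "x \<in> X" "edg G x = y" "y \<in> X" "s x \<noteq> y"
  shows "same_graph (reconnect G X s)
    (reconnect (del_darts {x, y} G) (X - {x, y}) (s(s x := s y, s y := s x)))"
proof -
  define u v where uv: "u = s x" "v = s y"
  let ?X0 = "X - {x, u} - {y, v}" and ?s' = "s(u := v, v := u)"
  note xy = edge_matchedD[OF em, of x] edge_matchedD[OF em, of y]
  have xD: "x \<in> darts G" "y \<in> darts G" "u \<in> darts G" "v \<in> darts G"
    using x X matchingD(1)[OF m] uv by auto
  have ne: "x \<noteq> y" using xy(2) xD x by auto
  have uvX: "u \<in> X" "v \<in> X" "u \<noteq> x" "v \<noteq> y" "s u = x" "s v = y"
    using matchingD[OF m] x uv by auto
  have ne2: "u \<noteq> y" "v \<noteq> x" "u \<noteq> v" using x uvX ne uv by auto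
  have m1: "matching (X - {x, u}) s" using matching_remove_pair[OF m x(1)] uv by simp
  have m0: "matching ?X0 s" using matching_remove_pair[OF m1, of y] x ne ne2 uv by simp
  have X1: "X = insert x (insert (s x) (X - {x, u}))" using x(1) uvX(1) unfolding uv by blast
  have X2: "X - {x, u} = insert y (insert (s y) ?X0)"
    using x(3) uvX(2) ne ne2 unfolding uv by blast
  have J: "edge_matched (join x u G)" using edge_matched_join em xD uvX by metis
  have "same_graph (reconnect G X s) (reconnect (join x u G) (X - {x, u}) s)"
    using reconnect_insert_pair[OF em m1, of x] X1 X uvX uv by auto
  also have "same_graph \<dots> (reconnect (join y v (join x u G)) ?X0 s)"
    using reconnect_insert_pair[OF J m0, of y] X2 X uvX uv by auto
  finally have 1: "same_graph (reconnect G X s) (reconnect (join y v (join x u G)) ?X0 s)" .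
  have eu: "edg G u \<noteq> y" "edg G v \<noteq> x" "edg G u \<noteq> v \<Longrightarrow> edg G v \<noteq> u"
    using edge_matchedD(3)[OF em] xD x uvX ne2 by metis+
  have J2: "same_graph (join y v (join x u G)) (join u v (del_darts {x, y} G))"
  proof -
    have e1: "edg (join x u G) = (edg G)(y := edg G u, edg G u := y)"
      "nloops (join x u G) = nloops G"
      using ne2(1) x(2) by (auto simp: join_def)
    \<comment> \<open>If \<open>u\<close> and \<open>v\<close> are themselves the ends of an edge,
      both sides close the same cycle and count one free loop.\<close>
    have d: "darts G - {x, u} - {y, v} = darts G - {x, y} - {u, v}" by blast
    show ?thesis
    proof (cases "edg G u = v")
      case True
      then show ?thesis
        using ne2 uvX(4) d by (simp add: same_graph_def join_def[of y] join_def[of u] e1)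
    next
      case False
      then have "edg (join y v (join x u G)) h = edg (join u v (del_darts {x, y} G)) h" if "h \<noteq> y" for h
        using that ne2 uvX(4) eu by (simp add: join_def[of y] join_def[of u] e1)
      then show ?thesis
        using False d eu ne2 uvX(4) by (simp add: same_graph_def join_def[of y] join_def[of u] e1)
    qed
  qed
  have D: "edge_matched (del_darts {x, y} G)" using edge_matched_del em xD x(2) by blast
  have X3: "X - {x, y} = insert u (insert (?s' u) ?X0)" using uvX ne2 by auto
  have m3: "matching ?X0 ?s'" using m0 by (auto simp: matching_def)
  have "same_graph (reconnect (del_darts {x, y} G) (insert u (insert (?s' u) ?X0)) ?s')
     (reconnect (join u (?s' u) (del_darts {x, y} G)) ?X0 ?s')"
    by (rule reconnect_insert_pair[OF D m3]) (use X uvX ne2 in auto)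
  then have 2: "same_graph (reconnect (del_darts {x, y} G) (X - {x, y}) ?s')
     (reconnect (join u v (del_darts {x, y} G)) ?X0 ?s')"
    unfolding X3 using ne2 by simp
  have "same_graph (reconnect (join y v (join x u G)) ?X0 s) (reconnect (join u v (del_darts {x, y} G)) ?X0 ?s')"
    by (rule reconnect_cong[OF J2]) auto
  then show ?thesis using 1 2 same_graph_trans same_graph_sym unfolding uv by blast
qed

text \<open>A pair of \<open>s\<close> that is also an edge is a closed cycle. Eliminating it first
  yields a free loop, and the rest of the reconnection never lowers the number of loops.\<close>

lemma nloops_reconnect_pos:
  assumes em: "edge_matched G" and m: "matching X s" and X: "X \<subseteq> darts G"
    and x: "x \<in> X" "s x = edg G x"
  shows "nloops (reconnect G X s) > 0"
proof -
  let ?Y = "X - {x, s x}"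
  have sx: "s x \<in> X" "s x \<noteq> x" "s (s x) = x" using matchingD[OF m x(1)] by auto
  have "X = insert x (insert (s x) ?Y)" using x sx by blast
  then have "same_graph (reconnect G X s) (reconnect (join x (s x) G) ?Y s)"
    using reconnect_insert_pair[OF em matching_remove_pair[OF m x(1)], of x] X sx by auto
  then have "nloops (reconnect G X s) \<ge> nloops (join x (s x) G)"
    using nloops_reconnect_ge[of "join x (s x) G"] by (simp add: same_graph_def)
  then show ?thesis using x by (simp add: join_def)
qed

section \<open>Well-formed graphs, unions of vertices, and isomorphisms of the edge
  structure\<close>

lemma wf_edge_matched: "wf G \<Longrightarrow> edge_matched G"
  by (simp add: wf_def edge_matched_def matching_def)

lemma wf_opp_matching: "wf G \<Longrightarrow> matching (darts G) (opp G)"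
  by (simp add: wf_def matching_def)

lemma wf_cong: 
  assumes "same_graph G H" "wf G" shows "wf H"
proof -
  have "{k \<in> darts H. vx H k = vx H h} = {k \<in> darts G. vx G k = vx G h}" if "h \<in> darts H" for h
    using assms(1) that by (auto simp: same_graph_def)
  then show ?thesis using assms unfolding wf_def same_graph_def by auto
qed

text \<open>Removing whole vertices leaves the valency four of the others intact, so reconnections
  along such sets stay within \<open>wf\<close>.\<close>

definition vertex_closed :: "fgraph \<Rightarrow> nat set \<Rightarrow> bool" where
  "vertex_closed G X \<longleftrightarrow> X \<subseteq> darts G \<and> (\<forall>h\<in>X. \<forall>k\<in>darts G. vx G k = vx G h \<longrightarrow> k \<in> X)"

lemma wf_reconnect:
  assumes w: "wf G" and X: "vertex_closed G X" and m: "matching X s"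
  shows "wf (reconnect G X s)"
proof -
  have "edge_matched (reconnect G X s)"
    using edge_matched_reconnect wf_edge_matched w X m unfolding vertex_closed_def by blast
  then have e: "finite (darts (reconnect G X s))"
    "\<And>h. h \<in> darts G - X \<Longrightarrow> edg (reconnect G X s) h \<in> darts G - X \<and> edg (reconnect G X s) h \<noteq> h \<and>
      edg (reconnect G X s) (edg (reconnect G X s) h) = h"
    by (auto simp: edge_matched_def matching_def)
  have o: "opp G h \<in> darts G - X \<and> opp G h \<noteq> h \<and> opp G (opp G h) = h \<and> vx G (opp G h) = vx G h"
    if "h \<in> darts G - X" for h
    using w X that unfolding wf_def vertex_closed_def by auto
  have "{k \<in> darts G - X. vx G k = vx G h} = {k \<in> darts G. vx G k = vx G h}" if "h \<in> darts G - X" for h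
    using X that unfolding vertex_closed_def by auto
  then have "card {k \<in> darts G - X. vx G k = vx G h} = 4" if "h \<in> darts G - X" for h
    using w that unfolding wf_def by auto
  then show ?thesis using e o by (auto simp: wf_def)
qed

text \<open>Ignores \<open>opp\<close> and \<open>vx\<close>, because the intermediate graphs of an
  elimination have damaged vertices; both are compared separately once the reconnection is
  complete.\<close>

definition edge_iso :: "(nat \<Rightarrow> nat) \<Rightarrow> fgraph \<Rightarrow> fgraph \<Rightarrow> bool" where
  "edge_iso f G H \<longleftrightarrow> bij_betw f (darts G) (darts H) \<and> nloops G = nloops H \<and>
     (\<forall>h\<in>darts G. f (edg G h) = edg H (f h))"

lemma edge_iso_cong:
  assumes "same_graph G G'" "same_graph H H'" "edge_matched G" shows "edge_iso f G H \<longleftrightarrow> edge_iso f G' H'"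
proof -
  have "f h \<in> darts H" if "bij_betw f (darts G) (darts H)" "h \<in> darts G" for h
    using that bij_betwE by blast
  then show ?thesis using assms unfolding edge_iso_def same_graph_def by auto
qed

lemma edge_iso_edge_matched:
  assumes "edge_iso f G H" "edge_matched G" shows "edge_matched H"
proof -
  note e = edge_matchedD[OF assms(2)]
  have b: "bij_betw f (darts G) (darts H)" and f: "\<And>h. h \<in> darts G \<Longrightarrow> edg H (f h) = f (edg G h)"
    using assms by (auto simp: edge_iso_def)
  have im: "f ` darts G = darts H" "inj_on f (darts G)" using b by (auto simp: bij_betw_def)
  have "finite (darts H)" using assms(2) im(1)[symmetric] unfolding edge_matched_def by simp
  moreover have "matching (darts H) (edg H)"
    unfolding matching_def
  proof
    fix k assume "k \<in> darts H"
    then obtain h where h: "h \<in> darts G" "k = f h" using im by blast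
    then show "edg H k \<in> darts H \<and> edg H k \<noteq> k \<and> edg H (edg H k) = k"
      using f[of h] f[of "edg G h"] e[of h] im inj_onD[OF im(2), of "edg G h" h] by auto
  qed
  ultimately show ?thesis by (simp add: edge_matched_def)
qed

lemma edge_iso_join:
  assumes "edge_iso f G H" "edge_matched G" "a \<in> darts G" "b \<in> darts G"
  shows "edge_iso f (join a b G) (join (f a) (f b) H)"
proof -
  note e = edge_matchedD[OF assms(2)]
  have b: "bij_betw f (darts G) (darts H)" and f: "\<And>h. h \<in> darts G \<Longrightarrow> edg H (f h) = f (edg G h)"
    and n: "nloops G = nloops H"
    using assms by (auto simp: edge_iso_def)
  have inj: "f h = f k \<longleftrightarrow> h = k" if "h \<in> darts G" "k \<in> darts G" for h k
    using b that by (auto simp: bij_betw_def inj_on_def)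
  have "bij_betw f (darts G - {a, b}) (darts H - {f a, f b})"
  proof -
    have "inj_on f (darts G)" "f ` darts G = darts H" using b by (auto simp: bij_betw_def)
    then show ?thesis
      using assms(3,4) by (simp add: bij_betw_def inj_on_diff inj_on_image_set_diff[of f "darts G"])
  qed
  moreover have "f (edg (join a b G) h) = edg (join (f a) (f b) H) (f h)" if "h \<in> darts G" for h
    using that assms(3,4) e(1) by (simp add: join_def f inj)
  moreover have "nloops (join a b G) = nloops (join (f a) (f b) H)"
    using assms(3,4) e(1) n by (simp add: join_def f inj)
  ultimately show ?thesis by (auto simp: edge_iso_def)
qed

text \<open>Eliminating one pair commutes with \<open>f\<close> by \<open>edge_iso_join\<close>, so
  induction over the pairs transports the whole reconnection without inspecting how its edges are
  chosen.\<close>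

lemma edge_iso_reconnect:
  assumes "edge_iso f G H" "edge_matched G" "X \<subseteq> darts G" "matching X s"
    and "\<And>h. h \<in> X \<Longrightarrow> t (f h) = f (s h)"
  shows "edge_iso f (reconnect G X s) (reconnect H (f ` X) t)"
proof -
  have "finite X" using assms finite_subset unfolding edge_matched_def by blast
  then show ?thesis using assms(4,1-3,5)
  proof (induction X arbitrary: G H rule: matching_induct)
    case empty
    then show ?case
      using edge_iso_cong[of G "reconnect G {} s" H "reconnect H {} t"]
        reconnect_empty edge_iso_edge_matched same_graph_sym by auto
  next
    case (pair a X)
    have aD: "a \<in> darts G" "s a \<in> darts G" using pair by auto
    have inj: "inj_on f (darts G)" using pair by (auto simp: edge_iso_def bij_betw_def)
    have im: "f ` darts G = darts H" using pair by (auto simp: edge_iso_def bij_betw_def)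
    have H: "edge_matched H" using edge_iso_edge_matched pair by blast
    have ta: "t (f a) = f (s a)" "t (f (s a)) = f a" "\<And>h. h \<in> X \<Longrightarrow> t (f h) = f (s h)"
      using pair.prems(4)[of a] pair.prems(4)[of "s a"] pair.prems(4) pair(6) by auto
    have neq: "f a \<noteq> f (s a)" "f a \<notin> f ` X" "f (s a) \<notin> f ` X"
      using inj_on_image_mem_iff[OF inj] inj_onD[OF inj, of a "s a"] pair aD by auto
    have mt: "matching (f ` X) t"
      unfolding matching_def
    proof
      fix k assume "k \<in> f ` X"
      then obtain h where h: "h \<in> X" "k = f h" by blast
      have "f (s h) \<noteq> f h"
        using inj_onD[OF inj, of "s h" h] matchingD[OF pair(2) h(1)] h(1) pair.prems(3) by blast
      then show "t k \<in> f ` X \<and> t k \<noteq> k \<and> t (t k) = k"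
        using h ta(3) matchingD[OF pair(2) h(1)] by simp
    qed
    have "edge_iso f (reconnect (join a (s a) G) X s) (reconnect (join (f a) (f (s a)) H) (f ` X) t)"
    proof (rule pair.IH)
      show "edge_iso f (join a (s a) G) (join (f a) (f (s a)) H)"
        using edge_iso_join pair aD by blast
      show "edge_matched (join a (s a) G)" using edge_matched_join pair aD by metis
      show "X \<subseteq> darts (join a (s a) G)" using pair by auto
    qed (use ta in auto)
    moreover have "same_graph (reconnect (join a (s a) G) X s) (reconnect G (insert a (insert (s a) X)) s)"
      by (rule same_graph_sym, rule reconnect_insert_pair) (use pair in auto)
    moreover have "same_graph (reconnect (join (f a) (t (f a)) H) (f ` X) t)
       (reconnect H (insert (f a) (insert (t (f a)) (f ` X))) t)"
    proof (rule same_graph_sym, rule reconnect_insert_pair)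
      show "insert (f a) (insert (t (f a)) (f ` X)) \<subseteq> darts H" using im pair.prems(3) ta(1) by auto
    qed (use H mt neq ta in auto)
    moreover have "edge_matched (reconnect (join a (s a) G) X s)"
      using pair aD by (intro edge_matched_reconnect edge_matched_join) auto
    ultimately show ?case using edge_iso_cong ta(1) by auto
  qed
qed

subsection \<open>Unicursal components and even vertices\<close>

lemma uni_rel_eq_conn_rel: "uni_rel G = conn_rel G (darts G) (opp G)"
  by (simp add: uni_rel_def conn_rel_def)

text \<open>Reconnecting all darts along \<open>opp\<close> closes every unicursal component into a
  free loop. The component count thus becomes a loop count, to which the reconnection lemmas
  apply.\<close>

lemma num_unicursal_eq_nloops:
  assumes "wf G" shows "num_unicursal G = nloops (reconnect G (darts G) (opp G))"
proof -
  let ?R = "conn_rel G (darts G) (opp G)"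
  have "?R `` {h} \<subseteq> darts G" if "h \<in> darts G" for h
    using conn_rel_closed[OF wf_edge_matched[OF assms] wf_opp_matching[OF assms] subset_refl that] by auto
  then have "{Q \<in> darts G // ?R. Q \<subseteq> darts G} = darts G // ?R"
    by (auto simp: quotient_def)
  then show ?thesis by (simp add: num_unicursal_def uni_rel_eq_conn_rel reconnect_def)
qed

text \<open>Two distinct non-opposite darts and their opposites are four distinct darts, so by
  valency four they exhaust the vertex.\<close>

lemma wf_vertex:
  assumes w: "wf G" and ab: "a \<in> darts G" "b \<in> darts G" "vx G b = vx G a" "b \<noteq> a" "b \<noteq> opp G a"
  shows "{k \<in> darts G. vx G k = vx G a} = {a, b, opp G a, opp G b}"
    "distinct [a, b, opp G a, opp G b]" "opp G (opp G a) = a" "opp G (opp G b) = b"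
    "vx G (opp G a) = vx G a" "vx G (opp G b) = vx G a" "opp G a \<in> darts G" "opp G b \<in> darts G"
proof -
  have o: "opp G h \<in> darts G" "opp G h \<noteq> h" "opp G (opp G h) = h" "vx G (opp G h) = vx G h"
    "card {k \<in> darts G. vx G k = vx G h} = 4" if "h \<in> darts G" for h
    using w that by (auto simp: wf_def)
  show 1: "opp G (opp G a) = a" "opp G (opp G b) = b"
    "vx G (opp G a) = vx G a" "vx G (opp G b) = vx G a" "opp G a \<in> darts G" "opp G b \<in> darts G"
    using o ab by auto
  have "opp G a \<noteq> opp G b" using 1 ab(4) by metis
  moreover have "opp G b \<noteq> a" using 1 ab(5) by metis
  ultimately show d: "distinct [a, b, opp G a, opp G b]" using o(2)[OF ab(1)] o(2)[OF ab(2)] ab(4,5) by auto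
  have "{a, b, opp G a, opp G b} \<subseteq> {k \<in> darts G. vx G k = vx G a}" using 1 ab by auto
  moreover have "finite {k \<in> darts G. vx G k = vx G a}" using w by (auto simp: wf_def)
  moreover have "card {a, b, opp G a, opp G b} = card {k \<in> darts G. vx G k = vx G a}"
    using d o(5)[OF ab(1)] by simp
  ultimately show "{k \<in> darts G. vx G k = vx G a} = {a, b, opp G a, opp G b}"
    using card_subset_eq by metis
qed

lemma uni_rel_equiv: "wf G \<Longrightarrow> equiv UNIV (uni_rel G)"
  unfolding uni_rel_eq_conn_rel by (rule conn_rel_equiv) (auto simp: wf_edge_matched wf_opp_matching)

lemma uni_rel_sym: "wf G \<Longrightarrow> (h, k) \<in> uni_rel G \<Longrightarrow> (k, h) \<in> uni_rel G"
  using uni_rel_equiv by (meson equivE symD)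

lemma uni_rel_trans: "(h, k) \<in> uni_rel G \<Longrightarrow> (k, j) \<in> uni_rel G \<Longrightarrow> (h, j) \<in> uni_rel G"
  unfolding uni_rel_eq_conn_rel by (rule conn_rel_trans)

lemma uni_rel_edg: "h \<in> darts G \<Longrightarrow> (h, edg G h) \<in> uni_rel G"
  unfolding uni_rel_eq_conn_rel by (rule conn_rel_edg)

lemma uni_rel_opp: "h \<in> darts G \<Longrightarrow> (h, opp G h) \<in> uni_rel G"
  unfolding uni_rel_eq_conn_rel by (rule conn_rel_fun)

lemma even_darts_iff:
  "h \<in> even_darts G \<longleftrightarrow> h \<in> darts G \<and>
     (\<forall>j\<in>darts G. \<forall>k\<in>darts G. vx G j = vx G h \<longrightarrow> vx G k = vx G h \<longrightarrow> (j, k) \<in> uni_rel G)"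
  by (simp add: even_darts_def even_vertex_def)

text \<open>Opposite darts always share a component, so two non-opposite darts decide the parity of
  the whole vertex.\<close>

lemma even_darts_vertex:
  assumes w: "wf G" and ab: "a \<in> darts G" "b \<in> darts G" "vx G b = vx G a" "b \<noteq> a" "b \<noteq> opp G a"
    and h: "h \<in> {a, b, opp G a, opp G b}"
  shows "h \<in> even_darts G \<longleftrightarrow> (a, b) \<in> uni_rel G"
proof -
  note v = wf_vertex[OF w ab]
  have vh: "vx G h = vx G a" "h \<in> darts G" using h v ab by auto
  have *: "j \<in> {a, b, opp G a, opp G b}" if "j \<in> darts G" "vx G j = vx G a" for j
    using v(1) that by auto
  have "(a, opp G a) \<in> uni_rel G" "(b, opp G b) \<in> uni_rel G" "(a, a) \<in> uni_rel G"
    using uni_rel_opp ab uni_rel_eq_conn_rel by auto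
  then have r: "(a, j) \<in> uni_rel G" if "(a, b) \<in> uni_rel G" "j \<in> darts G" "vx G j = vx G a" for j
    using that(1) *[OF that(2,3)] uni_rel_trans by blast
  have "(j, k) \<in> uni_rel G" if "(a, b) \<in> uni_rel G" "j \<in> darts G" "vx G j = vx G a"
    "k \<in> darts G" "vx G k = vx G a" for j k
    using r[OF that(1,2,3)] r[OF that(1,4,5)] uni_rel_trans uni_rel_sym[OF w] by blast
  then show ?thesis unfolding even_darts_iff vh(1) using vh(2) ab by blast
qed

lemma vertex_closed_even_darts: "vertex_closed G (even_darts G)"
  unfolding vertex_closed_def by (auto simp: even_darts_def)

lemma vertex_closed_opp: "wf G \<Longrightarrow> vertex_closed G X \<Longrightarrow> matching X (opp G)"
  unfolding vertex_closed_def wf_def matching_def by (metis subset_iff)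

text \<open>Running straight through \<open>X\<close> and then through all other vertices is running
  straight everywhere. Hence loop counts agree, and two surviving darts are in one component after
  the reconnection exactly if they were before.\<close>

lemma straighten:
  assumes w: "wf G" "wf H" and X: "vertex_closed G X" and H: "same_graph H (reconnect G X (opp G))"
  shows num_unicursal_straighten: "num_unicursal H = num_unicursal G"
    and even_darts_straighten: "even_darts H = even_darts G - X"
proof -
  let ?Y = "darts G - X"
  have em: "edge_matched G" using w wf_edge_matched by blast
  have sub: "X \<union> ?Y \<subseteq> darts G" "X \<inter> ?Y = {}" and un: "X \<union> ?Y = darts G"
    using X by (auto simp: vertex_closed_def)
  have mX: "matching X (opp G)" by (rule vertex_closed_opp[OF w(1) X])
  have HD: "darts H = ?Y" "\<And>h. h \<in> ?Y \<Longrightarrow> opp H h = opp G h" "\<And>h. h \<in> ?Y \<Longrightarrow> vx H h = vx G h"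
    using H by (auto simp: same_graph_def)
  then have mY: "matching ?Y (opp G)"
    using wf_opp_matching[OF w(2)] unfolding matching_def by (metis HD(1,2))
  have "same_graph (reconnect H ?Y (opp H)) (reconnect (reconnect G X (opp G)) ?Y (opp G))"
    by (rule reconnect_cong[OF H]) (use HD in auto)
  also have "same_graph \<dots> (reconnect G (darts G) (opp G))"
    using reconnect_reconnect[OF em sub mX mY] un by simp
  finally show "num_unicursal H = num_unicursal G"
    using w HD by (simp add: num_unicursal_eq_nloops same_graph_def)
  have c: "conn_rel H ?Y (opp H) = conn_rel (reconnect G X (opp G)) ?Y (opp G)"
    by (rule conn_rel_cong) (use H HD in \<open>auto simp: same_graph_def\<close>)
  have u: "(h, k) \<in> uni_rel H \<longleftrightarrow> (h, k) \<in> uni_rel G" if "h \<in> ?Y" "k \<in> ?Y" for h k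
    using conn_rel_reconnect[OF em sub mX mY that] un unfolding uni_rel_eq_conn_rel HD(1) c by simp
  show "even_darts H = even_darts G - X"
  proof (rule set_eqI)
    fix h
    show "h \<in> even_darts H \<longleftrightarrow> h \<in> even_darts G - X"
    proof (cases "h \<in> ?Y")
      case True
      have Y: "j \<in> ?Y" if "j \<in> darts G" "vx G j = vx G h" for j
        using X that True unfolding vertex_closed_def by auto
      show ?thesis
        unfolding Diff_iff even_darts_iff HD(1) using True Y u HD(3) by auto
    qed (auto simp: even_darts_iff HD)
  qed
qed

subsection \<open>Counting smoothings modulo 2\<close>

text \<open>This is \<open>states\<close> with the dart set as a parameter, which allows vertices to
  be split off one at a time.\<close>

definition smoothings :: "(nat \<Rightarrow> nat) \<Rightarrow> (nat \<Rightarrow> nat) \<Rightarrow> nat set \<Rightarrow> (nat \<Rightarrow> nat) set" where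
  "smoothings op v E = {s. (\<forall>h\<in>E. s h \<in> E \<and> s (s h) = h \<and> s h \<noteq> h \<and> s h \<noteq> op h \<and> v (s h) = v h) \<and>
     (\<forall>h. h \<notin> E \<longrightarrow> s h = h)}"

text \<open>A coefficient modulo 2. It is a truth value, so sums of coefficients appear as
  \<open>\<noteq>\<close>.\<close>

definition odd_count :: "((nat \<Rightarrow> nat) \<Rightarrow> bool) \<Rightarrow> (nat \<Rightarrow> nat) \<Rightarrow> (nat \<Rightarrow> nat) \<Rightarrow> nat set \<Rightarrow> bool" where
  "odd_count P op v E \<longleftrightarrow> odd (card {s \<in> smoothings op v E. P s})"

text \<open>Pairs \<open>a\<close> with \<open>b\<close> and \<open>c\<close> with \<open>d\<close>.
  At a vertex where \<open>a\<close> is opposite \<open>c\<close> and \<open>b\<close> opposite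
  \<open>d\<close>, the two smoothings are \<open>swap2 a b c d\<close> and
  \<open>swap2 a d b c\<close>.\<close>

definition swap2 :: "nat \<Rightarrow> nat \<Rightarrow> nat \<Rightarrow> nat \<Rightarrow> (nat \<Rightarrow> nat) \<Rightarrow> nat \<Rightarrow> nat" where
  "swap2 a b c d t = t(a := b, b := a, c := d, d := c)"

lemma states_eq_smoothings: "states G = smoothings (opp G) (vx G) (even_darts G)"
  by (auto simp: states_def smoothings_def)

lemma bracket_eq_odd_count:
  "bracket G K \<longleftrightarrow> \<not> killed K \<and>
     odd_count (\<lambda>s. r2_equiv (reconnect G (even_darts G) s) K) (opp G) (vx G) (even_darts G)"
  by (simp add: bracket_def odd_count_def states_eq_smoothings)

lemma smoothings_matching: "s \<in> smoothings op v E \<Longrightarrow> matching E s"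
  by (auto simp: smoothings_def matching_def)

lemma smoothings_outside: "s \<in> smoothings op v E \<Longrightarrow> h \<notin> E \<Longrightarrow> s h = h"
  by (auto simp: smoothings_def)

lemma smoothings_cong:
  assumes "\<And>h. h \<in> E \<Longrightarrow> op h = op' h" "\<And>h. h \<in> E \<Longrightarrow> v h = v' h"
  shows "smoothings op v E = smoothings op' v' E"
  using assms unfolding smoothings_def by (intro Collect_cong) auto

lemma odd_count_cong:
  assumes "\<And>h. h \<in> E \<Longrightarrow> op h = op' h" "\<And>h. h \<in> E \<Longrightarrow> v h = v' h"
    and "\<And>s. s \<in> smoothings op v E \<Longrightarrow> P s \<longleftrightarrow> Q s"
  shows "odd_count P op v E \<longleftrightarrow> odd_count Q op' v' E"
proof -
  have "smoothings op v E = smoothings op' v' E" using assms smoothings_cong by blast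
  then have "{s \<in> smoothings op v E. P s} = {s \<in> smoothings op' v' E. Q s}" using assms(3) by auto
  then show ?thesis by (simp add: odd_count_def)
qed

lemma odd_count_none: "(\<And>s. s \<in> smoothings op v E \<Longrightarrow> \<not> P s) \<Longrightarrow> \<not> odd_count P op v E"
proof -
  assume "\<And>s. s \<in> smoothings op v E \<Longrightarrow> \<not> P s"
  then have "{s \<in> smoothings op v E. P s} = {}" by auto
  then show ?thesis by (simp only: odd_count_def) simp
qed

lemma finite_smoothings:
  assumes "finite E" shows "finite (smoothings op v E)"
proof -
  \<comment> \<open>Smoothings are the identity off \<open>E\<close>, while the finiteness lemma
    wants one constant default there; the value 0 is arbitrary.\<close>
  let ?r = "\<lambda>s x. if x \<in> E then s x else (0::nat)"
  have "?r ` smoothings op v E \<subseteq> {f. \<forall>x. (x \<in> E \<longrightarrow> f x \<in> E) \<and> (x \<notin> E \<longrightarrow> f x = 0)}"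
    by (auto simp: smoothings_def)
  then have "finite (?r ` smoothings op v E)"
    using finite_set_of_finite_funs[OF assms assms] finite_subset by blast
  moreover have "inj_on ?r (smoothings op v E)"
  proof (rule inj_onI)
    fix s t assume st: "s \<in> smoothings op v E" "t \<in> smoothings op v E" "?r s = ?r t"
    show "s = t"
    proof
      fix x show "s x = t x"
        using fun_cong[OF st(3), of x] smoothings_outside[OF st(1), of x] smoothings_outside[OF st(2), of x]
        by (cases "x \<in> E") auto
    qed
  qed
  ultimately show ?thesis using finite_imageD by blast
qed

text \<open>One vertex with darts \<open>a\<close>, \<open>b\<close>, \<open>c\<close>,
  \<open>d\<close>, to be added to a set \<open>E\<close> of darts of other vertices; the assumption
  on labels makes \<open>E\<close> avoid the four darts.\<close>

locale local_vertex =
  fixes op v :: "nat \<Rightarrow> nat" and E a b c d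
  assumes dist: "distinct [a, b, c, d]"
    and op: "op a = c" "op b = d" "op c = a" "op d = b"
    and v: "v b = v a" "v c = v a" "v d = v a"
    and E: "\<And>h. h \<in> E \<Longrightarrow> v h \<noteq> v a" and fin: "finite E"
begin

lemma E_avoids: "a \<notin> E" "b \<notin> E" "c \<notin> E" "d \<notin> E"
  using E v by metis+

lemma swap2_smoothing:
  assumes "t \<in> smoothings op v E"
  shows "swap2 a b c d t \<in> smoothings op v (E \<union> {a, b, c, d})"
    "swap2 a d b c t \<in> smoothings op v (E \<union> {a, b, c, d})"
proof -
  have t: "t h \<in> E" "t (t h) = h" "t h \<noteq> h" "t h \<noteq> op h" "v (t h) = v h" if "h \<in> E" for h
    using assms that by (auto simp: smoothings_def)
  have t': "t h = h" if "h \<notin> E" for h using assms that by (auto simp: smoothings_def)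
  have ne: "h \<noteq> a \<and> h \<noteq> b \<and> h \<noteq> c \<and> h \<noteq> d" if "h \<in> E" for h using that E_avoids by metis
  have q: "swap2 a b c d t h = t h" "swap2 a d b c t h = t h" if "h \<in> E" for h
    using ne[OF that] by (auto simp: swap2_def)
  have q2: "swap2 a b c d t h \<in> {a,b,c,d} \<and> swap2 a b c d t (swap2 a b c d t h) = h \<and>
     swap2 a b c d t h \<noteq> h \<and> swap2 a b c d t h \<noteq> op h \<and> v (swap2 a b c d t h) = v h" 
    if "h \<in> {a,b,c,d}" for h
    using that dist op v by (auto simp: swap2_def)
  have q3: "swap2 a d b c t h \<in> {a,b,c,d} \<and> swap2 a d b c t (swap2 a d b c t h) = h \<and>
     swap2 a d b c t h \<noteq> h \<and> swap2 a d b c t h \<noteq> op h \<and> v (swap2 a d b c t h) = v h" 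
    if "h \<in> {a,b,c,d}" for h
    using that dist op v by (auto simp: swap2_def)
  have q4: "swap2 a b c d t h = h" "swap2 a d b c t h = h" if "h \<notin> E \<union> {a,b,c,d}" for h
    using that t' by (auto simp: swap2_def)
  let ?W = "E \<union> {a, b, c, d}"
  have "swap2 a b c d t h \<in> ?W \<and> swap2 a b c d t (swap2 a b c d t h) = h \<and> swap2 a b c d t h \<noteq> h \<and>
      swap2 a b c d t h \<noteq> op h \<and> v (swap2 a b c d t h) = v h" if "h \<in> ?W" for h
  proof (cases "h \<in> E")
    case True then show ?thesis using t[OF True] q(1)[OF True] q(1)[OF t(1)[OF True]] by simp
  next
    case False
    then have "h \<in> {a, b, c, d}" using that by blast
    from q2[OF this] show ?thesis by (metis UnI2)
  qed
  then show "swap2 a b c d t \<in> smoothings op v ?W"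
    unfolding smoothings_def mem_Collect_eq using q4(1) by (intro conjI ballI allI impI; metis)
  have "swap2 a d b c t h \<in> ?W \<and> swap2 a d b c t (swap2 a d b c t h) = h \<and> swap2 a d b c t h \<noteq> h \<and>
      swap2 a d b c t h \<noteq> op h \<and> v (swap2 a d b c t h) = v h" if "h \<in> ?W" for h
  proof (cases "h \<in> E")
    case True then show ?thesis using t[OF True] q(2)[OF True] q(2)[OF t(1)[OF True]] by simp
  next
    case False
    then have "h \<in> {a, b, c, d}" using that by blast
    from q3[OF this] show ?thesis by (metis UnI2)
  qed
  then show "swap2 a d b c t \<in> smoothings op v ?W"
    unfolding smoothings_def mem_Collect_eq using q4(2) by (intro conjI ballI allI impI; metis)
qed

text \<open>Vertex labels confine \<open>s\<close> to the four darts, and there the partner of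
  \<open>a\<close> is neither \<open>a\<close> nor its opposite \<open>c\<close>. Either choice,
  \<open>b\<close> or \<open>d\<close>, forces the other pair. The rest \<open>t\<close> is
  \<open>s\<close> made trivial on this vertex.\<close>

lemma smoothing_cases:
  assumes s: "s \<in> smoothings op v (E \<union> {a, b, c, d})"
  obtains t where "t \<in> smoothings op v E" "s = swap2 a b c d t \<or> s = swap2 a d b c t"
proof -
  let ?V = "{a, b, c, d}"
  have s1: "s h \<in> E \<union> ?V" "s (s h) = h" "s h \<noteq> h" "s h \<noteq> op h" "v (s h) = v h" if "h \<in> E \<union> ?V" for h
  proof -
    have "\<forall>h\<in>E \<union> ?V. s h \<in> E \<union> ?V \<and> s (s h) = h \<and> s h \<noteq> h \<and> s h \<noteq> op h \<and> v (s h) = v h"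
      using s unfolding smoothings_def mem_Collect_eq by (rule conjunct1)
    from bspec[OF this that] show "s h \<in> E \<union> ?V" "s (s h) = h" "s h \<noteq> h" "s h \<noteq> op h" "v (s h) = v h"
      by simp_all
  qed
  have s2: "s h = h" if "h \<notin> E \<union> ?V" for h using smoothings_outside[OF s that] .
  have sV: "s h \<in> ?V" if "h \<in> ?V" for h
    using s1(1,5)[of h] that E v by auto
  have sE: "s h \<in> E" if "h \<in> E" for h
  proof -
    have "v (s h) \<noteq> v a" using s1(5)[of h] E[OF that] that by simp
    then have "s h \<notin> ?V" using v by auto
    then show ?thesis using s1(1)[of h] that by blast
  qed
  define t where "t = (\<lambda>h. if h \<in> ?V then h else s h)"
  have nV: "h \<notin> ?V" if "h \<in> E" for h using that E_avoids by auto
  have tE: "t h = s h" if "h \<in> E" for h using nV[OF that] by (simp add: t_def)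
  have "t \<in> smoothings op v E"
    unfolding smoothings_def
  proof (intro CollectI conjI ballI allI impI)
    fix h assume h: "h \<in> E"
    show "t h \<in> E" "t (t h) = h" "t h \<noteq> h" "t h \<noteq> op h" "v (t h) = v h"
      using tE[OF h] tE[OF sE[OF h]] sE[OF h] s1[of h] h by auto
  next
    fix h assume "h \<notin> E" then show "t h = h" using s2[of h] by (auto simp: t_def)
  qed
  moreover have "s = swap2 a b c d t \<or> s = swap2 a d b c t"
  proof -
    have "s a \<in> {b, d}" using sV[of a] s1(3,4)[of a] op by auto
    then consider "s a = b" | "s a = d" by blast
    then show ?thesis
    proof cases
      case 1
      then have "s b = a" using s1(2)[of a] by auto
      then have "s c \<noteq> a" "s c \<noteq> b" "s c \<noteq> c" using s1(2)[of c] s1(3)[of c] 1 dist by auto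
      then have "s c = d" using sV[of c] by auto
      then have "s d = c" using s1(2)[of c] by auto
      then have "s = swap2 a b c d t"
        using 1 \<open>s b = a\<close> \<open>s c = d\<close> dist by (auto simp: swap2_def t_def)
      then show ?thesis by blast
    next
      case 2
      then have "s d = a" using s1(2)[of a] by auto
      then have "s b \<noteq> a" "s b \<noteq> d" "s b \<noteq> b" using s1(2)[of b] s1(3)[of b] 2 dist by auto
      then have "s b = c" using sV[of b] by auto
      then have "s c = b" using s1(2)[of b] by auto
      then have "s = swap2 a d b c t"
        using 2 \<open>s d = a\<close> \<open>s b = c\<close> dist by (auto simp: swap2_def t_def)
      then show ?thesis by blast
    qed
  qed
  ultimately show ?thesis using that by blast
qed

lemma swap2_inj:
  assumes "t \<in> smoothings op v E" "t' \<in> smoothings op v E"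
    and "swap2 a b c d t = swap2 a b c d t' \<or> swap2 a d b c t = swap2 a d b c t'"
  shows "t = t'"
proof
  fix h
  have out: "t x = x" "t' x = x" if "x \<notin> E" for x using that assms by (auto simp: smoothings_def)
  show "t h = t' h"
  proof (cases "h \<in> {a, b, c, d}")
    case True
    then show ?thesis using out E_avoids by auto
  next
    case False
    have "swap2 a b c d t h = swap2 a b c d t' h \<or> swap2 a d b c t h = swap2 a d b c t' h" using assms(3) by metis
    then show ?thesis using False by (simp add: swap2_def)
  qed
qed

text \<open>The smoothings of the larger set fall into two disjoint families according to the
  partner of \<open>a\<close>, each in bijection with the smoothings of \<open>E\<close>;
  cardinalities add, so parities combine by exclusive or.\<close>

lemma odd_count_split:
  "odd_count P op v (E \<union> {a, b, c, d}) \<longleftrightarrow>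
     odd_count (\<lambda>t. P (swap2 a b c d t)) op v E \<noteq> odd_count (\<lambda>t. P (swap2 a d b c t)) op v E"
proof -
  let ?S = "smoothings op v E"
  let ?A = "swap2 a b c d ` {t \<in> ?S. P (swap2 a b c d t)}"
  let ?B = "swap2 a d b c ` {t \<in> ?S. P (swap2 a d b c t)}"
  have "{s \<in> smoothings op v (E \<union> {a, b, c, d}). P s} = ?A \<union> ?B"
    using smoothing_cases swap2_smoothing by blast
  moreover have "?A \<inter> ?B = {}"
  proof -
    have "swap2 a b c d t a \<noteq> swap2 a d b c t' a" for t t' using dist by (simp add: swap2_def)
    then have "swap2 a b c d t \<noteq> swap2 a d b c t'" for t t' by metis
    then show ?thesis by blast
  qed
  moreover have "card ?A = card {t \<in> ?S. P (swap2 a b c d t)}" "card ?B = card {t \<in> ?S. P (swap2 a d b c t)}"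
    by (auto intro!: card_image inj_onI intro: swap2_inj)
  moreover have "finite ?A" "finite ?B" using finite_smoothings[OF fin] by auto
  ultimately have "card {s \<in> smoothings op v (E \<union> {a, b, c, d}). P s} =
    card {t \<in> ?S. P (swap2 a b c d t)} + card {t \<in> ?S. P (swap2 a d b c t)}"
    by (simp add: card_Un_disjoint)
  then show ?thesis by (auto simp: odd_count_def)
qed

end

section \<open>Second-move classes and invariance of the bracket under isomorphism\<close>

lemma fg_iso_iff_edge_iso:
  "fg_iso G H \<longleftrightarrow> (\<exists>f. edge_iso f G H \<and> (\<forall>h\<in>darts G. f (opp G h) = opp H (f h) \<and>
     (\<forall>k\<in>darts G. vx G h = vx G k \<longleftrightarrow> vx H (f h) = vx H (f k))))"
  unfolding fg_iso_def edge_iso_def by blast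

lemma fg_iso_sym:
  assumes "fg_iso G H" "wf G" shows "fg_iso H G"
proof -
  obtain f where n: "nloops G = nloops H" and f: "bij_betw f (darts G) (darts H)"
    and h: "\<And>h. h \<in> darts G \<Longrightarrow> f (edg G h) = edg H (f h)" "\<And>h. h \<in> darts G \<Longrightarrow> f (opp G h) = opp H (f h)"
     "\<And>h k. h \<in> darts G \<Longrightarrow> k \<in> darts G \<Longrightarrow> vx G h = vx G k \<longleftrightarrow> vx H (f h) = vx H (f k)"
    using assms(1) unfolding fg_iso_def by blast
  let ?g = "inv_into (darts G) f"
  have g: "?g (f x) = x" if "x \<in> darts G" for x using f that by (simp add: bij_betw_def inv_into_f_f)
  have im: "f ` darts G = darts H" using f by (simp add: bij_betw_def)
  have w: "edg G x \<in> darts G" "opp G x \<in> darts G" if "x \<in> darts G" for x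
    using assms(2) that by (auto simp: wf_def)
  have "?g (edg H k) = edg G (?g k) \<and> ?g (opp H k) = opp G (?g k) \<and>
     (\<forall>j\<in>darts H. vx H k = vx H j \<longleftrightarrow> vx G (?g k) = vx G (?g j))" if "k \<in> darts H" for k
  proof -
    obtain x where x: "x \<in> darts G" "k = f x" using \<open>k \<in> darts H\<close> unfolding im[symmetric] by blast
    have "vx H k = vx H j \<longleftrightarrow> vx G (?g k) = vx G (?g j)" if "j \<in> darts H" for j
    proof -
      obtain y where "y \<in> darts G" "j = f y" using \<open>j \<in> darts H\<close> unfolding im[symmetric] by blast
      then show ?thesis using x g h(3) by simp
    qed
    then show ?thesis using x g w h(1,2)[OF x(1), symmetric] by simp
  qed
  then show ?thesis unfolding fg_iso_def using bij_betw_inv_into[OF f] n by auto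
qed

lemma same_graph_fg_iso: "same_graph G H \<Longrightarrow> wf G \<Longrightarrow> fg_iso G H"
  unfolding fg_iso_def same_graph_def wf_def by (intro conjI exI[of _ id]) auto

lemma r2_step_sym: "r2_step G H \<Longrightarrow> r2_step H G"
  unfolding r2_step_def using fg_iso_sym by blast

lemma r2_equiv_step:
  assumes "r2_step G H" shows "r2_equiv G K \<longleftrightarrow> r2_equiv H K"
proof -
  have "wf G" "wf H" using assms by (auto simp: r2_step_def)
  then show ?thesis
    using assms r2_step_sym[OF assms] unfolding r2_equiv_def
    by (meson converse_rtranclp_into_rtranclp)
qed

lemma r2_equiv_fg_iso: "fg_iso G H \<Longrightarrow> wf G \<Longrightarrow> wf H \<Longrightarrow> r2_equiv G K \<longleftrightarrow> r2_equiv H K"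
  by (rule r2_equiv_step) (simp add: r2_step_def)

text \<open>The identity is an isomorphism between two such graphs; if they are not well-formed,
  both sides are false by definition.\<close>

lemma r2_equiv_cong:
  assumes "same_graph G H" shows "r2_equiv G K \<longleftrightarrow> r2_equiv H K"
proof (cases "wf G")
  case True
  then show ?thesis using r2_equiv_fg_iso same_graph_fg_iso wf_cong assms by blast
next
  case False
  then have "\<not> wf H" using wf_cong same_graph_sym assms by blast
  then show ?thesis using False by (simp add: r2_equiv_def)
qed

lemma r2_equiv_sym: "r2_equiv G H \<Longrightarrow> r2_equiv H G"
proof -
  assume a: "r2_equiv G H"
  have "symp r2_step" using r2_step_sym by (simp add: symp_def)
  then show ?thesis using a unfolding r2_equiv_def by (metis sympD symp_rtranclp)
qed

text \<open>In contrapositive form this discards terms: a smoothed graph with a free loop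
  contributes nothing to the coefficient of a class that is not killed.\<close>

lemma killed_loop: "r2_equiv G K \<Longrightarrow> nloops G > 0 \<Longrightarrow> killed K"
  unfolding killed_def using r2_equiv_sym by blast

lemma edg_reconnect_same:
  assumes "edge_matched G" "h \<in> darts G" "h \<notin> X" "edg G h \<notin> X"
  shows "edg (reconnect G X s) h = edg G h"
proof -
  note e = edge_matchedD[OF assms(1,2)]
  have "k \<in> {h, edg G h}" if "(h, k) \<in> conn_rel G X s" for k
    using conn_rel_map[OF that, of "\<lambda>k. k \<in> {h, edg G h}" id G X s] e assms conn_rel_edg by auto
  then show ?thesis
    using e assms conn_rel_edg[OF assms(2)] by (auto simp: reconnect_def intro!: the_equality)
qed

lemma uni_rel_iso:
  assumes "fg_iso G H" "wf G" obtains f where "edge_iso f G H" 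
   "\<And>h. h \<in> darts G \<Longrightarrow> f (opp G h) = opp H (f h)"
   "\<And>h k. h \<in> darts G \<Longrightarrow> k \<in> darts G \<Longrightarrow> vx G h = vx G k \<longleftrightarrow> vx H (f h) = vx H (f k)"
   "\<And>h k. h \<in> darts G \<Longrightarrow> k \<in> darts G \<Longrightarrow> (h, k) \<in> uni_rel G \<longleftrightarrow> (f h, f k) \<in> uni_rel H"
proof -
  obtain f where f: "edge_iso f G H" "\<And>h. h \<in> darts G \<Longrightarrow> f (opp G h) = opp H (f h)"
   "\<And>h k. h \<in> darts G \<Longrightarrow> k \<in> darts G \<Longrightarrow> vx G h = vx G k \<longleftrightarrow> vx H (f h) = vx H (f k)"
    using assms(1) unfolding fg_iso_iff_edge_iso by blast
  have e: "bij_betw f (darts G) (darts H)" "\<And>h. h \<in> darts G \<Longrightarrow> f (edg G h) = edg H (f h)"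
    using f(1) by (auto simp: edge_iso_def)
  let ?g = "inv_into (darts G) f"
  have g: "?g (f x) = x" if "x \<in> darts G" for x using e that by (simp add: bij_betw_def inv_into_f_f)
  have im: "f ` darts G = darts H" using e by (simp add: bij_betw_def)
  have w: "edg G x \<in> darts G" "opp G x \<in> darts G" if "x \<in> darts G" for x
    using assms(2) that by (auto simp: wf_def)
  have 1: "(f h, f k) \<in> uni_rel H" if "h \<in> darts G" "(h, k) \<in> uni_rel G" for h k
  proof -
    have "f x \<in> darts H" if "x \<in> darts G" for x using im that by blast
    then show ?thesis
      using that(1) conn_rel_map[OF that(2)[unfolded uni_rel_eq_conn_rel], of "\<lambda>h. h \<in> darts G" f H "darts H" "opp H"]
        conn_rel_edg[of _ H "darts H" "opp H"] conn_rel_fun[of _ "darts H" "opp H" H] w e(2) f(2)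
      unfolding uni_rel_eq_conn_rel by simp
  qed
  have 2: "(?g h, ?g k) \<in> uni_rel G" if "h \<in> darts H" "(h, k) \<in> uni_rel H" for h k
  proof -
    have "edg H x \<in> darts H \<and> (?g x, ?g (edg H x)) \<in> uni_rel G \<and>
       opp H x \<in> darts H \<and> (?g x, ?g (opp H x)) \<in> uni_rel G" if x: "x \<in> darts H" for x
    proof -
      obtain y where y: "y \<in> darts G" "x = f y" using x unfolding im[symmetric] by blast
      have "edg H x = f (edg G y)" "opp H x = f (opp G y)" using y e f by auto
      then show ?thesis using y g w im uni_rel_edg uni_rel_opp by auto
    qed
    then show ?thesis
      using that(1) conn_rel_map[OF that(2)[unfolded uni_rel_eq_conn_rel], of "\<lambda>h. h \<in> darts H" ?g G "darts G" "opp G"]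
      unfolding uni_rel_eq_conn_rel by simp
  qed
  have "(h, k) \<in> uni_rel G \<longleftrightarrow> (f h, f k) \<in> uni_rel H" if "h \<in> darts G" "k \<in> darts G" for h k
    using 1[OF that(1)] 2[of "f h" "f k"] that g im by auto
  then show thesis using that f by blast
qed

text \<open>Conjugation by an isomorphism maps states injectively to states and smoothed graphs to
  isomorphic ones. An inequality suffices, since the inverse isomorphism gives the reverse
  one.\<close>

lemma card_states_le_iso:
  assumes iso: "fg_iso G H" and w: "wf G" "wf H"
  shows "card {s \<in> states G. r2_equiv (reconnect G (even_darts G) s) K}
      \<le> card {s \<in> states H. r2_equiv (reconnect H (even_darts H) s) K}"
proof -
  obtain f where f: "edge_iso f G H" "\<And>h. h \<in> darts G \<Longrightarrow> f (opp G h) = opp H (f h)"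
   "\<And>h k. h \<in> darts G \<Longrightarrow> k \<in> darts G \<Longrightarrow> vx G h = vx G k \<longleftrightarrow> vx H (f h) = vx H (f k)"
   "\<And>h k. h \<in> darts G \<Longrightarrow> k \<in> darts G \<Longrightarrow> (h, k) \<in> uni_rel G \<longleftrightarrow> (f h, f k) \<in> uni_rel H"
    using uni_rel_iso iso w by blast
  have bij: "inj_on f (darts G)" "f ` darts G = darts H" using f(1) by (auto simp: edge_iso_def bij_betw_def)
  let ?E = "even_darts G" and ?F = "even_darts H" and ?g = "inv_into (darts G) f"
  have E: "?E \<subseteq> darts G" by (auto simp: even_darts_def)
  have g: "?g (f x) = x" if "x \<in> darts G" for x using bij that by (simp add: inv_into_f_f)
  have ev: "f h \<in> ?F \<longleftrightarrow> h \<in> ?E" if h: "h \<in> darts G" for h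
    using h bij(2)[symmetric] by (simp add: even_darts_iff f(3,4))
  have F: "?F = f ` ?E"
  proof (rule set_eqI)
    fix k
    show "k \<in> ?F \<longleftrightarrow> k \<in> f ` ?E"
    proof
      assume k: "k \<in> ?F"
      then have "k \<in> f ` darts G" using bij(2) by (simp add: even_darts_iff)
      then show "k \<in> f ` ?E" using ev k by blast
    next
      assume "k \<in> f ` ?E" then show "k \<in> ?F" using ev E by blast
    qed
  qed
  \<comment> \<open>The conjugate of \<open>s\<close> by \<open>f\<close>, extended by the identity
    as \<open>states\<close> demands.\<close>
  define \<phi> where "\<phi> s = (\<lambda>k. if k \<in> ?F then f (s (?g k)) else k)" for s
  have ph: "\<phi> s (f h) = f (s h)" if "h \<in> ?E" for s h
    using that F g E by (auto simp: \<phi>_def)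
  have st: "\<phi> s \<in> states H" if s: "s \<in> states G" for s
  proof -
    have s1: "s h \<in> ?E" "s (s h) = h" "s h \<noteq> h" "s h \<noteq> opp G h" "vx G (s h) = vx G h" if "h \<in> ?E" for h
      using s that by (auto simp: states_def)
    have "\<phi> s k \<in> ?F \<and> \<phi> s (\<phi> s k) = k \<and> \<phi> s k \<noteq> k \<and> \<phi> s k \<noteq> opp H k \<and> vx H (\<phi> s k) = vx H k" if "k \<in> ?F" for k
    proof -
      obtain h where h: "h \<in> ?E" "k = f h" using \<open>k \<in> ?F\<close> unfolding F by blast
      have D: "h \<in> darts G" "s h \<in> darts G" "opp G h \<in> darts G"
        using h E s1(1)[OF h(1)] w(1) by (auto simp: wf_def)
      have "f (s h) \<noteq> f h" "f (s h) \<noteq> f (opp G h)"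
        using inj_onD[OF bij(1), of "s h"] D s1[OF h(1)] by auto
      moreover have "vx H (f (s h)) = vx H (f h)" using f(3) D s1[OF h(1)] by auto
      ultimately show ?thesis
        using h ph[OF h(1)] ph[OF s1(1)[OF h(1)]] s1[OF h(1)] F f(2)[OF D(1)] by auto
    qed
    moreover have "\<phi> s k = k" if "k \<notin> ?F" for k using that by (simp add: \<phi>_def)
    ultimately show ?thesis by (simp add: states_def)
  qed
  have inj: "inj_on \<phi> (states G)"
  proof (rule inj_onI)
    fix s t assume a: "s \<in> states G" "t \<in> states G" "\<phi> s = \<phi> t"
    show "s = t"
    proof
      fix h
      show "s h = t h"
      proof (cases "h \<in> ?E")
        case True
        then have "f (s h) = f (t h)" using fun_cong[OF a(3), of "f h"] ph by simp
        moreover have "s h \<in> darts G" "t h \<in> darts G" using a True E by (auto simp: states_def)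
        ultimately show ?thesis using inj_onD[OF bij(1)] by blast
      qed (use a in \<open>auto simp: states_def\<close>)
    qed
  qed
  have eqv: "r2_equiv (reconnect G ?E s) K \<longleftrightarrow> r2_equiv (reconnect H ?F (\<phi> s)) K" if s: "s \<in> states G" for s
  proof -
    have m: "matching ?E s" "matching ?F (\<phi> s)"
      using s st[OF s] smoothings_matching unfolding states_eq_smoothings by blast+
    have "edge_iso f (reconnect G ?E s) (reconnect H (f ` ?E) (\<phi> s))"
      by (rule edge_iso_reconnect[OF f(1) wf_edge_matched[OF w(1)] E m(1) ph])
    then have "fg_iso (reconnect G ?E s) (reconnect H ?F (\<phi> s))"
      unfolding fg_iso_iff_edge_iso F[symmetric] using f(2,3) by auto
    then show ?thesis
      using r2_equiv_fg_iso wf_reconnect[OF w(1) vertex_closed_even_darts m(1)]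
        wf_reconnect[OF w(2) vertex_closed_even_darts m(2)] by blast
  qed
  show ?thesis
  proof (rule card_inj_on_le)
    show "inj_on \<phi> {s \<in> states G. r2_equiv (reconnect G ?E s) K}" using inj by (auto simp: inj_on_def)
    show "\<phi> ` {s \<in> states G. r2_equiv (reconnect G ?E s) K} \<subseteq> {s \<in> states H. r2_equiv (reconnect H ?F s) K}"
      using st eqv by auto
    have "finite ?F" using w(2) finite_subset[of ?F "darts H"] by (auto simp: wf_def even_darts_def)
    then show "finite {s \<in> states H. r2_equiv (reconnect H ?F s) K}"
      using finite_smoothings by (simp add: states_eq_smoothings)
  qed
qed

lemma bracket_fg_iso:
  assumes "fg_iso G H" "wf G" "wf H" shows "bracket G = bracket H"
proof
  fix K
  show "bracket G K = bracket H K"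
    using card_states_le_iso[OF assms, of K]
      card_states_le_iso[OF fg_iso_sym[OF assms(1,2)] assms(3,2), of K]
    by (simp add: bracket_def)
qed

lemma num_unicursal_fg_iso:
  assumes "fg_iso G H" "wf G" "wf H" shows "num_unicursal G = num_unicursal H"
proof -
  obtain f where f: "edge_iso f G H" "\<And>h. h \<in> darts G \<Longrightarrow> f (opp G h) = opp H (f h)"
    using assms(1) unfolding fg_iso_iff_edge_iso by blast
  have "edge_iso f (reconnect G (darts G) (opp G)) (reconnect H (f ` darts G) (opp H))"
    using edge_iso_reconnect[OF f(1) wf_edge_matched[OF assms(2)] subset_refl wf_opp_matching[OF assms(2)]] f(2)
    by simp
  moreover have "f ` darts G = darts H" using f(1) by (auto simp: edge_iso_def bij_betw_def)
  ultimately show ?thesis using assms by (simp add: num_unicursal_eq_nloops edge_iso_def)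
qed

subsection \<open>The first and second moves\<close>

text \<open>If \<open>x\<close> and \<open>y\<close> are the ends of an edge, the path \<open>s x, x, y, s y\<close> is shortened to
a direct pairing of \<open>s x\<close> with \<open>s y\<close>.\<close>

definition splice :: "nat \<Rightarrow> nat \<Rightarrow> (nat \<Rightarrow> nat) \<Rightarrow> nat \<Rightarrow> nat" where
  "splice x y s = s(s x := s y, s y := s x)"

lemma matching_splice:
  assumes "matching X s" "x \<in> X" "y \<in> X" "x \<noteq> y" "s x \<noteq> y"
  shows "matching (X - {x, y}) (splice x y s)"
  unfolding matching_def
proof
  fix h assume h: "h \<in> X - {x, y}"
  note m = matchingD[OF assms(1)]
  have sx: "s x \<in> X" "s y \<in> X" "s x \<noteq> x" "s y \<noteq> y" "s y \<noteq> x" "s x \<noteq> s y" "s (s x) = x" "s (s y) = y"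
    using m(1-3)[OF assms(2)] m(1-3)[OF assms(3)] assms(4,5) by auto
  have sh: "s h \<in> X" "s h \<noteq> h" "s (s h) = h" using m[of h] h by auto
  consider "h = s x" | "h = s y" | "h \<noteq> s x" "h \<noteq> s y" by blast
  then show "splice x y s h \<in> X - {x, y} \<and> splice x y s h \<noteq> h \<and> splice x y s (splice x y s h) = h"
  proof cases
    case 3
    then have "s h \<noteq> x" "s h \<noteq> y" using sh by auto
    moreover have "s h \<noteq> s x" "s h \<noteq> s y" using h sh sx by auto
    ultimately show ?thesis using 3 sh h by (simp add: splice_def)
  qed (use sx assms(5) in \<open>auto simp: splice_def\<close>)
qed

lemma del_darts_del_darts: "del_darts A (del_darts B G) = del_darts (B \<union> A) G"
  by (simp add: del_darts_def Diff_eq Int_assoc)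

text \<open>Two edges with all ends in \<open>X\<close>. By \<open>no_loop\<close> the first can be
  contracted; the second is then either contracted as well or closes a cycle.\<close>

locale two_edges =
  fixes G X s x1 y1 x2 y2
  assumes em: "edge_matched G" and m: "matching X s" and X: "X \<subseteq> darts G"
    and in_X: "x1 \<in> X" "y1 \<in> X" "x2 \<in> X" "y2 \<in> X"
    and e: "edg G x1 = y1" "edg G x2 = y2" and dist: "distinct [x1, y1, x2, y2]"
    and no_loop: "s x1 \<noteq> y1"
begin

lemma contract1:
  "same_graph (reconnect G X s) (reconnect (del_darts {x1, y1} G) (X - {x1, y1}) (splice x1 y1 s))"
  unfolding splice_def by (rule reconnect_contract[OF em m X in_X(1) e(1) in_X(2) no_loop])

lemma em1: "edge_matched (del_darts {x1, y1} G)"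
  using edge_matched_del em e(1) in_X X by blast

lemma m1: "matching (X - {x1, y1}) (splice x1 y1 s)"
  using matching_splice[OF m in_X(1,2)] dist no_loop by auto

lemma X1: "X - {x1, y1} \<subseteq> darts (del_darts {x1, y1} G)"
  using X by auto

lemma contract2:
  assumes "splice x1 y1 s x2 \<noteq> y2"
  shows "same_graph (reconnect G X s)
    (reconnect (del_darts {x1, y1, x2, y2} G) (X - {x1, y1, x2, y2}) (splice x2 y2 (splice x1 y1 s)))"
proof -
  have 1: "x2 \<in> X - {x1, y1}" "y2 \<in> X - {x1, y1}" using in_X dist by auto
  have 2: "edg (del_darts {x1, y1} G) x2 = y2" using e by simp
  have 3: "X - {x1, y1} - {x2, y2} = X - {x1, y1, x2, y2}" by blast
  have 4: "{x1, y1} \<union> {x2, y2} = {x1, y1, x2, y2}" by blast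
  note contract1
  also note reconnect_contract[OF em1 m1 X1 1(1) 2 1(2) assms, folded splice_def]
  finally show ?thesis unfolding del_darts_del_darts 3 4 .
qed

lemma loop2:
  assumes "splice x1 y1 s x2 = y2" shows "nloops (reconnect G X s) > 0"
proof -
  have "x2 \<in> X - {x1, y1}" using in_X dist by auto
  moreover have "splice x1 y1 s x2 = edg (del_darts {x1, y1} G) x2" using e assms by simp
  ultimately have "nloops (reconnect (del_darts {x1, y1} G) (X - {x1, y1}) (splice x1 y1 s)) > 0"
    by (rule nloops_reconnect_pos[OF em1 m1 X1])
  then show ?thesis using contract1 by (simp add: same_graph_def)
qed

end

lemma vertex_closed_Un: "vertex_closed G A \<Longrightarrow> vertex_closed G B \<Longrightarrow> vertex_closed G (A \<union> B)"
  unfolding vertex_closed_def by blast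

lemma vertex_closed_Diff: "vertex_closed G A \<Longrightarrow> vertex_closed G B \<Longrightarrow> vertex_closed G (A - B)"
  unfolding vertex_closed_def by (metis Diff_iff subset_iff)

lemma vertex_closed_vertex:
  assumes "wf G" "a \<in> darts G" "b \<in> darts G" "vx G b = vx G a" "b \<noteq> a" "b \<noteq> opp G a"
  shows "vertex_closed G {a, b, opp G a, opp G b}"
  using wf_vertex(1)[OF assms, symmetric] by (simp add: vertex_closed_def)

lemma local_vertex_wf:
  assumes w: "wf G" and ab: "a \<in> darts G" "b \<in> darts G" "vx G b = vx G a" "b \<noteq> a" "b \<noteq> opp G a"
    and E: "vertex_closed G E" "a \<notin> E"
  shows "local_vertex (opp G) (vx G) E a b (opp G a) (opp G b)"
proof
  note v = wf_vertex[OF w ab]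
  show "vx G h \<noteq> vx G a" if "h \<in> E" for h
    using E ab(1) that unfolding vertex_closed_def by metis
  show "finite E" using E w finite_subset by (auto simp: vertex_closed_def wf_def)
  show "distinct [a, b, opp G a, opp G b]" by (rule v(2))
qed (use wf_vertex[OF w ab] ab in auto)

text \<open>A smoothing of the graph after a removal move is read inside the original graph:
  straight through the removed vertices, \<open>t\<close> elsewhere. Both sides of a move then
  become reconnections of the same graph.\<close>

lemma reconnect_straight:
  assumes w: "wf G" and H: "same_graph H (reconnect G X (opp G))" and X: "vertex_closed G X"
    and E: "E \<subseteq> darts G" "E \<inter> X = {}" and t: "matching E t"
  shows "same_graph (reconnect H E t) (reconnect G (X \<union> E) (\<lambda>h. if h \<in> X then opp G h else t h))"
proof -
  let ?s = "\<lambda>h. if h \<in> X then opp G h else t h"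
  have mX: "matching X ?s" using vertex_closed_opp[OF w X] by (auto simp: matching_def)
  have n: "h \<notin> X" if "h \<in> E" for h using that E by auto
  then have mE: "matching E ?s" using t by (auto simp: matching_def)
  have sub: "X \<union> E \<subseteq> darts G" using X E by (auto simp: vertex_closed_def)
  have "reconnect G X (opp G) = reconnect G X ?s" by (rule reconnect_cong_fun) simp
  then have "same_graph H (reconnect G X ?s)" using H by simp
  then have "same_graph (reconnect H E t) (reconnect (reconnect G X ?s) E ?s)"
    by (rule reconnect_cong) (use n in auto)
  also have "same_graph \<dots> (reconnect G (X \<union> E) ?s)"
    using reconnect_reconnect[OF wf_edge_matched[OF w] sub _ mX mE] E by blast
  finally show ?thesis .
qed

text \<open>Removing a curl along its own smoothing and discarding the loop gives the same graph as
running straight through the vertex, so both removal moves are reconnections along \<open>opp\<close>.\<close>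

lemma r1_remove_straight:
  assumes "r1_remove G G'"
  obtains a b where "a \<in> darts G" "b \<in> darts G" "edg G a = b" "vx G b = vx G a" "b \<noteq> a" "b \<noteq> opp G a"
    "same_graph G' (reconnect G {a, b, opp G a, opp G b} (opp G))"
proof -
  have w: "wf G" using assms by (simp add: r1_remove_def)
  note em = wf_edge_matched[OF w]
  obtain a b where ab: "a \<in> darts G" "edg G a = b" "vx G b = vx G a" "b \<noteq> opp G a"
    and "let X = {a, b, opp G a, opp G b};
            s = (\<lambda>h. if h = a then b else if h = b then a
                      else if h = opp G a then opp G b else if h = opp G b then opp G a else h);
            H = reconnect G X s
        in G' = H\<lparr>nloops := nloops H - 1\<rparr>"
    using assms unfolding r1_remove_def by blast
  moreover define s where "s = (\<lambda>h. if h = a then b else if h = b then a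
                      else if h = opp G a then opp G b else if h = opp G b then opp G a else h)"
  moreover define X where "X = {a, b, opp G a, opp G b}"
  ultimately have G': "G' = (reconnect G X s)\<lparr>nloops := nloops (reconnect G X s) - 1\<rparr>"
    by (simp add: Let_def)
  have b: "b \<in> darts G" "b \<noteq> a" using edge_matchedD[OF em ab(1)] ab by auto
  note v = wf_vertex[OF w ab(1) b(1) ab(3) b(2) ab(4)]
  let ?Y = "{opp G a, opp G b}" and ?D = "del_darts {a, b} G" and ?J = "join a b G"
  have s: "s a = b" "s b = a" "s (opp G a) = opp G b" "s (opp G b) = opp G a"
    using v(2) by (auto simp: s_def)
  have mY: "matching ?Y s" using s v(2) by (auto simp: matching_def)
  have "same_graph (reconnect G (insert a (insert (s a) ?Y)) s) (reconnect (join a (s a) G) ?Y s)"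
    by (rule reconnect_insert_pair[OF em mY]) (use s v ab(1) b in auto)
  then have 1: "same_graph (reconnect G X s) (reconnect ?J ?Y s)" using s by (simp add: X_def)
  \<comment> \<open>As \<open>a\<close> and \<open>b\<close> form an edge, \<open>join a b G\<close>
    differs from deleting this edge only in the loop it counts, which is the loop that
    \<open>r1_remove\<close> subtracts.\<close>
  have "conn_rel ?J ?Y s = conn_rel ?D ?Y s"
    by (rule conn_rel_cong) (use ab(2) in \<open>auto simp: join_def\<close>)
  then have 2: "same_graph ((reconnect ?J ?Y s)\<lparr>nloops := nloops (reconnect ?J ?Y s) - 1\<rparr>) (reconnect ?D ?Y s)"
    using ab(2) by (simp add: same_graph_def reconnect_def) (simp add: join_def)
  have "same_graph G' ((reconnect ?J ?Y s)\<lparr>nloops := nloops (reconnect ?J ?Y s) - 1\<rparr>)"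
    using 1 unfolding G' same_graph_def by simp
  also note 2
  finally have 3: "same_graph G' (reconnect ?D ?Y s)" .
  have mX: "matching X (opp G)"
    using vertex_closed_opp[OF w vertex_closed_vertex[OF w ab(1) b(1) ab(3) b(2) ab(4)]] by (simp add: X_def)
  have "same_graph (reconnect G X (opp G)) (reconnect ?D (X - {a, b}) (splice a b (opp G)))"
    unfolding splice_def
    by (rule reconnect_contract[OF em mX]) (use ab b v in \<open>auto simp: X_def\<close>)
  moreover have "X - {a, b} = ?Y" using v(2) by (auto simp: X_def)
  moreover have "reconnect ?D ?Y (splice a b (opp G)) = reconnect ?D ?Y s"
    by (rule reconnect_cong_fun) (use s in \<open>auto simp: splice_def\<close>)
  ultimately have "same_graph (reconnect G X (opp G)) (reconnect ?D ?Y s)" by simp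
  then have "same_graph G' (reconnect G X (opp G))" using 3 same_graph_trans same_graph_sym by blast
  then show thesis using that[OF ab(1) b(1) ab(2,3) b(2) ab(4)] by (simp add: X_def)
qed

lemma bracket_r1:
  assumes "r1_remove G G'" shows "bracket G = bracket G'"
proof
  fix K
  have w: "wf G" "wf G'" using assms by (auto simp: r1_remove_def)
  note em = wf_edge_matched[OF w(1)]
  obtain a b where ab: "a \<in> darts G" "b \<in> darts G" "edg G a = b" "vx G b = vx G a" "b \<noteq> a" "b \<noteq> opp G a"
    and st: "same_graph G' (reconnect G {a, b, opp G a, opp G b} (opp G))"
    using r1_remove_straight assms by blast
  note ab' = ab(1,2,4,5,6)
  note v = wf_vertex[OF w(1) ab']
  define X where "X = {a, b, opp G a, opp G b}"
  have X: "vertex_closed G X" using vertex_closed_vertex[OF w(1) ab'] by (simp add: X_def)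
  let ?E = "even_darts G"
  define E where "E = even_darts G'"
  have E: "E = ?E - X" using even_darts_straighten[OF w X] st by (simp add: X_def E_def)
  \<comment> \<open>The loop edge links two non-opposite darts of the vertex, so a curl is always
    even.\<close>
  have "(a, b) \<in> uni_rel G" using uni_rel_edg[OF ab(1)] ab(3) by simp
  then have "X \<subseteq> ?E" using even_darts_vertex[OF w(1) ab'] by (auto simp: X_def)
  then have EX: "?E = E \<union> X" using E by blast
  have EXi: "E \<inter> X = {}" using E by blast
  have Ec: "vertex_closed G E" unfolding E using vertex_closed_Diff[OF vertex_closed_even_darts X] .
  have ED: "E \<subseteq> darts G" "?E \<subseteq> darts G" "X \<subseteq> darts G"
    using Ec X by (auto simp: vertex_closed_def EX)
  have aE: "a \<notin> E" "b \<notin> E" "opp G a \<notin> E" "opp G b \<notin> E" using EXi by (auto simp: X_def)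
  interpret local_vertex "opp G" "vx G" E a b "opp G a" "opp G b"
    by (rule local_vertex_wf[OF w(1) ab' Ec aE(1)])
  let ?P = "\<lambda>s. r2_equiv (reconnect G ?E s) K"
  show "bracket G K = bracket G' K"
  proof (cases "killed K")
    case nk: False
    have "odd_count ?P (opp G) (vx G) (E \<union> {a, b, opp G a, opp G b}) \<longleftrightarrow>
       odd_count (\<lambda>t. ?P (swap2 a b (opp G a) (opp G b) t)) (opp G) (vx G) E \<noteq>
       odd_count (\<lambda>t. ?P (swap2 a (opp G b) b (opp G a) t)) (opp G) (vx G) E"
      by (rule odd_count_split)
    moreover have "\<not> odd_count (\<lambda>t. ?P (swap2 a b (opp G a) (opp G b) t)) (opp G) (vx G) E"
    proof (rule odd_count_none)
      fix t assume "t \<in> smoothings (opp G) (vx G) E"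
      then have "matching ?E (swap2 a b (opp G a) (opp G b) t)"
        unfolding EX X_def by (rule smoothings_matching[OF swap2_smoothing(1)])
      then have "nloops (reconnect G ?E (swap2 a b (opp G a) (opp G b) t)) > 0"
      proof (rule nloops_reconnect_pos[OF em _ ED(2)])
        show "a \<in> ?E" using \<open>X \<subseteq> ?E\<close> by (auto simp: X_def)
        show "swap2 a b (opp G a) (opp G b) t a = edg G a" using dist ab(3) by (simp add: swap2_def)
      qed
      then show "\<not> ?P (swap2 a b (opp G a) (opp G b) t)" using killed_loop nk by blast
    qed
    moreover have "odd_count (\<lambda>t. ?P (swap2 a (opp G b) b (opp G a) t)) (opp G) (vx G) E \<longleftrightarrow>
      odd_count (\<lambda>t. r2_equiv (reconnect G' E t) K) (opp G') (vx G') E"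
    proof (rule odd_count_cong)
      fix h assume "h \<in> E"
      then have "h \<in> darts G'" using ED EXi st by (auto simp: same_graph_def X_def)
      then show "opp G h = opp G' h" "vx G h = vx G' h" using st by (auto simp: same_graph_def)
    next
      fix t assume t: "t \<in> smoothings (opp G) (vx G) E"
      \<comment> \<open>\<open>?r\<close> runs straight through the curl. Contracting the loop edge
        turns both \<open>?s\<close> and \<open>?r\<close> into the pairing of
        \<open>opp G a\<close> with \<open>opp G b\<close>.\<close>
      let ?s = "swap2 a (opp G b) b (opp G a) t" and ?r = "\<lambda>h. if h \<in> X then opp G h else t h"
      let ?D = "del_darts {a, b} G"
      have mt: "matching E t" using t smoothings_matching by blast
      have ms: "matching ?E ?s"
        unfolding EX X_def by (rule smoothings_matching[OF swap2_smoothing(2)[OF t]])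
      have mr: "matching ?E ?r"
      proof -
        have "matching X (opp G)" by (rule vertex_closed_opp[OF w(1) X])
        moreover have "h \<notin> X" if "h \<in> E" for h using that EXi by blast
        ultimately show ?thesis using mt unfolding EX matching_def by auto
      qed
      have "same_graph (reconnect G ?E ?s) (reconnect ?D (?E - {a, b}) (splice a b ?s))"
        unfolding splice_def
        by (rule reconnect_contract[OF em ms ED(2)])
          (use ab EX dist in \<open>auto simp: swap2_def X_def\<close>)
      also have "reconnect ?D (?E - {a, b}) (splice a b ?s) = reconnect ?D (?E - {a, b}) (splice a b ?r)"
      proof (rule reconnect_cong_fun)
        fix h assume "h \<in> ?E - {a, b}"
        then have "h = opp G a \<or> h = opp G b \<or> h \<in> E" using EX by (auto simp: X_def)
        then show "splice a b ?s h = splice a b ?r h"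
          using dist aE by (auto simp: splice_def swap2_def X_def)
      qed
      also have "same_graph (reconnect ?D (?E - {a, b}) (splice a b ?r)) (reconnect G ?E ?r)"
        unfolding splice_def
        by (rule same_graph_sym, rule reconnect_contract[OF em mr ED(2)])
          (use ab EX dist in \<open>auto simp: X_def\<close>)
      also have "same_graph (reconnect G ?E ?r) (reconnect G' E t)"
        using reconnect_straight[OF w(1) st[folded X_def] X ED(1) EXi mt] same_graph_sym EX
        by (simp add: Un_commute)
      finally show "?P ?s \<longleftrightarrow> r2_equiv (reconnect G' E t) K" by (rule r2_equiv_cong)
    qed
    ultimately show ?thesis using nk EX by (simp add: bracket_eq_odd_count E_def[symmetric] X_def)
  qed (simp add: bracket_def)
qed

section \<open>The second move: bigons\<close>

definition bigon :: "fgraph \<Rightarrow> nat \<Rightarrow> nat \<Rightarrow> nat \<Rightarrow> nat \<Rightarrow> bool" where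
  "bigon G x1 x2 y1 y2 \<longleftrightarrow> x1 \<in> darts G \<and> x2 \<in> darts G \<and>
       edg G x1 = y1 \<and> edg G x2 = y2 \<and>
       vx G x2 = vx G x1 \<and> vx G y2 = vx G y1 \<and> vx G x1 \<noteq> vx G y1 \<and>
       x2 \<noteq> x1 \<and> x2 \<noteq> opp G x1 \<and> y2 \<noteq> opp G y1"

lemma r2_remove_bigon:
  assumes "r2_remove G G'" obtains x1 x2 y1 y2 where "bigon G x1 x2 y1 y2"
    "G' = reconnect G {k \<in> darts G. vx G k = vx G x1 \<or> vx G k = vx G y1} (opp G)"
  using assms unfolding r2_remove_def bigon_def by blast

lemma bigon_vertices:
  assumes "wf G" "bigon G x1 x2 y1 y2"
  shows "y1 \<in> darts G" "y2 \<in> darts G" "y2 \<noteq> y1"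
    "{k \<in> darts G. vx G k = vx G x1 \<or> vx G k = vx G y1} =
      {x1, x2, opp G x1, opp G x2} \<union> {y1, y2, opp G y1, opp G y2}"
    "distinct [x1, x2, opp G x1, opp G x2, y1, y2, opp G y1, opp G y2]"
proof -
  note em = wf_edge_matched[OF assms(1)]
  note b = assms(2)[unfolded bigon_def]
  show 1: "y1 \<in> darts G" "y2 \<in> darts G" using b edge_matchedD(1)[OF em] by auto
  show 2: "y2 \<noteq> y1" using b edge_matchedD(3)[OF em] by metis
  note vX = wf_vertex[OF assms(1), of x1 x2] and vY = wf_vertex[OF assms(1), of y1 y2]
  have "{k \<in> darts G. vx G k = vx G x1 \<or> vx G k = vx G y1} =
    {k \<in> darts G. vx G k = vx G x1} \<union> {k \<in> darts G. vx G k = vx G y1}" by blast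
  then show "{k \<in> darts G. vx G k = vx G x1 \<or> vx G k = vx G y1} =
      {x1, x2, opp G x1, opp G x2} \<union> {y1, y2, opp G y1, opp G y2}"
    using vX(1) vY(1) b 1 2 by simp
  have "vx G h = vx G x1" if "h \<in> {x1, x2, opp G x1, opp G x2}" for h using that vX(5,6) b by auto
  moreover have "vx G h = vx G y1" if "h \<in> {y1, y2, opp G y1, opp G y2}" for h using that vY(5,6) b 1 2 by auto
  ultimately have "{x1, x2, opp G x1, opp G x2} \<inter> {y1, y2, opp G y1, opp G y2} = {}"
    using b by (metis disjoint_iff)
  then show "distinct [x1, x2, opp G x1, opp G x2, y1, y2, opp G y1, opp G y2]"
    using vX(2) vY(2) b 1 2 by auto
qed

text \<open>Smoothing at vertices away from the bigon leaves its two edges in place, so the smoothed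
  graph still admits the second move there. The removal and the smoothing act on disjoint vertices
  and commute.\<close>

lemma bigon_straight_reconnect:
  assumes w: "wf G" and b: "bigon G x1 x2 y1 y2"
    and X: "X = {k \<in> darts G. vx G k = vx G x1 \<or> vx G k = vx G y1}"
    and E: "vertex_closed G E" "E \<inter> X = {}" "matching E t"
  shows "r2_equiv (reconnect G E t) K \<longleftrightarrow> r2_equiv (reconnect (reconnect G X (opp G)) E t) K"
proof -
  let ?A = "reconnect G E t"
  let ?B = "reconnect ?A X (opp G)"
  have Xc: "vertex_closed G X" unfolding X vertex_closed_def by auto
  note em = wf_edge_matched[OF w]
  note v = bigon_vertices[OF w b]
  have XA: "vertex_closed ?A X" using Xc E unfolding vertex_closed_def by auto
  have ED: "E \<subseteq> darts G" using E by (auto simp: vertex_closed_def)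
  have wA: "wf ?A" by (rule wf_reconnect[OF w E(1,3)])
  have mX: "matching X (opp G)" by (rule vertex_closed_opp[OF w Xc])
  have wB: "wf ?B" by (rule wf_reconnect[OF wA XA mX])
  have inX: "x1 \<in> X" "x2 \<in> X" "y1 \<in> X" "y2 \<in> X" using v(4) X by auto
  then have nE: "x1 \<notin> E" "x2 \<notin> E" "y1 \<notin> E" "y2 \<notin> E" using E by auto
  have e: "edg ?A x1 = y1" "edg ?A x2 = y2"
    using edg_reconnect_same[OF em] b nE unfolding bigon_def by auto
  have XX: "X = {k \<in> darts ?A. vx ?A k = vx ?A x1 \<or> vx ?A k = vx ?A y1}"
    using E(2) unfolding X by auto
  have "r2_remove ?A ?B"
    unfolding r2_remove_def
    apply (intro conjI wA wB)
    apply (rule exI[of _ x1], rule exI[of _ x2], rule exI[of _ y1], rule exI[of _ y2])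
    using b e nE XX[symmetric] unfolding bigon_def by simp
  then have "r2_step ?A ?B" using wA wB by (simp add: r2_step_def)
  then have 1: "r2_equiv ?A K \<longleftrightarrow> r2_equiv ?B K" by (rule r2_equiv_step)
  let ?r = "\<lambda>h. if h \<in> X then opp G h else t h"
  have m: "matching E ?r" "matching X ?r"
    using E(2,3) mX unfolding matching_def by auto
  have "?A = reconnect G E ?r" by (rule reconnect_cong_fun) (use E(2) in auto)
  moreover have "?B = reconnect ?A X ?r" by (rule reconnect_cong_fun) auto
  ultimately have "same_graph ?B (reconnect G (X \<union> E) ?r)"
    unfolding Un_commute[of X] using reconnect_reconnect[OF em _ E(2) m] ED Xc by (auto simp: vertex_closed_def)
  moreover have "same_graph (reconnect (reconnect G X (opp G)) E t) (reconnect G (X \<union> E) ?r)"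
    by (rule reconnect_straight[OF w _ Xc ED E(2,3)]) simp
  ultimately have "same_graph ?B (reconnect (reconnect G X (opp G)) E t)"
    using same_graph_trans[OF _ same_graph_sym] by blast
  then show ?thesis using 1 r2_equiv_cong by blast
qed

lemma bracket_r2:
  assumes "r2_remove G G'" shows "bracket G = bracket G'"
proof
  fix K
  have w: "wf G" "wf G'" using assms by (auto simp: r2_remove_def)
  note em = wf_edge_matched[OF w(1)]
  obtain x1 x2 y1 y2 where b: "bigon G x1 x2 y1 y2"
    and G'0: "G' = reconnect G {k \<in> darts G. vx G k = vx G x1 \<or> vx G k = vx G y1} (opp G)"
    using r2_remove_bigon assms by blast
  define X where "X = {k \<in> darts G. vx G k = vx G x1 \<or> vx G k = vx G y1}"
  have G': "G' = reconnect G X (opp G)" using G'0 by (simp add: X_def)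
  define p1 p2 q1 q2 where pq: "p1 = opp G x1" "p2 = opp G x2" "q1 = opp G y1" "q2 = opp G y2"
  note v = bigon_vertices[OF w(1) b]
  note b' = b[unfolded bigon_def]
  have x: "x1 \<in> darts G" "x2 \<in> darts G" "vx G x2 = vx G x1" "x2 \<noteq> x1" "x2 \<noteq> opp G x1" using b' by auto
  have y: "y1 \<in> darts G" "y2 \<in> darts G" "vx G y2 = vx G y1" "y2 \<noteq> y1" "y2 \<noteq> opp G y1" using b' v by auto
  have e: "edg G x1 = y1" "edg G x2 = y2" using b' by auto
  let ?V = "{x1, x2, p1, p2}" and ?W = "{y1, y2, q1, q2}"
  have XVW: "X = ?V \<union> ?W" using v(4) by (simp add: X_def pq)
  have d: "distinct [x1, x2, p1, p2, y1, y2, q1, q2]" using v(5) by (simp add: pq)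
  have Xc: "vertex_closed G X" unfolding X_def vertex_closed_def by auto
  let ?E = "even_darts G"
  define E where "E = even_darts G'"
  have E: "E = ?E - X" using even_darts_straighten[OF w Xc] G' by (simp add: E_def)
  have EXi: "E \<inter> X = {}" using E by blast
  have Ec: "vertex_closed G E" unfolding E using vertex_closed_Diff[OF vertex_closed_even_darts Xc] .
  have ED: "E \<subseteq> darts G" "X \<subseteq> darts G" using Ec Xc by (auto simp: vertex_closed_def)
  \<comment> \<open>The two edges of the bigon continue the same two strands, which meet at both
    vertices.\<close>
  have "(x1, x2) \<in> uni_rel G \<longleftrightarrow> (y1, y2) \<in> uni_rel G"
    using uni_rel_edg[OF x(1)] uni_rel_edg[OF x(2)] e uni_rel_sym[OF w(1)] uni_rel_trans by metis
  then have ev: "h \<in> ?E \<longleftrightarrow> (x1, x2) \<in> uni_rel G" if "h \<in> X" for h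
    using even_darts_vertex[OF w(1) x, of h] even_darts_vertex[OF w(1) y, of h] that XVW pq by blast
  let ?P = "\<lambda>s. r2_equiv (reconnect G ?E s) K"
  show "bracket G K = bracket G' K"
  proof (cases "killed K")
    case nk: False
    have "odd_count ?P (opp G) (vx G) ?E \<longleftrightarrow>
      odd_count (\<lambda>t. r2_equiv (reconnect G' E t) K) (opp G) (vx G) E"
    proof (cases "(x1, x2) \<in> uni_rel G")
      case False
      then have "?E \<inter> X = {}" using ev by blast
      \<comment> \<open>Both vertices are odd and stay unsmoothed, so the two graphs have the same
        states.\<close>
      then have EE: "?E = E" using E by blast
      show ?thesis
        unfolding EE G'
        by (rule odd_count_cong[OF refl refl])
          (rule bigon_straight_reconnect[OF w(1) b X_def Ec EXi smoothings_matching])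
    next
      case True
      then have "X \<subseteq> ?E" using ev by blast
      then have EX: "?E = (E \<union> ?V) \<union> ?W" using E XVW by blast
      have nE: "h \<notin> E" if "h \<in> ?V \<union> ?W" for h using that EXi XVW by blast
      have EVc: "vertex_closed G (E \<union> ?V)"
        using vertex_closed_Un[OF Ec vertex_closed_vertex[OF w(1) x]] by (simp add: pq)
      interpret V: local_vertex "opp G" "vx G" E x1 x2 p1 p2
        using local_vertex_wf[OF w(1) x Ec] nE by (simp add: pq)
      have y1E: "y1 \<notin> E \<union> ?V" using nE[of y1] d by auto
      interpret W: local_vertex "opp G" "vx G" "E \<union> ?V" y1 y2 q1 q2
        unfolding pq(3,4) by (rule local_vertex_wf[OF w(1) y EVc y1E])
      let ?S = "smoothings (opp G) (vx G) E"
      let ?D = "del_darts {x1, y1, x2, y2} G" and ?Y = "?E - {x1, y1, x2, y2}"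
      have Y: "h \<in> E \<or> h = p1 \<or> h = p2 \<or> h = q1 \<or> h = q2" if "h \<in> ?Y" for h using that EX by blast
      have hE: "h \<noteq> x1 \<and> h \<noteq> x2 \<and> h \<noteq> p1 \<and> h \<noteq> p2 \<and> h \<noteq> y1 \<and> h \<noteq> y2 \<and> h \<noteq> q1 \<and> h \<noteq> q2" if "h \<in> E" for h
        using that nE by blast
      have two: "two_edges G ?E s x1 y1 x2 y2" if "matching ?E s" "s x1 \<noteq> y1" for s
        using that em e d vertex_closed_even_darts[of G] EX by unfold_locales (auto simp: vertex_closed_def)
      have dd: "distinct [x1, x2, p1, p2, y1, y2, q1, q2]" "distinct [y1, y2, q1, q2, x1, x2, p1, p2]" using d by auto
      \<comment> \<open>Of the four smoothings at the bigon one creates a free loop, two agree and cancel,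
        and the last one is the smoothing of \<open>G'\<close>.\<close>
      have c00: "\<not> ?P (swap2 y1 y2 q1 q2 (swap2 x1 x2 p1 p2 t))" if t: "t \<in> ?S" for t
      proof -
        let ?s = "swap2 y1 y2 q1 q2 (swap2 x1 x2 p1 p2 t)"
        have "matching ?E ?s" unfolding EX
          using W.swap2_smoothing(1)[OF V.swap2_smoothing(1)[OF t]] smoothings_matching by blast
        then interpret two_edges G ?E ?s x1 y1 x2 y2 by (rule two) (use dd in \<open>auto simp: swap2_def\<close>)
        have "nloops (reconnect G ?E ?s) > 0" by (rule loop2) (use dd in \<open>auto simp: swap2_def splice_def\<close>)
        then show ?thesis using killed_loop nk by blast
      qed
      have c01: "?P (swap2 y1 q2 y2 q1 (swap2 x1 x2 p1 p2 t)) \<longleftrightarrow> 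
         r2_equiv (reconnect ?D ?Y (swap2 p1 p2 q1 q2 t)) K" if t: "t \<in> ?S" for t
      proof -
        let ?s = "swap2 y1 q2 y2 q1 (swap2 x1 x2 p1 p2 t)"
        have "matching ?E ?s" unfolding EX
          using W.swap2_smoothing(2)[OF V.swap2_smoothing(1)[OF t]] smoothings_matching by blast
        then interpret two_edges G ?E ?s x1 y1 x2 y2 by (rule two) (use dd in \<open>auto simp: swap2_def\<close>)
        have "same_graph (reconnect G ?E ?s) (reconnect ?D ?Y (splice x2 y2 (splice x1 y1 ?s)))"
          by (rule contract2) (use dd in \<open>auto simp: swap2_def splice_def\<close>)
        also have "reconnect ?D ?Y (splice x2 y2 (splice x1 y1 ?s)) = reconnect ?D ?Y (swap2 p1 p2 q1 q2 t)"
        proof (rule reconnect_cong_fun)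
          fix h assume "h \<in> ?Y"
          from Y[OF this] hE[of h] show "splice x2 y2 (splice x1 y1 ?s) h = swap2 p1 p2 q1 q2 t h"
            using dd by (auto simp: swap2_def splice_def)
        qed
        finally show ?thesis by (rule r2_equiv_cong)
      qed
      have c10: "?P (swap2 y1 y2 q1 q2 (swap2 x1 p2 x2 p1 t)) \<longleftrightarrow> 
         r2_equiv (reconnect ?D ?Y (swap2 p1 p2 q1 q2 t)) K" if t: "t \<in> ?S" for t
      proof -
        let ?s = "swap2 y1 y2 q1 q2 (swap2 x1 p2 x2 p1 t)"
        have "matching ?E ?s" unfolding EX
          using W.swap2_smoothing(1)[OF V.swap2_smoothing(2)[OF t]] smoothings_matching by blast
        then interpret two_edges G ?E ?s x1 y1 x2 y2 by (rule two) (use dd in \<open>auto simp: swap2_def\<close>)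
        have "same_graph (reconnect G ?E ?s) (reconnect ?D ?Y (splice x2 y2 (splice x1 y1 ?s)))"
          by (rule contract2) (use dd in \<open>auto simp: swap2_def splice_def\<close>)
        also have "reconnect ?D ?Y (splice x2 y2 (splice x1 y1 ?s)) = reconnect ?D ?Y (swap2 p1 p2 q1 q2 t)"
        proof (rule reconnect_cong_fun)
          fix h assume "h \<in> ?Y"
          from Y[OF this] hE[of h] show "splice x2 y2 (splice x1 y1 ?s) h = swap2 p1 p2 q1 q2 t h"
            using dd by (auto simp: swap2_def splice_def)
        qed
        finally show ?thesis by (rule r2_equiv_cong)
      qed
      have c11: "?P (swap2 y1 q2 y2 q1 (swap2 x1 p2 x2 p1 t)) \<longleftrightarrow> 
         r2_equiv (reconnect G' E t) K" if t: "t \<in> ?S" for t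
      proof -
        \<comment> \<open>After contraction of both edges, \<open>?s\<close> pairs \<open>p1\<close>
          with \<open>q1\<close> and \<open>p2\<close> with \<open>q2\<close>, exactly as running
          straight along \<open>?r\<close> does.\<close>
        let ?s = "swap2 y1 q2 y2 q1 (swap2 x1 p2 x2 p1 t)" and ?r = "\<lambda>h. if h \<in> X then opp G h else t h"
        have mt: "matching E t" using t smoothings_matching by blast
        have "matching ?E ?s" unfolding EX
          using W.swap2_smoothing(2)[OF V.swap2_smoothing(2)[OF t]] smoothings_matching by blast
        then interpret s: two_edges G ?E ?s x1 y1 x2 y2 by (rule two) (use dd in \<open>auto simp: swap2_def\<close>)
        have o: "opp G x1 = p1" "opp G x2 = p2" "opp G y1 = q1" "opp G y2 = q2"
          "opp G p1 = x1" "opp G p2 = x2" "opp G q1 = y1" "opp G q2 = y2"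
          using wf_vertex(3,4)[OF w(1) x] wf_vertex(3,4)[OF w(1) y] by (auto simp: pq)
        have inX: "x1 \<in> X" "x2 \<in> X" "p1 \<in> X" "p2 \<in> X" "y1 \<in> X" "y2 \<in> X" "q1 \<in> X" "q2 \<in> X"
          using XVW by auto
        have "matching ?E ?r"
        proof -
          have "matching X (opp G)" by (rule vertex_closed_opp[OF w(1) Xc])
          moreover have "h \<notin> X" if "h \<in> E" for h using that EXi by blast
          moreover have "?E = E \<union> X" using EX XVW by blast
          ultimately show ?thesis using mt unfolding matching_def by auto
        qed
        then interpret r: two_edges G ?E ?r x1 y1 x2 y2 by (rule two) (use dd inX o in auto)
        have "same_graph (reconnect G ?E ?s) (reconnect ?D ?Y (splice x2 y2 (splice x1 y1 ?s)))"
          by (rule s.contract2) (use dd in \<open>auto simp: swap2_def splice_def\<close>)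
        also have "reconnect ?D ?Y (splice x2 y2 (splice x1 y1 ?s)) = reconnect ?D ?Y (splice x2 y2 (splice x1 y1 ?r))"
        proof (rule reconnect_cong_fun)
          fix h assume "h \<in> ?Y"
          moreover have "h \<in> E \<Longrightarrow> h \<notin> X" using EXi by blast
          ultimately show "splice x2 y2 (splice x1 y1 ?s) h = splice x2 y2 (splice x1 y1 ?r) h"
            using Y[of h] hE[of h] dd inX o by (auto simp: swap2_def splice_def)
        qed
        also have "same_graph (reconnect ?D ?Y (splice x2 y2 (splice x1 y1 ?r))) (reconnect G ?E ?r)"
          by (rule same_graph_sym, rule r.contract2) (use dd inX o in \<open>auto simp: splice_def\<close>)
        also have "same_graph (reconnect G ?E ?r) (reconnect G' E t)"
        proof -
          have "?E = X \<union> E" using EX XVW by blast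
          then show ?thesis
            using reconnect_straight[OF w(1) _ Xc ED(1) EXi mt, of G'] same_graph_sym G' by simp
        qed
        finally show ?thesis by (rule r2_equiv_cong)
      qed
      let ?N = "\<lambda>P. odd_count P (opp G) (vx G) E"
      have cong: "?N P \<longleftrightarrow> ?N Q" if "\<And>t. t \<in> ?S \<Longrightarrow> P t \<longleftrightarrow> Q t" for P Q
        using that by (rule odd_count_cong[OF refl refl])
      have "\<not> ?N (\<lambda>t. ?P (swap2 y1 y2 q1 q2 (swap2 x1 x2 p1 p2 t)))"
        by (rule odd_count_none) (rule c00)
      moreover have "?N (\<lambda>t. ?P (swap2 y1 q2 y2 q1 (swap2 x1 x2 p1 p2 t))) \<longleftrightarrow>
          ?N (\<lambda>t. r2_equiv (reconnect ?D ?Y (swap2 p1 p2 q1 q2 t)) K)"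
        by (rule cong) (rule c01)
      moreover have "?N (\<lambda>t. ?P (swap2 y1 y2 q1 q2 (swap2 x1 p2 x2 p1 t))) \<longleftrightarrow>
          ?N (\<lambda>t. r2_equiv (reconnect ?D ?Y (swap2 p1 p2 q1 q2 t)) K)"
        by (rule cong) (rule c10)
      moreover have "?N (\<lambda>t. ?P (swap2 y1 q2 y2 q1 (swap2 x1 p2 x2 p1 t))) \<longleftrightarrow>
          ?N (\<lambda>t. r2_equiv (reconnect G' E t) K)"
        by (rule cong) (rule c11)
      moreover have "odd_count ?P (opp G) (vx G) (E \<union> ?V \<union> ?W) \<longleftrightarrow>
         (?N (\<lambda>t. ?P (swap2 y1 y2 q1 q2 (swap2 x1 x2 p1 p2 t))) \<noteq>
          ?N (\<lambda>t. ?P (swap2 y1 y2 q1 q2 (swap2 x1 p2 x2 p1 t)))) \<noteq>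
         (?N (\<lambda>t. ?P (swap2 y1 q2 y2 q1 (swap2 x1 x2 p1 p2 t))) \<noteq>
          ?N (\<lambda>t. ?P (swap2 y1 q2 y2 q1 (swap2 x1 p2 x2 p1 t))))"
        by (simp only: W.odd_count_split V.odd_count_split)
      ultimately show ?thesis by (simp only: EX[symmetric]) blast
    qed
    moreover have "odd_count (\<lambda>t. r2_equiv (reconnect G' E t) K) (opp G') (vx G') E \<longleftrightarrow>
       odd_count (\<lambda>t. r2_equiv (reconnect G' E t) K) (opp G) (vx G) E"
      unfolding G' by simp
    ultimately show ?thesis using nk by (simp add: bracket_eq_odd_count E_def[symmetric])
  qed (simp add: bracket_def)
qed

subsection \<open>The third move\<close>

text \<open>The darts \<open>h\<close>, \<open>x\<close>, \<open>y\<close>, \<open>k\<close> form a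
  complete class of the connection relation, and \<open>k\<close> is its only other member outside
  \<open>X\<close>.\<close>

lemma edg_reconnect_path:
  assumes em: "edge_matched G" and m: "matching X s"
    and h: "h \<in> darts G" "h \<notin> X" and x: "edg G h = x" "x \<in> X" "s x = y" and k: "edg G y = k" "k \<notin> X" "y \<in> darts G"
  shows "edg (reconnect G X s) h = k"
proof -
  note e = edge_matchedD[OF em]
  have yX: "y \<in> X" "s y = x" "y \<noteq> x" using matchingD[OF m x(2)] x(3) by auto
  have kD: "k \<in> darts G" using e(1) k by blast
  have inv: "edg G x = h" "edg G k = y" using e(3)[OF h(1)] e(3)[OF k(3)] x(1) k(1) by auto
  have "k \<noteq> h" using inv(2) x(1) yX(3) by auto
  have "(h, x) \<in> conn_rel G X s" "(x, y) \<in> conn_rel G X s" "(y, k) \<in> conn_rel G X s"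
    using conn_rel_edg[OF h(1)] conn_rel_fun[OF x(2)] conn_rel_edg[OF k(3)] x k by metis+
  then have hk: "(h, k) \<in> conn_rel G X s" by (meson conn_rel_trans)
  have un: "j \<in> {h, x, y, k}" if "(h, j) \<in> conn_rel G X s" for j
  proof -
    have "edg G i \<in> {h, x, y, k}" if "i \<in> {h, x, y, k}" for i using that x k inv by auto
    moreover have "s i \<in> {h, x, y, k}" if "i \<in> X" "i \<in> {h, x, y, k}" for i using that x yX h k by auto
    ultimately show ?thesis
      using conn_rel_map[OF that, of "\<lambda>j. j \<in> {h, x, y, k}" id G X s] conn_rel_edg conn_rel_fun by auto
  qed
  then show ?thesis
    using hk kD k(2) \<open>k \<noteq> h\<close> x(2) yX(1) by (auto simp: reconnect_def intro!: the_equality)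
qed

text \<open>Joining \<open>a\<close> to \<open>u\<close> prolongs the edge at \<open>u\<close> up to
  \<open>b\<close>. Up to letting \<open>b\<close> play the part of \<open>u\<close>, this only
  deletes the edge between \<open>a\<close> and \<open>b\<close>.\<close>

lemma edge_iso_join_del:
  assumes em: "edge_matched G" and ab: "a \<in> darts G" "edg G a = b" and u: "u \<in> darts G" "u \<noteq> a" "u \<noteq> b"
  shows "edge_iso (id(b := u)) (join a u G) (del_darts {a, b} G)"
proof -
  note e = edge_matchedD[OF em]
  have b: "b \<in> darts G" "b \<noteq> a" "edg G b = a" using e[OF ab(1)] ab(2) by auto
  have eu: "edg G u \<in> darts G" "edg G u \<noteq> u" "edg G (edg G u) = u" "edg G u \<noteq> a" "edg G u \<noteq> b"
    using e[OF u(1)] ab(2) u b(3) by auto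
  have J: "edg (join a u G) = (edg G)(b := edg G u, edg G u := b)" "nloops (join a u G) = nloops G"
    using ab u by (auto simp: join_def)
  have "bij_betw (id(b := u)) (darts G - {a, u}) (darts G - {a, b})"
    by (rule bij_betw_byWitness[of _ "id(u := b)"]) (use ab b u in auto)
  moreover have "(id(b := u)) (edg (join a u G) h) = edg G ((id(b := u)) h)"
    if h: "h \<in> darts G" "h \<noteq> a" "h \<noteq> u" for h
  proof -
    consider "h = b" | "h = edg G u" | "h \<noteq> b" "h \<noteq> edg G u" by blast
    then show ?thesis
    proof cases
      case 3
      then have "edg G h \<noteq> b" using e(3)[OF h(1)] b(3) h(2) by metis
      then show ?thesis using 3 by (simp add: J)
    qed (use eu in \<open>simp_all add: J\<close>)
  qed
  ultimately show ?thesis using J(2) by (simp add: edge_iso_def)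
qed

lemma edge_iso_comp: "edge_iso f G H \<Longrightarrow> edge_iso g H M \<Longrightarrow> edge_iso (g \<circ> f) G M"
  unfolding edge_iso_def using bij_betw_trans bij_betwE by fastforce

lemma edge_iso_del:
  assumes "edge_iso f G H" "A \<subseteq> darts G" shows "edge_iso f (del_darts A G) (del_darts (f ` A) H)"
proof -
  have "inj_on f (darts G)" "f ` darts G = darts H" using assms(1) by (auto simp: edge_iso_def bij_betw_def)
  then have "bij_betw f (darts G - A) (darts H - f ` A)"
    using assms(2) by (simp add: bij_betw_def inj_on_diff inj_on_image_set_diff[of f "darts G"])
  then show ?thesis using assms(1) by (simp add: edge_iso_def)
qed

text \<open>Two graphs with isomorphisms to a common \<open>M\<close> are isomorphic by
  \<open>g\<close> followed by the inverse of \<open>g'\<close>; the pointwise equation avoids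
  writing that inverse.\<close>

lemma edge_iso_factor:
  assumes g: "edge_iso g G M" and g': "edge_iso g' H M" and em: "edge_matched G" "edge_matched H"
    and f: "\<And>h. h \<in> darts G \<Longrightarrow> f h \<in> darts H \<and> g' (f h) = g h"
  shows "edge_iso f G H"
proof -
  have b: "inj_on g (darts G)" "g ` darts G = darts M" "inj_on g' (darts H)" "g' ` darts H = darts M"
    using g g' by (auto simp: edge_iso_def bij_betw_def)
  have "inj_on f (darts G)"
    by (rule inj_onI) (metis b(1) f inj_onD)
  moreover have "f ` darts G = darts H"
  proof
    show "darts H \<subseteq> f ` darts G"
    proof
      fix k assume k: "k \<in> darts H"
      then have "g' k \<in> g ` darts G" using b by auto
      then obtain h where h: "h \<in> darts G" "g' k = g h" by blast
      then have "k = f h" using inj_onD[OF b(3), of k "f h"] f[OF h(1)] k by simp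
      then show "k \<in> f ` darts G" using h by blast
    qed
  qed (use f in blast)
  moreover have "f (edg G h) = edg H (f h)" if h: "h \<in> darts G" for h
  proof -
    have D: "edg G h \<in> darts G" "edg H (f h) \<in> darts H" using edge_matchedD(1) em h f by blast+
    have "g' (f (edg G h)) = edg M (g h)" using f[OF D(1)] g h by (simp add: edge_iso_def)
    also have "\<dots> = g' (edg H (f h))" using f[OF h] g' by (simp add: edge_iso_def)
    finally show ?thesis using inj_onD[OF b(3)] f[OF D(1)] D(2) by blast
  qed
  ultimately show ?thesis using g g' by (simp add: edge_iso_def bij_betw_def)
qed

text \<open>\<open>no_loop\<close> and \<open>no_loop2\<close> keep the first two contractions from
  closing up, so that the third edge decides between a pairing of the outer ends and a free
  loop.\<close>

locale three_edges = two_edges +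
  fixes x3 y3
  assumes x3: "x3 \<in> X" "y3 \<in> X" "edg G x3 = y3" "distinct [x1, y1, x2, y2, x3, y3]"
    and no_loop2: "splice x1 y1 s x2 \<noteq> y2"
begin

lemma em2: "edge_matched (del_darts {x1, y1, x2, y2} G)"
proof -
  have "edge_matched (del_darts {x2, y2} (del_darts {x1, y1} G))"
    by (rule edge_matched_del[OF em1]) (use X in_X dist e in auto)
  moreover have "{x1, y1} \<union> {x2, y2} = {x1, y1, x2, y2}" by blast
  ultimately show ?thesis unfolding del_darts_del_darts by simp
qed

lemma m2: "matching (X - {x1, y1, x2, y2}) (splice x2 y2 (splice x1 y1 s))"
proof -
  have "matching (X - {x1, y1} - {x2, y2}) (splice x2 y2 (splice x1 y1 s))"
    by (rule matching_splice[OF m1]) (use in_X dist no_loop2 in auto)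
  moreover have "X - {x1, y1} - {x2, y2} = X - {x1, y1, x2, y2}" by blast
  ultimately show ?thesis by simp
qed

lemma X2: "X - {x1, y1, x2, y2} \<subseteq> darts (del_darts {x1, y1, x2, y2} G)"
  using X by auto

lemma x3': "x3 \<in> X - {x1, y1, x2, y2}" "y3 \<in> X - {x1, y1, x2, y2}"
  "edg (del_darts {x1, y1, x2, y2} G) x3 = y3"
  using x3 by auto

lemma contract3:
  assumes "splice x2 y2 (splice x1 y1 s) x3 \<noteq> y3"
  shows "same_graph (reconnect G X s)
    (reconnect (del_darts {x1, y1, x2, y2, x3, y3} G) (X - {x1, y1, x2, y2, x3, y3})
      (splice x3 y3 (splice x2 y2 (splice x1 y1 s))))"
proof -
  have 3: "X - {x1, y1, x2, y2} - {x3, y3} = X - {x1, y1, x2, y2, x3, y3}" by blast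
  have 4: "{x1, y1, x2, y2} \<union> {x3, y3} = {x1, y1, x2, y2, x3, y3}" by blast
  note contract2[OF no_loop2]
  also note reconnect_contract[OF em2 m2 X2 x3'(1,3,2) assms, folded splice_def]
  finally show ?thesis unfolding del_darts_del_darts 3 4 .
qed

lemma loop3:
  assumes "splice x2 y2 (splice x1 y1 s) x3 = y3" shows "nloops (reconnect G X s) > 0"
proof -
  have "nloops (reconnect (del_darts {x1, y1, x2, y2} G) (X - {x1, y1, x2, y2})
     (splice x2 y2 (splice x1 y1 s))) > 0"
    by (rule nloops_reconnect_pos[OF em2 m2 X2 x3'(1)]) (use assms x3'(3) in simp)
  then show ?thesis using contract2[OF no_loop2] by (simp add: same_graph_def)
qed

end

section \<open>The third move: triangles and their smoothings\<close>

definition triangle :: "fgraph \<Rightarrow> nat \<Rightarrow> nat \<Rightarrow> nat \<Rightarrow> nat \<Rightarrow> nat \<Rightarrow> nat \<Rightarrow> bool" where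
  "triangle G a1 b1 a2 c2 b3 c3 \<longleftrightarrow>
       {a1, b1, a2, c2, b3, c3} \<subseteq> darts G \<and>
       edg G a1 = b1 \<and> edg G a2 = c2 \<and> edg G b3 = c3 \<and>
       vx G a2 = vx G a1 \<and> a2 \<noteq> a1 \<and> a2 \<noteq> opp G a1 \<and>
       vx G b3 = vx G b1 \<and> b3 \<noteq> b1 \<and> b3 \<noteq> opp G b1 \<and>
       vx G c3 = vx G c2 \<and> c3 \<noteq> c2 \<and> c3 \<noteq> opp G c2 \<and>
       vx G a1 \<noteq> vx G b1 \<and> vx G a1 \<noteq> vx G c2 \<and> vx G b1 \<noteq> vx G c2"

text \<open>Along each of the three strands the two crossings of the triangle exchange their vertex
  labels. Edges and opposites are untouched, hence so are the unicursal components.\<close>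

definition slide :: "fgraph \<Rightarrow> nat \<Rightarrow> nat \<Rightarrow> nat \<Rightarrow> nat \<Rightarrow> nat \<Rightarrow> nat \<Rightarrow> fgraph" where
  "slide G a1 b1 a2 c2 b3 c3 = G\<lparr>vx := (\<lambda>h.
              if h \<in> {b1, opp G b1, c2, opp G c2} then vx G a1
              else if h \<in> {a1, opp G a1, c3, opp G c3} then vx G b1
              else if h \<in> {a2, opp G a2, b3, opp G b3} then vx G c2
              else vx G h)\<rparr>"

lemma r3_move_triangle:
  assumes "r3_move G G'"
  obtains a1 b1 a2 c2 b3 c3 where "triangle G a1 b1 a2 c2 b3 c3" "G' = slide G a1 b1 a2 c2 b3 c3"
  using assms unfolding r3_move_def triangle_def slide_def by blast

lemma slide_simps [simp]:
  "darts (slide G a1 b1 a2 c2 b3 c3) = darts G" "edg (slide G a1 b1 a2 c2 b3 c3) = edg G"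
  "opp (slide G a1 b1 a2 c2 b3 c3) = opp G" "nloops (slide G a1 b1 a2 c2 b3 c3) = nloops G"
  by (simp_all add: slide_def)

lemma splice_apply: "splice x y s h = (if h = s y then s x else if h = s x then s y else s h)"
  by (simp add: splice_def)

lemma swap2_apply:
  "swap2 a b c d t h = (if h = d then c else if h = c then d else if h = b then a else if h = a then b else t h)"
  by (simp add: swap2_def)

text \<open>Strand \<open>i\<close> enters the triangle at the outer end \<open>p\<close> and leaves
  it at \<open>q\<close> with index \<open>i\<close>. The outer ends are parameters so that the
  locale can be instantiated for the slid graph with all \<open>p\<close> and \<open>q\<close>
  exchanged.\<close>

locale triangle_graph =
  fixes G a1 b1 a2 c2 b3 c3 p1 q1 p2 q2 p3 q3
  assumes w: "wf G" and tri: "triangle G a1 b1 a2 c2 b3 c3"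
    and pq: "opp G a1 = p1" "opp G b1 = q1" "opp G a2 = p2" "opp G c2 = q2" "opp G b3 = p3" "opp G c3 = q3"
begin

abbreviation "VA \<equiv> {a1, a2, p1, p2}"
abbreviation "VB \<equiv> {b1, b3, q1, p3}"
abbreviation "VC \<equiv> {c2, c3, q2, q3}"
abbreviation "ends \<equiv> {p1, q1, p2, q2, p3, q3}"
abbreviation "D \<equiv> del_darts {a1, b1, a2, c2, b3, c3} G"

lemma em: "edge_matched G"
  by (rule wf_edge_matched[OF w])

lemma tA: "a1 \<in> darts G" "a2 \<in> darts G" "vx G a2 = vx G a1" "a2 \<noteq> a1" "a2 \<noteq> opp G a1"
  and tB: "b1 \<in> darts G" "b3 \<in> darts G" "vx G b3 = vx G b1" "b3 \<noteq> b1" "b3 \<noteq> opp G b1"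
  and tC: "c2 \<in> darts G" "c3 \<in> darts G" "vx G c3 = vx G c2" "c3 \<noteq> c2" "c3 \<noteq> opp G c2"
  and te: "edg G a1 = b1" "edg G a2 = c2" "edg G b3 = c3"
  and tv: "vx G a1 \<noteq> vx G b1" "vx G a1 \<noteq> vx G c2" "vx G b1 \<noteq> vx G c2"
  using tri by (auto simp: triangle_def)

lemma te': "edg G b1 = a1" "edg G c2 = a2" "edg G c3 = b3"
  using te edge_matchedD(3)[OF em] tA tB by metis+

lemmas vertexA = wf_vertex[OF w tA, unfolded pq]
lemmas vertexB = wf_vertex[OF w tB, unfolded pq]
lemmas vertexC = wf_vertex[OF w tC, unfolded pq]

lemma pq': "opp G p1 = a1" "opp G q1 = b1" "opp G p2 = a2" "opp G q2 = c2" "opp G p3 = b3" "opp G q3 = c3"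
  using vertexA(3,4) vertexB(3,4) vertexC(3,4) by auto

lemma in_darts: "{a1, b1, a2, c2, b3, c3, p1, q1, p2, q2, p3, q3} \<subseteq> darts G"
  using tA tB tC vertexA(7,8) vertexB(7,8) vertexC(7,8) by auto

lemma vx_ends: "vx G p1 = vx G a1" "vx G p2 = vx G a1" "vx G q1 = vx G b1" "vx G p3 = vx G b1"
  "vx G q2 = vx G c2" "vx G q3 = vx G c2"
  using vertexA(5,6) vertexB(5,6) vertexC(5,6) by auto

lemma dist: "distinct [a1, a2, p1, p2, b1, b3, q1, p3, c2, c3, q2, q3]"
proof -
  have "vx G h = vx G a1" if "h \<in> VA" for h using that tA vx_ends by auto
  moreover have "vx G h = vx G b1" if "h \<in> VB" for h using that tB vx_ends by auto
  moreover have "vx G h = vx G c2" if "h \<in> VC" for h using that tC vx_ends by auto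
  ultimately have "VA \<inter> VB = {}" "VA \<inter> VC = {}" "VB \<inter> VC = {}"
    using tv by (metis disjoint_iff)+
  then show ?thesis using vertexA(2) vertexB(2) vertexC(2) by auto
qed

text \<open>Supplies each inequality in the opposite orientation, which the evaluations by
  \<open>ne\<close> need as well.\<close>

lemma dist_rev: "distinct [q3, q2, c3, c2, p3, q1, b3, b1, p2, p1, a2, a1]"
  using dist distinct_rev[of "[a1, a2, p1, p2, b1, b3, q1, p3, c2, c3, q2, q3]"] by (simp only: rev.simps append.simps)

lemmas ne = dist[simplified] dist_rev[simplified]

lemma closedA: "vertex_closed G VA" and closedB: "vertex_closed G VB" and closedC: "vertex_closed G VC"
  using vertex_closed_vertex[OF w tA] vertex_closed_vertex[OF w tB] vertex_closed_vertex[OF w tC] pq by simp_all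

end

text \<open>\<open>E\<close> stands for the even darts away from the triangle; \<open>F\<close> is
  the set smoothed when all three vertices are even.\<close>

locale triangle_env = triangle_graph +
  fixes E
  assumes E: "vertex_closed G E" and E_disj: "E \<inter> (VA \<union> VB \<union> VC) = {}"
begin

abbreviation "F \<equiv> E \<union> VC \<union> VB \<union> VA"

lemma E_ne: "h \<in> E \<Longrightarrow> h \<noteq> a1 \<and> h \<noteq> a2 \<and> h \<noteq> p1 \<and> h \<noteq> p2 \<and> h \<noteq> b1 \<and> h \<noteq> b3 \<and> h \<noteq> q1 \<and> h \<noteq> p3 \<and>
  h \<noteq> c2 \<and> h \<noteq> c3 \<and> h \<noteq> q2 \<and> h \<noteq> q3"
  using E_disj by blast

lemma E_darts: "E \<subseteq> darts G" and F_darts: "F \<subseteq> darts G"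
  using E in_darts by (auto simp: vertex_closed_def)

lemma F_rest: "F - {a1, b1, a2, c2, b3, c3} = E \<union> ends"
  using ne E_ne by blast

lemma two_edges_triangle: "matching F s \<Longrightarrow> s a1 \<noteq> b1 \<Longrightarrow> two_edges G F s a1 b1 a2 c2"
  by unfold_locales (use em F_darts te ne in auto)

lemma three_edges_triangle: "matching F s \<Longrightarrow> s a1 \<noteq> b1 \<Longrightarrow> splice a1 b1 s a2 \<noteq> c2 \<Longrightarrow> three_edges G F s a1 b1 a2 c2 b3 c3"
  by (intro three_edges.intro two_edges_triangle three_edges_axioms.intro) (use te ne in auto)

text \<open>If no cycle closes while the three sides are contracted, the smoothed graph depends only
  on the induced pairing \<open>\<mu>\<close> of the six outer ends and of \<open>E\<close>.\<close>

lemma reduce: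
  assumes "matching F s" "s a1 \<noteq> b1" "splice a1 b1 s a2 \<noteq> c2"
    "splice a2 c2 (splice a1 b1 s) b3 \<noteq> c3"
    and \<mu>: "\<And>h. h \<in> E \<union> ends \<Longrightarrow> splice b3 c3 (splice a2 c2 (splice a1 b1 s)) h = \<mu> h"
  shows "r2_equiv (reconnect G F s) K \<longleftrightarrow> r2_equiv (reconnect D (E \<union> ends) \<mu>) K"
proof -
  interpret three_edges G F s a1 b1 a2 c2 b3 c3 by (rule three_edges_triangle[OF assms(1-3)])
  have "same_graph (reconnect G F s) (reconnect D (E \<union> ends) (splice b3 c3 (splice a2 c2 (splice a1 b1 s))))"
    using contract3[OF assms(4)] unfolding F_rest .
  also have "\<dots> = reconnect D (E \<union> ends) \<mu>" by (rule reconnect_cong_fun) (rule \<mu>)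
  finally show ?thesis by (rule r2_equiv_cong)
qed

lemma closed_EC: "vertex_closed G (E \<union> VC)" and closed_ECB: "vertex_closed G (E \<union> VC \<union> VB)"
  using vertex_closed_Un E closedB closedC by blast+

text \<open>The vertices are stacked in the order \<open>C\<close>, \<open>B\<close>,
  \<open>A\<close> on top of \<open>E\<close>, so that three applications of
  \<open>odd_count_split\<close> enumerate the eight smoothings.\<close>

sublocale C: local_vertex "opp G" "vx G" E c2 c3 q2 q3
  using local_vertex_wf[OF w tC E] E_ne pq by auto

sublocale B: local_vertex "opp G" "vx G" "E \<union> VC" b1 b3 q1 p3
proof -
  have "b1 \<notin> E \<union> VC" using E_ne ne by auto
  from local_vertex_wf[OF w tB closed_EC this] show "local_vertex (opp G) (vx G) (E \<union> VC) b1 b3 q1 p3"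
    unfolding pq .
qed

sublocale A: local_vertex "opp G" "vx G" "E \<union> VC \<union> VB" a1 a2 p1 p2
proof -
  have "a1 \<notin> E \<union> VC \<union> VB" using E_ne ne by auto
  from local_vertex_wf[OF w tA closed_ECB this] show "local_vertex (opp G) (vx G) (E \<union> VC \<union> VB) a1 a2 p1 p2"
    unfolding pq .
qed

text \<open>After all three vertices are smoothed, only a pairing \<open>x-y\<close>, \<open>z-u\<close>, \<open>v'-w'\<close> of the six
outer ends of the triangle matters.\<close>

definition reduced :: "fgraph \<Rightarrow> nat \<Rightarrow> nat \<Rightarrow> nat \<Rightarrow> nat \<Rightarrow> nat \<Rightarrow> nat \<Rightarrow> (nat \<Rightarrow> nat) \<Rightarrow> bool" where
  "reduced K x y z u v' w' t \<longleftrightarrow> r2_equiv (reconnect D (E \<union> ends) (swap2 x y z u (t(v' := w', w' := v')))) K"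

lemma matching_F:
  assumes "t \<in> smoothings (opp G) (vx G) E"
    and "sC = swap2 c2 c3 q2 q3 t \<or> sC = swap2 c2 q3 c3 q2 t"
    and "sB = swap2 b1 b3 q1 p3 sC \<or> sB = swap2 b1 p3 b3 q1 sC"
    and "s = swap2 a1 a2 p1 p2 sB \<or> s = swap2 a1 p2 a2 p1 sB"
  shows "matching F s"
proof -
  have "sC \<in> smoothings (opp G) (vx G) (E \<union> VC)" using C.swap2_smoothing[OF assms(1)] assms(2) by metis
  then have "sB \<in> smoothings (opp G) (vx G) (E \<union> VC \<union> VB)" using B.swap2_smoothing assms(3) by metis
  then have "s \<in> smoothings (opp G) (vx G) F" using A.swap2_smoothing assms(4) by metis
  then show ?thesis by (rule smoothings_matching)
qed

text \<open>Turning inward at every vertex closes the three sides into one cycle, detected when the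
  third side is reached.\<close>

lemma corner_loop:
  assumes "t \<in> smoothings (opp G) (vx G) E"
    and s: "s = swap2 a1 a2 p1 p2 (swap2 b1 b3 q1 p3 (swap2 c2 c3 q2 q3 t))"
  shows "nloops (reconnect G F s) > 0"
proof -
  have "matching F s" by (rule matching_F[OF assms(1)]) (use s in auto)
  then interpret three_edges G F s a1 b1 a2 c2 b3 c3
    by (rule three_edges_triangle) (simp_all add: s splice_apply swap2_apply ne)
  show ?thesis by (rule loop3) (simp add: s splice_apply swap2_apply ne)
qed

lemmas eval_simps = splice_apply swap2_apply ne if_True if_False fun_upd_apply simp_thms

text \<open>The digits give the smoothings at the vertices \<open>A\<close>, \<open>B\<close>, \<open>C\<close>: 0 joins the two triangle
sides meeting there to each other, 1 joins each of them to an outer end.\<close>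

lemma reduce_cases:
  assumes t: "t \<in> smoothings (opp G) (vx G) E"
  shows
    reduce_001: "r2_equiv (reconnect G F (swap2 a1 a2 p1 p2 (swap2 b1 b3 q1 p3 (swap2 c2 q3 c3 q2 t)))) K \<longleftrightarrow>
      reduced K p1 p2 q1 p3 q2 q3 t"
    and reduce_010: "r2_equiv (reconnect G F (swap2 a1 a2 p1 p2 (swap2 b1 p3 b3 q1 (swap2 c2 c3 q2 q3 t)))) K \<longleftrightarrow>
      reduced K p1 p2 q1 p3 q2 q3 t"
    and reduce_100: "r2_equiv (reconnect G F (swap2 a1 p2 a2 p1 (swap2 b1 b3 q1 p3 (swap2 c2 c3 q2 q3 t)))) K \<longleftrightarrow>
      reduced K p1 p2 q1 p3 q2 q3 t"
    and reduce_011: "r2_equiv (reconnect G F (swap2 a1 a2 p1 p2 (swap2 b1 p3 b3 q1 (swap2 c2 q3 c3 q2 t)))) K \<longleftrightarrow>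
      reduced K p1 p2 q1 q2 p3 q3 t"
    and reduce_101: "r2_equiv (reconnect G F (swap2 a1 p2 a2 p1 (swap2 b1 b3 q1 p3 (swap2 c2 q3 c3 q2 t)))) K \<longleftrightarrow>
      reduced K p1 q3 q1 p3 p2 q2 t"
    and reduce_110: "r2_equiv (reconnect G F (swap2 a1 p2 a2 p1 (swap2 b1 p3 b3 q1 (swap2 c2 c3 q2 q3 t)))) K \<longleftrightarrow>
      reduced K q2 q3 p2 p3 p1 q1 t"
    and reduce_111: "r2_equiv (reconnect G F (swap2 a1 p2 a2 p1 (swap2 b1 p3 b3 q1 (swap2 c2 q3 c3 q2 t)))) K \<longleftrightarrow>
      reduced K p1 q3 p2 p3 q1 q2 t"
proof -
  note I = disjI1[OF refl] and II = disjI2[OF refl]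
  show "r2_equiv (reconnect G F (swap2 a1 a2 p1 p2 (swap2 b1 b3 q1 p3 (swap2 c2 q3 c3 q2 t)))) K \<longleftrightarrow>
      reduced K p1 p2 q1 p3 q2 q3 t"
    unfolding reduced_def
    by (rule reduce[OF matching_F[OF t II I I]], simp_all only: eval_simps Un_iff)
      (elim disjE insertE emptyE, drule E_ne, simp_all add: eval_simps)
  show "r2_equiv (reconnect G F (swap2 a1 a2 p1 p2 (swap2 b1 p3 b3 q1 (swap2 c2 c3 q2 q3 t)))) K \<longleftrightarrow>
      reduced K p1 p2 q1 p3 q2 q3 t"
    unfolding reduced_def
    by (rule reduce[OF matching_F[OF t I II I]], simp_all only: eval_simps Un_iff)
      (elim disjE insertE emptyE, drule E_ne, simp_all add: eval_simps)
  show "r2_equiv (reconnect G F (swap2 a1 p2 a2 p1 (swap2 b1 b3 q1 p3 (swap2 c2 c3 q2 q3 t)))) K \<longleftrightarrow>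
      reduced K p1 p2 q1 p3 q2 q3 t"
    unfolding reduced_def
    by (rule reduce[OF matching_F[OF t I I II]], simp_all only: eval_simps Un_iff)
      (elim disjE insertE emptyE, drule E_ne, simp_all add: eval_simps)
  show "r2_equiv (reconnect G F (swap2 a1 a2 p1 p2 (swap2 b1 p3 b3 q1 (swap2 c2 q3 c3 q2 t)))) K \<longleftrightarrow>
      reduced K p1 p2 q1 q2 p3 q3 t"
    unfolding reduced_def
    by (rule reduce[OF matching_F[OF t II II I]], simp_all only: eval_simps Un_iff)
      (elim disjE insertE emptyE, drule E_ne, simp_all add: eval_simps)
  show "r2_equiv (reconnect G F (swap2 a1 p2 a2 p1 (swap2 b1 b3 q1 p3 (swap2 c2 q3 c3 q2 t)))) K \<longleftrightarrow>
      reduced K p1 q3 q1 p3 p2 q2 t"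
    unfolding reduced_def
    by (rule reduce[OF matching_F[OF t II I II]], simp_all only: eval_simps Un_iff)
      (elim disjE insertE emptyE, drule E_ne, simp_all add: eval_simps)
  show "r2_equiv (reconnect G F (swap2 a1 p2 a2 p1 (swap2 b1 p3 b3 q1 (swap2 c2 c3 q2 q3 t)))) K \<longleftrightarrow>
      reduced K q2 q3 p2 p3 p1 q1 t"
    unfolding reduced_def
    by (rule reduce[OF matching_F[OF t I II II]], simp_all only: eval_simps Un_iff)
      (elim disjE insertE emptyE, drule E_ne, simp_all add: eval_simps)
  show "r2_equiv (reconnect G F (swap2 a1 p2 a2 p1 (swap2 b1 p3 b3 q1 (swap2 c2 q3 c3 q2 t)))) K \<longleftrightarrow>
      reduced K p1 q3 p2 p3 q1 q2 t"
    unfolding reduced_def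
    by (rule reduce[OF matching_F[OF t II II II]], simp_all only: eval_simps Un_iff)
      (elim disjE insertE emptyE, drule E_ne, simp_all add: eval_simps)
qed

text \<open>The all-0 smoothing creates a free loop, and two of the three coinciding terms cancel.\<close>

lemma odd_count_triangle:
  assumes nk: "\<not> killed K"
  shows "odd_count (\<lambda>s. r2_equiv (reconnect G F s) K) (opp G) (vx G) F \<longleftrightarrow>
    ((((odd_count (reduced K p1 p2 q1 p3 q2 q3) (opp G) (vx G) E \<noteq>
        odd_count (reduced K p1 p2 q1 q2 p3 q3) (opp G) (vx G) E) \<noteq>
       odd_count (reduced K p1 q3 q1 p3 p2 q2) (opp G) (vx G) E) \<noteq>
      odd_count (reduced K q2 q3 p2 p3 p1 q1) (opp G) (vx G) E) \<noteq>
     odd_count (reduced K p1 q3 p2 p3 q1 q2) (opp G) (vx G) E)"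
proof -
  let ?N = "\<lambda>P. odd_count P (opp G) (vx G) E"
  let ?P = "\<lambda>s. r2_equiv (reconnect G F s) K"
  have cong: "?N P \<longleftrightarrow> ?N Q" if "\<And>t. t \<in> smoothings (opp G) (vx G) E \<Longrightarrow> P t \<longleftrightarrow> Q t" for P Q
    using that by (rule odd_count_cong[OF refl refl])
  have "\<not> ?N (\<lambda>t. ?P (swap2 a1 a2 p1 p2 (swap2 b1 b3 q1 p3 (swap2 c2 c3 q2 q3 t))))"
    by (rule odd_count_none) (use corner_loop killed_loop nk in blast)
  moreover have "?N (\<lambda>t. ?P (swap2 a1 a2 p1 p2 (swap2 b1 b3 q1 p3 (swap2 c2 q3 c3 q2 t)))) \<longleftrightarrow> ?N (reduced K p1 p2 q1 p3 q2 q3)"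
    by (rule cong) (rule reduce_001)
  moreover have "?N (\<lambda>t. ?P (swap2 a1 a2 p1 p2 (swap2 b1 p3 b3 q1 (swap2 c2 c3 q2 q3 t)))) \<longleftrightarrow> ?N (reduced K p1 p2 q1 p3 q2 q3)"
    by (rule cong) (rule reduce_010)
  moreover have "?N (\<lambda>t. ?P (swap2 a1 p2 a2 p1 (swap2 b1 b3 q1 p3 (swap2 c2 c3 q2 q3 t)))) \<longleftrightarrow> ?N (reduced K p1 p2 q1 p3 q2 q3)"
    by (rule cong) (rule reduce_100)
  moreover have "?N (\<lambda>t. ?P (swap2 a1 a2 p1 p2 (swap2 b1 p3 b3 q1 (swap2 c2 q3 c3 q2 t)))) \<longleftrightarrow> ?N (reduced K p1 p2 q1 q2 p3 q3)"
    by (rule cong) (rule reduce_011)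
  moreover have "?N (\<lambda>t. ?P (swap2 a1 p2 a2 p1 (swap2 b1 b3 q1 p3 (swap2 c2 q3 c3 q2 t)))) \<longleftrightarrow> ?N (reduced K p1 q3 q1 p3 p2 q2)"
    by (rule cong) (rule reduce_101)
  moreover have "?N (\<lambda>t. ?P (swap2 a1 p2 a2 p1 (swap2 b1 p3 b3 q1 (swap2 c2 c3 q2 q3 t)))) \<longleftrightarrow> ?N (reduced K q2 q3 p2 p3 p1 q1)"
    by (rule cong) (rule reduce_110)
  moreover have "?N (\<lambda>t. ?P (swap2 a1 p2 a2 p1 (swap2 b1 p3 b3 q1 (swap2 c2 q3 c3 q2 t)))) \<longleftrightarrow> ?N (reduced K p1 q3 p2 p3 q1 q2)"
    by (rule cong) (rule reduce_111)
  moreover have "odd_count ?P (opp G) (vx G) F \<longleftrightarrow>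
    ((((?N (\<lambda>t. ?P (swap2 a1 a2 p1 p2 (swap2 b1 b3 q1 p3 (swap2 c2 c3 q2 q3 t)))) \<noteq>
     ?N (\<lambda>t. ?P (swap2 a1 a2 p1 p2 (swap2 b1 b3 q1 p3 (swap2 c2 q3 c3 q2 t))))) \<noteq>
    (?N (\<lambda>t. ?P (swap2 a1 a2 p1 p2 (swap2 b1 p3 b3 q1 (swap2 c2 c3 q2 q3 t)))) \<noteq>
     ?N (\<lambda>t. ?P (swap2 a1 a2 p1 p2 (swap2 b1 p3 b3 q1 (swap2 c2 q3 c3 q2 t)))))) \<noteq>
   ((?N (\<lambda>t. ?P (swap2 a1 p2 a2 p1 (swap2 b1 b3 q1 p3 (swap2 c2 c3 q2 q3 t)))) \<noteq>
     ?N (\<lambda>t. ?P (swap2 a1 p2 a2 p1 (swap2 b1 b3 q1 p3 (swap2 c2 q3 c3 q2 t))))) \<noteq>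
    (?N (\<lambda>t. ?P (swap2 a1 p2 a2 p1 (swap2 b1 p3 b3 q1 (swap2 c2 c3 q2 q3 t)))) \<noteq>
     ?N (\<lambda>t. ?P (swap2 a1 p2 a2 p1 (swap2 b1 p3 b3 q1 (swap2 c2 q3 c3 q2 t))))))))"
    by (simp only: A.odd_count_split B.odd_count_split C.odd_count_split)
  ultimately show ?thesis by argo
qed

end

section \<open>Triangles in which only the vertex \<open>A\<close> is smoothed\<close>

lemma vertex_closedD: "vertex_closed G X \<Longrightarrow> a \<in> X \<Longrightarrow> h \<in> darts G \<Longrightarrow> vx G h = vx G a \<Longrightarrow> h \<in> X"
  by (simp add: vertex_closed_def)

lemma matching_Un: "matching X s \<Longrightarrow> matching Y s \<Longrightarrow> matching (X \<union> Y) s"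
  by (auto simp: matching_def)

lemma matching_cong: "matching X s \<Longrightarrow> (\<And>h. h \<in> X \<Longrightarrow> t h = s h) \<Longrightarrow> matching X t"
  by (simp add: matching_def)

context triangle_env
begin

lemma sub_A: "E \<union> VA \<subseteq> darts G" "VA \<union> E \<subseteq> darts G" "VA \<inter> E = {}"
  using E_darts in_darts E_disj by auto

lemma local_A: "local_vertex (opp G) (vx G) E a1 a2 p1 p2"
  using local_vertex_wf[OF w tA E] E_ne pq by auto

text \<open>This smoothing turns the triangle into a bigon, which a second move removes.\<close>

lemma cut_even_vertex:
  assumes t: "t \<in> smoothings (opp G) (vx G) E"
  shows "r2_equiv (reconnect G (E \<union> VA) (swap2 a1 a2 p1 p2 t)) K \<longleftrightarrow> reduced K p1 p2 q1 q2 p3 q3 t"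
proof -
  let ?s = "swap2 a1 a2 p1 p2 t" and ?Z = "VB \<union> VC"
  \<comment> \<open>\<open>r\<close> smooths \<open>A\<close> and \<open>E\<close> but runs straight
    through \<open>B\<close> and \<open>C\<close>; the second move removing the bigon is this
    straight passage.\<close>
  define r where "r = (\<lambda>h. if h \<in> ?Z then opp G h else ?s h)"
  let ?H = "reconnect G VA ?s"
  have mt: "matching E t" using t smoothings_matching by blast
  have sE: "?s h = t h" if "h \<in> E" for h using E_ne[OF that] by (simp add: swap2_apply)
  have mA: "matching VA ?s" by (simp add: matching_def swap2_apply ne)
  have mE: "matching E ?s" using mt sE by (simp add: matching_def)
  have rs: "r h = ?s h" if "h \<in> VA \<union> E" for h
    using that ne E_ne[of h] by (auto simp: r_def)
  have mZ: "matching ?Z (opp G)" using vertex_closed_opp[OF w] vertex_closed_Un closedB closedC by blast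
  have rZ: "r h = opp G h" if "h \<in> ?Z" for h using that by (simp add: r_def)
  have mr: "matching VA r" "matching E r" "matching ?Z r"
    by (rule matching_cong[OF mA], rule rs, blast, rule matching_cong[OF mE], rule rs, blast,
      rule matching_cong[OF mZ], rule rZ)
  have emH: "edge_matched ?H" by (rule edge_matched_reconnect[OF em _ mA]) (use sub_A in blast)
  have wH: "wf ?H" by (rule wf_reconnect[OF w closedA mA])
  have dH: "{b1, b3, c2, c3} \<subseteq> darts ?H" using in_darts ne by auto
  \<comment> \<open>Pairing \<open>a1\<close> with \<open>a2\<close> concatenates two sides of the
    triangle into an edge from \<open>B\<close> to \<open>C\<close>, which bounds a bigon with the
    third side.\<close>
  have "edg ?H b1 = c2"
    by (rule edg_reconnect_path[OF em mA, where x = a1 and y = a2]) (use in_darts te te' ne in \<open>auto simp: swap2_apply\<close>)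
  moreover have "edg ?H b3 = c3"
    using edg_reconnect_same[OF em, of b3 VA ?s] in_darts te ne by auto
  ultimately have bi: "bigon ?H b1 b3 c2 c3"
    using dH tB tC tv by (auto simp: bigon_def)
  have Z: "?Z = {k \<in> darts ?H. vx ?H k = vx ?H b1 \<or> vx ?H k = vx ?H c2}"
    using bigon_vertices(4)[OF wH bi] pq by simp
  have EH: "vertex_closed ?H E" using E sub_A unfolding vertex_closed_def by auto
  have EZ: "E \<inter> ?Z = {}" using E_disj by blast
  have "same_graph (reconnect G (VA \<union> E) ?s) (reconnect ?H E ?s)"
    using reconnect_reconnect[OF em sub_A(2,3) mA mE] same_graph_sym by blast
  also have "reconnect ?H E ?s = reconnect ?H E t" by (rule reconnect_cong_fun) (rule sE)
  finally have 1: "r2_equiv (reconnect G (VA \<union> E) ?s) K \<longleftrightarrow> r2_equiv (reconnect ?H E t) K"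
    by (rule r2_equiv_cong)
  have 2: "r2_equiv (reconnect ?H E t) K \<longleftrightarrow> r2_equiv (reconnect (reconnect ?H ?Z (opp G)) E t) K"
    using bigon_straight_reconnect[OF wH bi Z EH EZ mt] by simp
  have "same_graph (reconnect (reconnect ?H ?Z (opp G)) E t) (reconnect (reconnect ?H ?Z r) E r)"
  proof (rule reconnect_cong)
    have "reconnect ?H ?Z (opp G) = reconnect ?H ?Z r" by (rule reconnect_cong_fun) (use rZ in simp)
    then show "same_graph (reconnect ?H ?Z (opp G)) (reconnect ?H ?Z r)" by simp
  qed (use rs sE in simp)
  also have "same_graph \<dots> (reconnect ?H (?Z \<union> E) r)"
  proof (rule reconnect_reconnect[OF emH _ _ mr(3,2)])
    show "?Z \<union> E \<subseteq> darts ?H" using E_darts in_darts ne E_ne by auto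
  qed (use EZ in blast)
  also have "same_graph \<dots> (reconnect (reconnect G VA r) (?Z \<union> E) r)"
  proof (rule reconnect_cong)
    have "?H = reconnect G VA r" by (rule reconnect_cong_fun, rule rs[symmetric], blast)
    then show "same_graph ?H (reconnect G VA r)" by simp
  qed simp
  also have "same_graph \<dots> (reconnect G (VA \<union> (?Z \<union> E)) r)"
  proof (rule reconnect_reconnect[OF em _ _ mr(1)])
    show "VA \<union> (?Z \<union> E) \<subseteq> darts G" using E_darts in_darts by auto
    show "VA \<inter> (?Z \<union> E) = {}" using E_ne ne by auto
    show "matching (?Z \<union> E) r" by (rule matching_Un[OF mr(3,2)])
  qed
  also have "VA \<union> (?Z \<union> E) = F" by blast
  finally have 3: "r2_equiv (reconnect (reconnect ?H ?Z (opp G)) E t) K \<longleftrightarrow> r2_equiv (reconnect G F r) K"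
    by (rule r2_equiv_cong)
  have "matching (E \<union> (VC \<union> VB) \<union> VA) r"
    using matching_Un[OF matching_Un[OF mr(2)] mr(1), of "VC \<union> VB"] mr(3) by (simp only: Un_commute)
  then have mF: "matching F r" by (simp only: Un_assoc)
  have rv: "r a1 = a2" "r a2 = a1" "r p1 = p2" "r p2 = p1" "r b1 = q1" "r q1 = b1" "r c2 = q2" "r q2 = c2"
    "r b3 = p3" "r p3 = b3" "r c3 = q3" "r q3 = c3"
    using pq pq' by (simp_all add: r_def swap2_apply ne)
  \<comment> \<open>Strands 1 and 2 turn at \<open>A\<close>, giving the pairs \<open>p1\<close>,
    \<open>p2\<close> and \<open>q1\<close>, \<open>q2\<close>; strand 3 passes straight from
    \<open>p3\<close> to \<open>q3\<close>.\<close>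
  have 4: "r2_equiv (reconnect G F r) K \<longleftrightarrow> reduced K p1 p2 q1 q2 p3 q3 t"
    unfolding reduced_def
  proof (rule reduce[OF mF])
    fix h assume "h \<in> E \<union> ends"
    then show "splice b3 c3 (splice a2 c2 (splice a1 b1 r)) h = swap2 p1 p2 q1 q2 (t(p3 := q3, q3 := p3)) h"
    proof
      assume "h \<in> E"
      then show ?thesis using E_ne[of h] rs[of h] sE[of h] by (simp add: eval_simps rv)
    next
      assume "h \<in> ends"
      then show ?thesis by (elim insertE emptyE) (simp_all only: eval_simps rv)
    qed
  qed (simp_all only: eval_simps rv)
  have "E \<union> VA = VA \<union> E" by (rule Un_commute)
  then show ?thesis using 1 2 3 4 by simp
qed

text \<open>Each pair of this smoothing amounts to deleting one of the two sides at
  \<open>A\<close>, with \<open>b1\<close> replacing \<open>p2\<close> and \<open>c2\<close>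
  replacing \<open>p1\<close>. On the level of edges, the target deletes two whole sides and favours
  neither end of them, so the slid graph leads to the same one.\<close>

lemma through_even_vertex:
  assumes t: "t \<in> smoothings (opp G) (vx G) E"
  shows "edge_iso (id(b1 := p2, c2 := p1)) (reconnect G (E \<union> VA) (swap2 a1 p2 a2 p1 t))
    (reconnect (del_darts {a1, b1, a2, c2} G) E t)"
proof -
  let ?s = "swap2 a1 p2 a2 p1 t"
  let ?J1 = "join a1 p2 G" and ?J2 = "join a2 p1 (join a1 p2 G)" and ?H = "reconnect G VA ?s"
  note e = edge_matchedD[OF em]
  have mt: "matching E t" using t smoothings_matching by blast
  have sE: "?s h = t h" if "h \<in> E" for h using E_ne[OF that] by (simp add: swap2_apply)
  have sv: "?s a1 = p2" "?s a2 = p1" "?s p1 = a2" "?s p2 = a1" by (simp_all add: swap2_apply ne)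
  have mA: "matching VA ?s" "matching {a2, p1} ?s" "matching {} ?s" by (simp_all add: matching_def swap2_apply ne)
  have mE: "matching E ?s" using mt sE by (simp add: matching_def)
  have em1: "edge_matched ?J1" by (rule edge_matched_join[OF em]) (use in_darts ne in auto)
  have em2: "edge_matched ?J2" by (rule edge_matched_join[OF em1]) (use in_darts ne in auto)
  have "same_graph (reconnect G (insert a1 (insert (?s a1) {a2, p1})) ?s) (reconnect (join a1 (?s a1) G) {a2, p1} ?s)"
    by (rule reconnect_insert_pair[OF em mA(2)]) (use in_darts ne sv in auto)
  then have "same_graph ?H (reconnect ?J1 {a2, p1} ?s)" using sv by (simp add: insert_commute)
  also have "same_graph \<dots> (reconnect ?J2 {} ?s)"
    using reconnect_insert_pair[OF em1 mA(3), of a2] in_darts ne sv by auto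
  also have "same_graph \<dots> ?J2" by (rule reconnect_empty[OF em2])
  finally have H: "same_graph ?H ?J2" .
  have emH: "edge_matched ?H" using em2 edge_matched_cong same_graph_sym H by blast
  have c2: "edg ?J1 a2 = c2"
  proof -
    have "edg G p2 \<noteq> a2" using e(3)[of p2] te ne in_darts by auto
    then show ?thesis using te ne by (auto simp: join_def)
  qed
  have i1: "edge_iso (id(b1 := p2)) ?J1 (del_darts {a1, b1} G)"
    by (rule edge_iso_join_del[OF em]) (use in_darts te ne in auto)
  have i2: "edge_iso (id(c2 := p1)) ?J2 (del_darts {a2, c2} ?J1)"
    by (rule edge_iso_join_del[OF em1]) (use in_darts c2 ne in auto)
  have "edge_iso (id(b1 := p2)) (del_darts {a2, c2} ?J1) (del_darts ((id(b1 := p2)) ` {a2, c2}) (del_darts {a1, b1} G))"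
    by (rule edge_iso_del[OF i1]) (use in_darts ne in auto)
  moreover have "(id(b1 := p2)) ` {a2, c2} = {a2, c2}" using ne by auto
  moreover have "{a1, b1} \<union> {a2, c2} = {a1, b1, a2, c2}" by blast
  ultimately have "edge_iso (id(b1 := p2)) (del_darts {a2, c2} ?J1) (del_darts {a1, b1, a2, c2} G)"
    by (simp add: del_darts_del_darts)
  from edge_iso_comp[OF i2 this] have "edge_iso (id(b1 := p2) \<circ> id(c2 := p1)) ?J2 (del_darts {a1, b1, a2, c2} G)" .
  moreover have "id(b1 := p2) \<circ> id(c2 := p1) = id(b1 := p2, c2 := p1)" using ne by (auto simp: fun_eq_iff)
  ultimately have "edge_iso (id(b1 := p2, c2 := p1)) ?J2 (del_darts {a1, b1, a2, c2} G)" by simp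
  then have i: "edge_iso (id(b1 := p2, c2 := p1)) ?H (del_darts {a1, b1, a2, c2} G)"
    using edge_iso_cong[OF same_graph_sym[OF H] same_graph_refl em2] by simp
  have idE: "(id(b1 := p2, c2 := p1)) h = h" if "h \<in> E" for h using E_ne[OF that] by simp
  have "edge_iso (id(b1 := p2, c2 := p1)) (reconnect ?H E ?s)
     (reconnect (del_darts {a1, b1, a2, c2} G) ((id(b1 := p2, c2 := p1)) ` E) t)"
  proof (rule edge_iso_reconnect[OF i emH _ mE])
    show "E \<subseteq> darts ?H" using sub_A by auto
    fix h assume h: "h \<in> E"
    then have "t h \<in> E" using mt by (simp add: matching_def)
    then show "t ((id(b1 := p2, c2 := p1)) h) = (id(b1 := p2, c2 := p1)) (?s h)"
      using idE[OF h] idE[of "t h"] sE[OF h] by simp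
  qed
  moreover have "(id(b1 := p2, c2 := p1)) ` E = E" using idE by auto
  moreover have "same_graph (reconnect ?H E ?s) (reconnect G (E \<union> VA) ?s)"
    using reconnect_reconnect[OF em sub_A(2,3) mA(1) mE] by (simp add: Un_commute)
  moreover have "edge_matched (reconnect ?H E ?s)"
    by (rule edge_matched_reconnect[OF emH _ mE]) (use sub_A in auto)
  ultimately show ?thesis using edge_iso_cong[OF _ same_graph_refl] by simp
qed

end

section \<open>Comparison of a triangle with its slide\<close>

locale triangle_slide = triangle_env +
  assumes w': "wf (slide G a1 b1 a2 c2 b3 c3)"
begin

abbreviation "S \<equiv> slide G a1 b1 a2 c2 b3 c3"

lemma vx_S: "h \<in> {b1, q1, c2, q2} \<Longrightarrow> vx S h = vx G a1" "h \<in> {a1, p1, c3, q3} \<Longrightarrow> vx S h = vx G b1"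
  "h \<in> {a2, p2, b3, p3} \<Longrightarrow> vx S h = vx G c2" "h \<notin> VA \<union> VB \<union> VC \<Longrightarrow> vx S h = vx G h"
proof -
  have 1: "vx S h = (if h \<in> {b1, q1, c2, q2} then vx G a1 else if h \<in> {a1, p1, c3, q3} then vx G b1
              else if h \<in> {a2, p2, b3, p3} then vx G c2 else vx G h)"
    by (simp add: slide_def pq)
  show "h \<in> {b1, q1, c2, q2} \<Longrightarrow> vx S h = vx G a1" unfolding 1 by simp
  show "h \<in> {a1, p1, c3, q3} \<Longrightarrow> vx S h = vx G b1" unfolding 1 using ne by auto
  show "h \<in> {a2, p2, b3, p3} \<Longrightarrow> vx S h = vx G c2" unfolding 1 using ne by auto
  show "h \<notin> VA \<union> VB \<union> VC \<Longrightarrow> vx S h = vx G h" unfolding 1 by simp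
qed

lemma vx_ABC: "h \<in> VA \<Longrightarrow> vx G h = vx G a1" "h \<in> VB \<Longrightarrow> vx G h = vx G b1" "h \<in> VC \<Longrightarrow> vx G h = vx G c2"
  using tA(3) tB(3) tC(3) vx_ends by auto

lemma vx_S_cases: "h \<in> VA \<union> VB \<union> VC \<Longrightarrow> vx S h \<in> {vx G a1, vx G b1, vx G c2}"
  using vx_S(1-3)[of h] by blast

lemma vx_outside:
  assumes "h \<in> darts G" "h \<notin> VA \<union> VB \<union> VC" shows "vx G h \<notin> {vx G a1, vx G b1, vx G c2}"
  using vertex_closedD[OF closedA, of a1 h] vertex_closedD[OF closedB, of b1 h]
    vertex_closedD[OF closedC, of c2 h] assms by blast

lemma vx_S_eq_iff:
  assumes "h \<in> darts G" "h \<notin> VA \<union> VB \<union> VC" shows "vx S k = vx S h \<longleftrightarrow> vx G k = vx G h"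
proof (cases "k \<in> VA \<union> VB \<union> VC")
  case True
  then have "vx G k \<in> {vx G a1, vx G b1, vx G c2}" using vx_ABC[of k] by blast
  then have "vx S k \<noteq> vx G h" "vx G k \<noteq> vx G h"
    using vx_S_cases[OF True] vx_outside[OF assms] by metis+
  then show ?thesis using vx_S(4)[OF assms(2)] by simp
qed (use vx_S(4) assms in simp)

lemma E_outside: "h \<in> E \<Longrightarrow> h \<in> darts G \<and> h \<notin> VA \<union> VB \<union> VC"
  using E_darts E_disj by blast

text \<open>In the slid graph the two ends of each side have changed places, so the same description
  applies with \<open>a1\<close>, \<open>b1\<close> and \<open>a2\<close>, \<open>c2\<close> and
  \<open>b3\<close>, \<open>c3\<close> interchanged. All results on triangles thereby hold on both
  sides of the move.\<close>

lemma triangle_S: "triangle S b1 a1 c2 a2 c3 b3"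
  using tri te' tv pq ne vx_S(1)[of b1] vx_S(1)[of c2] vx_S(2)[of a1] vx_S(2)[of c3] vx_S(3)[of a2] vx_S(3)[of b3]
  by (simp add: triangle_def)

lemma env_S: "triangle_env S b1 a1 c2 a2 c3 b3 q1 p1 q2 p2 q3 p3 E"
proof
  show "wf S" by (rule w')
  show "triangle S b1 a1 c2 a2 c3 b3" by (rule triangle_S)
  show "vertex_closed S E"
    unfolding vertex_closed_def
  proof (intro conjI ballI impI)
    show "E \<subseteq> darts S" using E_darts by simp
    fix h k assume h: "h \<in> E" and k: "k \<in> darts S" "vx S k = vx S h"
    then have "vx G k = vx G h" using vx_S_eq_iff[of h k] E_outside[OF h] by blast
    then show "k \<in> E" using vertex_closedD[OF E h, of k] k(1) by simp
  qed
  show "E \<inter> ({b1, c2, q1, q2} \<union> {a1, c3, p1, q3} \<union> {a2, b3, p2, p3}) = {}"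
    using E_disj by blast
qed (simp_all add: pq)

sublocale S: triangle_env S b1 a1 c2 a2 c3 b3 q1 p1 q2 p2 q3 p3 E
  by (rule env_S)

lemma smoothings_S: "smoothings (opp S) (vx S) E = smoothings (opp G) (vx G) E"
  by (rule smoothings_cong) (use vx_S(4) E_outside in auto)

text \<open>All relabelled darts belong to the triangle and disappear here, the side darts by
  deletion and the outer ends by reconnection.\<close>

lemma same_reconnect_S:
  "same_graph (reconnect S.D (E \<union> S.ends) \<mu>) (reconnect D (E \<union> ends) \<mu>)"
proof -
  have D: "{b1, a1, c2, a2, c3, b3} = {a1, b1, a2, c2, b3, c3}" "S.ends = ends" by blast+
  have "conn_rel S.D (E \<union> ends) \<mu> = conn_rel D (E \<union> ends) \<mu>"
    by (rule conn_rel_cong) auto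
  then show ?thesis
    using vx_S(4) unfolding D by (auto simp: same_graph_def reconnect_def)
qed

lemma reduced_S:
  assumes "swap2 x y z u (t(v' := w', w' := v')) = swap2 a b c d (t(e := f, f := e))"
  shows "S.reduced K x y z u v' w' t \<longleftrightarrow> reduced K a b c d e f t"
  unfolding S.reduced_def reduced_def assms by (rule r2_equiv_cong[OF same_reconnect_S])

lemma bracket_all_even:
  assumes "even_darts G = F" "even_darts S = F"
  shows "bracket G = bracket S"
proof
  fix K
  have F: "F = S.F" by blast
  \<comment> \<open>Exchanging every \<open>p\<close> with the \<open>q\<close> of its strand
    permutes the five pairings: three are fixed, and the one that occurs three times is swapped with
    the one turning outward at all three vertices.\<close>
  have r: "S.reduced K q1 q2 p1 q3 p2 p3 = reduced K p1 q3 p2 p3 q1 q2"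
    "S.reduced K q1 q2 p1 p2 q3 p3 = reduced K p1 p2 q1 q2 p3 q3"
    "S.reduced K q1 p3 p1 q3 q2 p2 = reduced K p1 q3 q1 p3 p2 q2"
    "S.reduced K p2 p3 q2 q3 q1 p1 = reduced K q2 q3 p2 p3 p1 q1"
    "S.reduced K q1 p3 q2 q3 p1 p2 = reduced K p1 p2 q1 p3 q2 q3"
    by (rule ext, rule reduced_S, rule ext, simp add: swap2_apply ne)+
  have o: "odd_count P (opp S) (vx S) E \<longleftrightarrow> odd_count P (opp G) (vx G) E" for P
    unfolding odd_count_def smoothings_S ..
  show "bracket G K = bracket S K"
  proof (cases "killed K")
    case False
    show ?thesis
      using odd_count_triangle[OF False] S.odd_count_triangle[OF False, folded F]
      unfolding bracket_eq_odd_count assms r o by argo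
  qed (simp add: bracket_def)
qed

text \<open>Here the two smoothed graphs are isomorphic, with the roles of the odd vertices \<open>B\<close> and
\<open>C\<close> exchanged.\<close>

lemma through_slide:
  assumes t: "t \<in> smoothings (opp G) (vx G) E"
  shows "r2_equiv (reconnect G (E \<union> VA) (swap2 a1 p2 a2 p1 t)) K \<longleftrightarrow>
    r2_equiv (reconnect S (E \<union> S.VA) (swap2 b1 q2 c2 q1 t)) K"
proof -
  let ?s = "swap2 a1 p2 a2 p1 t" and ?s' = "swap2 b1 q2 c2 q1 t"
  let ?H = "reconnect G (E \<union> VA) ?s" and ?H' = "reconnect S (E \<union> S.VA) ?s'"
  let ?M = "reconnect (del_darts {a1, b1, a2, c2} G) E t" and ?M' = "reconnect (del_darts {b1, a1, c2, a2} S) E t"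
  let ?g = "id(b1 := p2, c2 := p1)" and ?g' = "id(a1 := q2, a2 := q1)"
  \<comment> \<open>This is \<open>?g\<close> followed by the inverse of \<open>?g'\<close>.\<close>
  define f where "f = id(b1 := p2, c2 := p1, q1 := a2, q2 := a1)"
  interpret A: local_vertex "opp G" "vx G" E a1 a2 p1 p2 by (rule local_A)
  interpret A': local_vertex "opp S" "vx S" E b1 c2 q1 q2 by (rule S.local_A)
  have t': "t \<in> smoothings (opp S) (vx S) E" using t smoothings_S by simp
  have m: "matching (E \<union> VA) ?s" "matching (E \<union> S.VA) ?s'"
    by (rule smoothings_matching[OF A.swap2_smoothing(2)[OF t]])
      (rule smoothings_matching[OF A'.swap2_smoothing(2)[OF t']])
  have wH: "wf ?H" by (rule wf_reconnect[OF w vertex_closed_Un[OF E closedA] m(1)])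
  have wH': "wf ?H'" by (rule wf_reconnect[OF w' vertex_closed_Un[OF S.E S.closedA] m(2)])
  have i: "edge_iso ?g ?H ?M" by (rule through_even_vertex[OF t])
  have "edge_iso ?g' ?H' ?M'" by (rule S.through_even_vertex[OF t'])
  moreover have "darts ?M' = darts ?M" "nloops ?M' = nloops ?M" "edg ?M' = edg ?M"
  proof -
    have D: "{b1, a1, c2, a2} = {a1, b1, a2, c2}" by blast
    have "conn_rel (del_darts {b1, a1, c2, a2} S) E t = conn_rel (del_darts {a1, b1, a2, c2} G) E t"
      by (rule conn_rel_cong) auto
    then show "darts ?M' = darts ?M" "nloops ?M' = nloops ?M" "edg ?M' = edg ?M"
      unfolding D by (auto simp: reconnect_def)
  qed
  ultimately have i': "edge_iso ?g' ?H' ?M" by (simp add: edge_iso_def)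
  have fv: "f b1 = p2" "f c2 = p1" "f q1 = a2" "f q2 = a1" and fo: "h \<notin> {b1, c2, q1, q2} \<Longrightarrow> f h = h" for h
    using ne by (auto simp: f_def)
  have Hd: "h \<in> darts ?H \<longleftrightarrow> h \<in> darts G \<and> h \<notin> E \<and> h \<notin> VA" for h by auto
  have Hd': "h \<in> darts ?H' \<longleftrightarrow> h \<in> darts G \<and> h \<notin> E \<and> h \<notin> S.VA" for h by auto
  have nE: "p2 \<notin> E" "p1 \<notin> E" "a2 \<notin> E" "a1 \<notin> E" using E_ne by blast+
  have "edge_iso f ?H ?H'"
  proof (rule edge_iso_factor[OF i i' wf_edge_matched[OF wH] wf_edge_matched[OF wH']])
    fix h assume h: "h \<in> darts ?H"
    show "f h \<in> darts ?H' \<and> ?g' (f h) = ?g h"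
    proof (cases "h \<in> {b1, c2, q1, q2}")
      case True
      then show ?thesis unfolding Hd' using in_darts ne nE fv by auto
    next
      case False
      then show ?thesis using h fo[OF False] unfolding Hd Hd' by auto
    qed
  qed
  moreover have "f (opp ?H h) = opp ?H' (f h)" if h: "h \<in> darts ?H" for h
  proof (cases "h \<in> {b1, c2, q1, q2}")
    case True
    then show ?thesis using fv pq pq' by auto
  next
    case False
    have "opp G h \<notin> {b1, c2, q1, q2}"
    proof
      assume a: "opp G h \<in> {b1, c2, q1, q2}"
      have "opp G (opp G h) = h" using h w unfolding Hd by (auto simp: wf_def)
      then show False using a False pq pq' by auto
    qed
    then show ?thesis using fo False by simp
  qed
  moreover have "vx ?H h = vx ?H k \<longleftrightarrow> vx ?H' (f h) = vx ?H' (f k)" if h: "h \<in> darts ?H" and k: "k \<in> darts ?H" for h k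
  proof -
    \<comment> \<open>\<open>f\<close> carries the darts of \<open>B\<close> to the vertex labelled
      like \<open>C\<close> in the slid graph and conversely; \<open>\<tau>\<close> records this
      exchange of labels.\<close>
    define \<tau> where "\<tau> = id(vx G b1 := vx G c2, vx G c2 := vx G b1)"
    have inj: "\<tau> x = \<tau> y \<longleftrightarrow> x = y" for x y using tv(3) by (auto simp: \<tau>_def)
    have *: "vx S (f h) = \<tau> (vx G h)" if h: "h \<in> darts ?H" for h
    proof -
      consider "h \<in> VB" | "h \<in> VC" | "h \<notin> VA \<union> VB \<union> VC" using h unfolding Hd by blast
      then show ?thesis
      proof cases
        case 1
        then have "f h \<in> {a2, p2, b3, p3}" using fv fo ne by auto
        then show ?thesis using vx_S(3) vx_ABC(2)[OF 1] tv by (simp add: \<tau>_def)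
      next
        case 2
        then have "f h \<in> {a1, p1, c3, q3}" using fv fo ne by auto
        then show ?thesis using vx_S(2) vx_ABC(3)[OF 2] tv by (simp add: \<tau>_def)
      next
        case 3
        then have "f h = h" using fo by blast
        moreover have "vx G h \<notin> {vx G a1, vx G b1, vx G c2}" using vx_outside 3 h unfolding Hd by blast
        ultimately show ?thesis using vx_S(4)[OF 3] by (simp add: \<tau>_def)
      qed
    qed
    show ?thesis using *[OF h] *[OF k] inj by simp
  qed
  ultimately have "fg_iso ?H ?H'" unfolding fg_iso_iff_edge_iso by blast
  then show ?thesis using r2_equiv_fg_iso wH wH' by blast
qed

lemma bracket_one_even:
  assumes "even_darts G = E \<union> VA" "even_darts S = E \<union> S.VA"
  shows "bracket G = bracket S"
proof
  fix K
  interpret A: local_vertex "opp G" "vx G" E a1 a2 p1 p2 by (rule local_A)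
  interpret A': local_vertex "opp S" "vx S" E b1 c2 q1 q2 by (rule S.local_A)
  \<comment> \<open>Exchanging all \<open>p\<close> and \<open>q\<close> fixes this pairing, so the
    smoothings that produce a bigon agree on both sides of the move.\<close>
  have r: "S.reduced K q1 q2 p1 p2 q3 p3 t \<longleftrightarrow> reduced K p1 p2 q1 q2 p3 q3 t" for t
    by (rule reduced_S, rule ext, simp add: swap2_apply ne)
  have o: "odd_count P (opp S) (vx S) E \<longleftrightarrow> odd_count P (opp G) (vx G) E" for P
    unfolding odd_count_def smoothings_S ..
  have "odd_count (\<lambda>t. r2_equiv (reconnect G (E \<union> VA) (swap2 a1 a2 p1 p2 t)) K) (opp G) (vx G) E \<longleftrightarrow>
    odd_count (\<lambda>t. r2_equiv (reconnect S (E \<union> S.VA) (swap2 b1 c2 q1 q2 t)) K) (opp G) (vx G) E"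
    by (rule odd_count_cong[OF refl refl]) (use cut_even_vertex S.cut_even_vertex r smoothings_S in auto)
  moreover have "odd_count (\<lambda>t. r2_equiv (reconnect G (E \<union> VA) (swap2 a1 p2 a2 p1 t)) K) (opp G) (vx G) E \<longleftrightarrow>
    odd_count (\<lambda>t. r2_equiv (reconnect S (E \<union> S.VA) (swap2 b1 q2 c2 q1 t)) K) (opp G) (vx G) E"
    by (rule odd_count_cong[OF refl refl]) (rule through_slide)
  ultimately show "bracket G K = bracket S K"
    unfolding bracket_eq_odd_count assms A.odd_count_split A'.odd_count_split o by argo
qed

end

section \<open>Parities at the triangle and invariance under every step\<close>

lemma uni_rel_slide: "uni_rel (slide G a1 b1 a2 c2 b3 c3) = uni_rel G"
  by (simp add: uni_rel_def)

lemma num_unicursal_slide: "num_unicursal (slide G a1 b1 a2 c2 b3 c3) = num_unicursal G"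
  by (simp add: num_unicursal_def uni_rel_slide)

lemma three_part_union:
  assumes "A \<inter> B = {}" "A \<inter> C = {}" "B \<inter> C = {}" "V - (A \<union> B \<union> C) = E"
    and "\<And>h. h \<in> A \<Longrightarrow> h \<in> V \<longleftrightarrow> P" "\<And>h. h \<in> B \<Longrightarrow> h \<in> V \<longleftrightarrow> Q" "\<And>h. h \<in> C \<Longrightarrow> h \<in> V \<longleftrightarrow> R"
  shows "V = E \<union> (if P then A else {}) \<union> (if Q then B else {}) \<union> (if R then C else {})"
  using assms by auto

text \<open>Parity depends only on the two strands that meet at a vertex. The slide keeps the
  strands and the pair meeting under each label, so corresponding vertices have equal parity
  although their darts differ.\<close>

lemma triangle_slide_even:
  assumes w: "wf G" and tri: "triangle G a1 b1 a2 c2 b3 c3" and w': "wf (slide G a1 b1 a2 c2 b3 c3)"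
  defines "E \<equiv> even_darts G - ({a1, a2, opp G a1, opp G a2} \<union> {b1, b3, opp G b1, opp G b3} \<union> {c2, c3, opp G c2, opp G c3})"
  shows "triangle_slide G a1 b1 a2 c2 b3 c3 (opp G a1) (opp G b1) (opp G a2) (opp G c2) (opp G b3) (opp G c3) E"
    and "even_darts G = E \<union> (if (a1, a2) \<in> uni_rel G then {a1, a2, opp G a1, opp G a2} else {})
      \<union> (if (b1, b3) \<in> uni_rel G then {b1, b3, opp G b1, opp G b3} else {})
      \<union> (if (c2, c3) \<in> uni_rel G then {c2, c3, opp G c2, opp G c3} else {})" (is "_ = ?R")
    and "even_darts (slide G a1 b1 a2 c2 b3 c3) = E \<union> (if (a1, a2) \<in> uni_rel G then {b1, c2, opp G b1, opp G c2} else {})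
      \<union> (if (b1, b3) \<in> uni_rel G then {a1, c3, opp G a1, opp G c3} else {})
      \<union> (if (c2, c3) \<in> uni_rel G then {a2, b3, opp G a2, opp G b3} else {})" (is "_ = ?R'")
proof -
  interpret T: triangle_graph G a1 b1 a2 c2 b3 c3 "opp G a1" "opp G b1" "opp G a2" "opp G c2" "opp G b3" "opp G c3"
    by unfold_locales (use w tri in auto)
  have E: "vertex_closed G E" unfolding E_def
    by (intro vertex_closed_Diff vertex_closed_even_darts vertex_closed_Un T.closedA T.closedB T.closedC)
  show "triangle_slide G a1 b1 a2 c2 b3 c3 (opp G a1) (opp G b1) (opp G a2) (opp G c2) (opp G b3) (opp G c3) E"
    by unfold_locales (use E w' in \<open>auto simp: E_def\<close>)
  then interpret L: triangle_slide G a1 b1 a2 c2 b3 c3 "opp G a1" "opp G b1" "opp G a2" "opp G c2" "opp G b3" "opp G c3" E .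
  let ?X = "T.VA \<union> T.VB \<union> T.VC"
  note evA = even_darts_vertex[OF w T.tA] and evB = even_darts_vertex[OF w T.tB] and evC = even_darts_vertex[OF w T.tC]
  show "even_darts G = ?R"
    by (rule three_part_union[OF _ _ _ _ evA evB evC]) (use T.ne in \<open>auto simp: E_def\<close>)
  have st: "(a1, b1) \<in> uni_rel G" "(a2, c2) \<in> uni_rel G" "(b3, c3) \<in> uni_rel G"
    using uni_rel_edg T.in_darts T.te by fastforce+
  note sym = uni_rel_sym[OF w] and trans = uni_rel_trans[of _ _ G]
  have u: "(b1, c2) \<in> uni_rel G \<longleftrightarrow> (a1, a2) \<in> uni_rel G" "(a1, c3) \<in> uni_rel G \<longleftrightarrow> (b1, b3) \<in> uni_rel G"
    "(a2, b3) \<in> uni_rel G \<longleftrightarrow> (c2, c3) \<in> uni_rel G"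
    using st by (meson sym trans)+
  note evA' = even_darts_vertex[OF w' L.S.tA, unfolded uni_rel_slide u]
    and evB' = even_darts_vertex[OF w' L.S.tB, unfolded uni_rel_slide u]
    and evC' = even_darts_vertex[OF w' L.S.tC, unfolded uni_rel_slide u]
  have "even_darts (slide G a1 b1 a2 c2 b3 c3) - ?X = E"
    unfolding E_def even_darts_iff set_eq_iff Diff_iff uni_rel_slide using L.vx_S_eq_iff by auto
  moreover have "L.S.VA \<union> L.S.VB \<union> L.S.VC = ?X" by blast
  ultimately have "even_darts (slide G a1 b1 a2 c2 b3 c3) - (L.S.VA \<union> L.S.VB \<union> L.S.VC) = E" by simp
  then show "even_darts (slide G a1 b1 a2 c2 b3 c3) = ?R'"
    by (rule three_part_union[OF _ _ _ _ evA' evB' evC', rotated 3]) (use T.ne in auto)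
qed

lemma bracket_slide_all_even:
  assumes "wf G" "triangle G a1 b1 a2 c2 b3 c3" "wf (slide G a1 b1 a2 c2 b3 c3)"
    and "(a1, a2) \<in> uni_rel G" "(b1, b3) \<in> uni_rel G" "(c2, c3) \<in> uni_rel G"
  shows "bracket G = bracket (slide G a1 b1 a2 c2 b3 c3)"
proof -
  note * = triangle_slide_even[OF assms(1-3)]
  show ?thesis
    by (rule triangle_slide.bracket_all_even[OF *(1)]; use *(2,3) assms(4-6) in simp; blast)
qed

lemma bracket_slide_one_even:
  assumes "wf G" "triangle G a1 b1 a2 c2 b3 c3" "wf (slide G a1 b1 a2 c2 b3 c3)"
    and "(a1, a2) \<in> uni_rel G" "(b1, b3) \<notin> uni_rel G" "(c2, c3) \<notin> uni_rel G"
  shows "bracket G = bracket (slide G a1 b1 a2 c2 b3 c3)"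
proof -
  note * = triangle_slide_even[OF assms(1-3)]
  show ?thesis
    by (rule triangle_slide.bracket_one_even[OF *(1)]; use *(2,3) assms(4-6) in simp)
qed

lemma bracket_slide:
  assumes w: "wf G" and tri: "triangle G a1 b1 a2 c2 b3 c3" and w': "wf (slide G a1 b1 a2 c2 b3 c3)"
    and two: "num_unicursal G \<le> 2"
  shows "bracket G = bracket (slide G a1 b1 a2 c2 b3 c3)"
proof -
  interpret T: triangle_graph G a1 b1 a2 c2 b3 c3 "opp G a1" "opp G b1" "opp G a2" "opp G c2" "opp G b3" "opp G c3"
    by unfold_locales (use w tri in auto)
  let ?U = "uni_rel G"
  note sym = uni_rel_sym[OF w] and trans = uni_rel_trans[of _ _ G]
  have st: "(a1, b1) \<in> ?U" "(a2, c2) \<in> ?U" "(b3, c3) \<in> ?U"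
    using uni_rel_edg T.in_darts T.te by fastforce+
  \<comment> \<open>Three strands lie in at most two unicursal components, so some vertex is even.\<close>
  have "(a1, a2) \<in> ?U \<or> (b1, b3) \<in> ?U \<or> (c2, c3) \<in> ?U"
  proof (rule ccontr)
    assume c: "\<not> ?thesis"
    then have n: "(a1, a2) \<notin> ?U" "(a1, b3) \<notin> ?U" "(a2, b3) \<notin> ?U"
      using st by (meson sym trans)+
    then have "?U `` {a1} \<noteq> ?U `` {a2}" "?U `` {a1} \<noteq> ?U `` {b3}" "?U `` {a2} \<noteq> ?U `` {b3}"
      using eq_equiv_class_iff[OF uni_rel_equiv[OF w]] by auto
    then have "card {?U `` {a1}, ?U `` {a2}, ?U `` {b3}} = 3" by simp
    moreover have "{?U `` {a1}, ?U `` {a2}, ?U `` {b3}} \<subseteq> darts G // ?U"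
      using T.in_darts by (auto intro: quotientI)
    moreover have "finite (darts G // ?U)" using w by (simp add: quotient_def wf_def)
    ultimately have "3 \<le> card (darts G // ?U)" using card_mono by metis
    then show False using two by (simp add: num_unicursal_def)
  qed
  \<comment> \<open>Evenness at \<open>A\<close>, \<open>B\<close>, \<open>C\<close> means that
    strands 1 and 2, 1 and 3, 2 and 3 share a component; by transitivity two of these imply the
    third.\<close>
  moreover have "(a1, a2) \<in> ?U \<Longrightarrow> (b1, b3) \<in> ?U \<Longrightarrow> (c2, c3) \<in> ?U"
    "(a1, a2) \<in> ?U \<Longrightarrow> (c2, c3) \<in> ?U \<Longrightarrow> (b1, b3) \<in> ?U"
    "(b1, b3) \<in> ?U \<Longrightarrow> (c2, c3) \<in> ?U \<Longrightarrow> (a1, a2) \<in> ?U"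
    using st by (meson sym trans)+
  ultimately consider "(a1, a2) \<in> ?U" "(b1, b3) \<in> ?U" "(c2, c3) \<in> ?U"
    | "(a1, a2) \<in> ?U" "(b1, b3) \<notin> ?U" "(c2, c3) \<notin> ?U"
    | "(a1, a2) \<notin> ?U" "(b1, b3) \<in> ?U" "(c2, c3) \<notin> ?U"
    | "(a1, a2) \<notin> ?U" "(b1, b3) \<notin> ?U" "(c2, c3) \<in> ?U" by blast
  then show ?thesis
  proof cases
    case 1
    then show ?thesis using bracket_slide_all_even[OF w tri w'] by blast
  next
    case 2
    then show ?thesis using bracket_slide_one_even[OF w tri w'] by blast
  next
    case 3
    \<comment> \<open>Renaming makes the even vertex play the part of \<open>A\<close>: here
      \<open>A\<close> and \<open>B\<close> trade places, and strands 2 and 3 with them. The slide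
      itself does not depend on the naming.\<close>
    have t: "triangle G b1 a1 b3 c3 a2 c2"
      using tri T.te' T.te T.ne by (auto simp: triangle_def)
    have "slide G b1 a1 b3 c3 a2 c2 = slide G a1 b1 a2 c2 b3 c3"
      using T.ne T.tC(3) by (auto simp: slide_def fun_eq_iff)
    moreover have "(c3, c2) \<notin> ?U" using 3 sym by blast
    ultimately show ?thesis using bracket_slide_one_even[OF w t] 3 w' by simp
  next
    case 4
    \<comment> \<open>Here \<open>A\<close> and \<open>C\<close> trade places, as do strands 1 and
      3.\<close>
    have t: "triangle G c3 b3 c2 a2 b1 a1"
      using tri T.te' T.te T.ne by (auto simp: triangle_def)
    have "slide G c3 b3 c2 a2 b1 a1 = slide G a1 b1 a2 c2 b3 c3"
      using T.ne T.tA(3) T.tB(3) T.tC(3) by (auto simp: slide_def fun_eq_iff)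
    moreover have "(a2, a1) \<notin> ?U" "(b3, b1) \<notin> ?U" "(c3, c2) \<in> ?U" using 4 sym by blast+
    ultimately show ?thesis using bracket_slide_one_even[OF w t] w' by simp
  qed
qed

lemma num_unicursal_r1:
  assumes "r1_remove G G'" shows "num_unicursal G' = num_unicursal G"
proof -
  have w: "wf G" "wf G'" using assms by (auto simp: r1_remove_def)
  from r1_remove_straight[OF assms] show ?thesis
    using num_unicursal_straighten[OF w] vertex_closed_vertex[OF w(1)] by metis
qed

lemma num_unicursal_r2:
  assumes "r2_remove G G'" shows "num_unicursal G' = num_unicursal G"
proof -
  have w: "wf G" "wf G'" using assms by (auto simp: r2_remove_def)
  obtain x1 x2 y1 y2 where b: "bigon G x1 x2 y1 y2"
    and G': "G' = reconnect G {k \<in> darts G. vx G k = vx G x1 \<or> vx G k = vx G y1} (opp G)"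
    using r2_remove_bigon assms by blast
  show ?thesis
    by (rule num_unicursal_straighten[OF w, of "{k \<in> darts G. vx G k = vx G x1 \<or> vx G k = vx G y1}"])
      (auto simp: vertex_closed_def G')
qed

lemma bracket_r3:
  assumes "r3_move G G'" "num_unicursal G \<le> 2" shows "bracket G = bracket G'"
  using r3_move_triangle[OF assms(1)] bracket_slide assms unfolding r3_move_def by metis

lemma num_unicursal_r3: "r3_move G G' \<Longrightarrow> num_unicursal G' = num_unicursal G"
  by (metis r3_move_triangle num_unicursal_slide)

text \<open>The bound on components is there for the third move, and preserving their number keeps
  it available at each intermediate graph of a sequence.\<close>

lemma link_step_invariant:
  assumes "link_step G H" "num_unicursal G \<le> 2"
  shows "bracket G = bracket H \<and> num_unicursal H = num_unicursal G"
proof -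
  have w: "wf G" "wf H" using assms(1) by (auto simp: link_step_def)
  consider "fg_iso G H" | "r1_remove G H" | "r1_remove H G" | "r2_remove G H" | "r2_remove H G"
    | "r3_move G H" | "r3_move H G"
    using assms(1) by (auto simp: link_step_def)
  then show ?thesis
  proof cases
    case 1 then show ?thesis using bracket_fg_iso num_unicursal_fg_iso w by metis
  next
    case 2 then show ?thesis using bracket_r1 num_unicursal_r1 by metis
  next
    case 3 then show ?thesis using bracket_r1 num_unicursal_r1 by metis
  next
    case 4 then show ?thesis using bracket_r2 num_unicursal_r2 by metis
  next
    case 5 then show ?thesis using bracket_r2 num_unicursal_r2 by metis
  next
    case 6 then show ?thesis using bracket_r3 num_unicursal_r3 assms(2) by metis
  next
    case 7 then show ?thesis using bracket_r3 num_unicursal_r3 assms(2) by metis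
  qed
qed

theorem mainTheorem3:
  fixes G G' :: fgraph
  assumes "wf G" and "wf G'"
    and "num_unicursal G = 2" and "num_unicursal G' = 2"
    and "link_equiv G G'"
  shows "bracket G = bracket G'"
proof -
  have "link_step\<^sup>*\<^sup>* G G'" using assms(5) by (simp add: link_equiv_def)
  then have "bracket G = bracket G' \<and> num_unicursal G' = 2"
  proof (induction rule: rtranclp_induct)
    case base
    then show ?case using assms(3) by simp
  next
    case (step H K)
    then show ?case using link_step_invariant[of H K] by simp
  qed
  then show ?thesis by simp
qed

end
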